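(* Let $G,H$ be finite groups with $|G|=M+1$, $|H|=N+1$, $2\le|G|<|H|$ (so $N>M\ge1$), let $\mathcal B=G*H$, and let $\omega_1,\omega_2>0$. Let $\mathcal Y$ be the Cayley graph of $\mathcal B$ with generating set $(G\setminus\{e\})\sqcup(H\setminus\{e\})$, with edges corresponding to $G$ having weight $\omega_1$ and edges corresponding to $H$ having weight $\omega_2$, and with normalized Laplacian $\mathcal L_{\mathcal Y}$. Then the heat kernel function $k_t^{\mathcal Y}\colon\mathcal B\to\mathbb R$ ($t\ge0$) of $\mathcal L_{\mathcal Y}$ is given by $$k_t^{\mathcal Y}(x)=K_t^{\mathcal Y}(\pi_e(x)),\quad x\in\mathcal B,$$ where, for $n\in\mathbb Z$, $$K_t^{\mathcal Y}(n)=\frac1{\sqrt{|\pi_e^{-1}(n)|}}\Bigg(\sum_{k=1}^2e^{-t\lambda_k}f_k(0)f_k(n)+\int_0^\pi\sum_{\epsilon\in\{\pm1\}}e^{-t\lambda_{\epsilon,x}}F_{\epsilon,x}(0)^T\mathcal H_\epsilon(x)^{-1}F_{\epsilon,x}(n)\,\mathrm dx\Bigg),$$ with $\pi_e$, $\lambda_k$, $f_k$, $\lambda_{\epsilon,x}$, $F_{\epsilon,x}$ and $\mathcal H_\epsilon(x)$ the explicit objects defined in the context.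
   Context: **Laplacian and heat kernel.** Put $\kappa:=M\omega_1+N\omega_2$. On $\ell^2(\mathcal B)$, $$(\mathcal L_{\mathcal Y}f)(x)=f(x)-\frac1\kappa\Big(\sum_{a\in G\setminus\{e\}}\omega_1f(xa)+\sum_{b\in H\setminus\{e\}}\omega_2f(xb)\Big),\quad x\in\mathcal B.$$ The heat operator is $h_t^{\mathcal Y}=e^{-t\mathcal L_{\mathcal Y}}$, and the heat kernel function $k_t^{\mathcal Y}\colon\mathcal B\to\mathbb R$ is determined by $(h_t^{\mathcal Y}f)(x)=\sum_{y\in\mathcal B}k_t^{\mathcal Y}(y^{-1}x)f(y)$ for $f\in\ell^2(\mathcal B)$. **The map $\pi_e\colon\mathcal B\to\mathbb Z$.** With $|x|$ the length (number of syllables) of the reduced word of $x$: $\pi_e(e)=0$; $\pi_e(x)=|x|$ if the reduced form of $x$ starts with an element of $H$; $\pi_e(x)=-|x|$ if it starts with an element of $G$. Its fibers are finite: for $n\ge0$, $|\pi_e^{-1}(2n)|=M^nN^n$, $|\pi_e^{-1}(2n+1)|=M^nN^{n+1}$, and $|\pi_e^{-1}(-m)|$ ($m\ge0$) is obtained from $|\pi_e^{-1}(m)|$ by exchanging $M$ and $N$. **Discrete data.** $$\lambda_1=\frac{(N+1)\omega_2}{\kappa},\quad\lambda_2=1+\frac{\omega_1+\omega_2}{\kappa},\quad\beta_1=\sqrt{\frac{N-M}{(M+1)(N+1)}},\quad\beta_2=\sqrt{\frac{MN-1}{(M+1)(N+1)}}.$$ The functions $f_1,f_2\colon\mathbb Z\to\mathbb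 R$ are $$f_1(2n)=\beta_1(-1)^n\big(\tfrac MN\big)^{|n|/2},\qquad f_2(2n)=\beta_2(MN)^{-|n|/2}\qquad(n\in\mathbb Z),$$ and for $n\ge0$ $$f_1(2n+1)=\beta_1(-1)^{n+1}M^{n/2}N^{-(n+1)/2},\quad f_1(-2n-1)=\beta_1(-1)^nM^{(n+1)/2}N^{-n/2},$$ $$f_2(2n+1)=-\beta_2M^{-n/2}N^{-(n+1)/2},\quad f_2(-2n-1)=-\beta_2M^{-(n+1)/2}N^{-n/2}.$$ **Continuous data.** For $x\in(0,\pi)$, $\epsilon\in\{\pm1\}$: $$R_x=\sqrt{\big((M+1)\omega_1-(N+1)\omega_2\big)^2+4(M+N)\omega_1\omega_2+8\sqrt{MN}\,\omega_1\omega_2\cos x},$$ $$\lambda_{\epsilon,x}=\frac{(M+1)\omega_1+(N+1)\omega_2-\epsilon R_x}{2\kappa},\qquad\rho_{\epsilon,x}=\kappa(1-\lambda_{\epsilon,x}),$$ $$A_{\epsilon,x}=\rho_{\epsilon,x}-(N-1)\omega_2,\qquad B_{\epsilon,x}=\rho_{\epsilon,x}-(M-1)\omega_1,$$ $$D_{\epsilon,x}=\frac{A_{\epsilon,x}B_{\epsilon,x}\big((M-1)\omega_1+(N-1)\omega_2\big)-(A_{\epsilon,x}-B_{\epsilon,x})(M\omega_1^2-N\omega_2^2)}{2A_{\epsilon,x}\sqrt{MN}\,\omega_1\omega_2\sin x}.$$ Writing $A,B,D$ for $A_{\epsilon,x},B_{\epsilon,x},D_{\epsilon,x}$, the functions $f^{(1)}_{\epsilon,x},f^{(2)}_{\epsilon,x}\colon\mathbb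 Z\to\mathbb R$ are, for $n\ge0$, $$f^{(1)}_{\epsilon,x}(2n)=\cos nx,\qquad f^{(1)}_{\epsilon,x}(2n+1)=\frac{\sqrt N\omega_2\cos nx+\sqrt M\omega_1\cos((n+1)x)}{A},$$ $$f^{(1)}_{\epsilon,x}(-2n)=\cos nx+D\sin nx,$$ $$f^{(1)}_{\epsilon,x}(-2n-1)=\frac{\sqrt M\omega_1(\cos nx+D\sin nx)+\sqrt N\omega_2\big(\cos((n+1)x)+D\sin((n+1)x)\big)}{B},$$ $$f^{(2)}_{\epsilon,x}(2n)=\sin nx,\qquad f^{(2)}_{\epsilon,x}(2n+1)=\frac{\sqrt N\omega_2\sin nx+\sqrt M\omega_1\sin((n+1)x)}{A},$$ $$f^{(2)}_{\epsilon,x}(-2n)=-\frac BA\sin nx,\qquad f^{(2)}_{\epsilon,x}(-2n-1)=-\frac{\sqrt M\omega_1\sin nx+\sqrt N\omega_2\sin((n+1)x)}{A}.$$ Finally $$F_{\epsilon,x}(m)=\begin{pmatrix} f^{(1)}_{\epsilon,x}(m) \\ f^{(2)}_{\epsilon,x}(m) \end{pmatrix},\qquad\mathcal H_\epsilon(x)=\frac\pi2\Big(1+\frac BA\Big)\begin{pmatrix} 1+\frac AB+\frac ABD^2 & -D \\ -D & 1+\frac BA \end{pmatrix}.$$ *)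

theory Defs
  imports "HOL-Analysis.Analysis" "HOL-Algebra.Group"
begin

section \<open>Free product of two groups\<close>

text \<open>Elements of the free product are reduced words: lists of syllables
  \<^term>\<open>Inl a\<close> (nontrivial \<open>a\<close> in \<open>G\<close>) and \<^term>\<open>Inr b\<close> (nontrivial \<open>b\<close> in \<open>H\<close>) in which the
  two kinds alternate.\<close>

definition reduced_word ::
  "('a, 'c) monoid_scheme \<Rightarrow> ('b, 'd) monoid_scheme \<Rightarrow> ('a + 'b) list \<Rightarrow> bool" where
  "reduced_word G H w \<longleftrightarrow>
     set w \<subseteq> Inl ` (carrier G - {\<one>\<^bsub>G\<^esub>}) \<union> Inr ` (carrier H - {\<one>\<^bsub>H\<^esub>}) \<and>
     successively (\<lambda>s s'. isl s \<noteq> isl s') w"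

fun syl_mult :: "('a, 'c) monoid_scheme \<Rightarrow> ('b, 'd) monoid_scheme \<Rightarrow>
    'a + 'b \<Rightarrow> ('a + 'b) list \<Rightarrow> ('a + 'b) list" where
  "syl_mult G H (Inl a) (Inl b # w) =
     (if a \<otimes>\<^bsub>G\<^esub> b = \<one>\<^bsub>G\<^esub> then w else Inl (a \<otimes>\<^bsub>G\<^esub> b) # w)"
| "syl_mult G H (Inr a) (Inr b # w) =
     (if a \<otimes>\<^bsub>H\<^esub> b = \<one>\<^bsub>H\<^esub> then w else Inr (a \<otimes>\<^bsub>H\<^esub> b) # w)"
| "syl_mult G H s w = s # w"

definition free_product ::
  "('a, 'c) monoid_scheme \<Rightarrow> ('b, 'd) monoid_scheme \<Rightarrow> ('a + 'b) list monoid" where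
  "free_product G H =
     \<lparr>carrier = {w. reduced_word G H w}, mult = foldr (syl_mult G H), one = []\<rparr>"

lemma reduced_word_Nil [simp]: "reduced_word G H []"
  by (simp add: reduced_word_def)

lemma reduced_word_ConsD: "reduced_word G H (s # w) \<Longrightarrow> reduced_word G H w"
  by (auto simp: reduced_word_def successively_Cons)

lemma reduced_word_sylD:
  "reduced_word G H (s # w) \<Longrightarrow> reduced_word G H [s]"
  by (auto simp: reduced_word_def)

lemma reduced_word_Inl [simp]:
  "reduced_word G H [Inl a] \<longleftrightarrow> a \<in> carrier G \<and> a \<noteq> \<one>\<^bsub>G\<^esub>"
  by (auto simp: reduced_word_def)

lemma reduced_word_Inr [simp]:
  "reduced_word G H [Inr b] \<longleftrightarrow> b \<in> carrier H \<and> b \<noteq> \<one>\<^bsub>H\<^esub>"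
  by (auto simp: reduced_word_def)

lemma reduced_word_Cons_iff:
  "reduced_word G H (s # w) \<longleftrightarrow>
     s \<in> Inl ` (carrier G - {\<one>\<^bsub>G\<^esub>}) \<union> Inr ` (carrier H - {\<one>\<^bsub>H\<^esub>}) \<and>
     reduced_word G H w \<and> (w = [] \<or> isl s \<noteq> isl (hd w))"
  by (auto simp: reduced_word_def successively_Cons)

lemma syl_mult_reduced:
  assumes "group G" "group H" "reduced_word G H [s]" "reduced_word G H w"
  shows "reduced_word G H (syl_mult G H s w)"
proof -
  interpret G: group G by fact
  interpret H: group H by fact
  show ?thesis
    using assms(3,4)
    by (cases "(G, H, s, w)" rule: syl_mult.cases)
       (auto simp: reduced_word_Cons_iff split: if_splits)
qed

lemma syl_mult_syl_mult_Inl: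
  assumes "group G" "reduced_word G H [Inl a]" "reduced_word G H [Inl b]" "reduced_word G H w"
  shows "syl_mult G H (Inl a) (syl_mult G H (Inl b) w) =
    (if a \<otimes>\<^bsub>G\<^esub> b = \<one>\<^bsub>G\<^esub> then w else syl_mult G H (Inl (a \<otimes>\<^bsub>G\<^esub> b)) w)"
proof -
  interpret G: group G by fact
  have ab: "a \<in> carrier G" "b \<in> carrier G" "a \<noteq> \<one>\<^bsub>G\<^esub>" "b \<noteq> \<one>\<^bsub>G\<^esub>"
    using assms by auto
  show ?thesis
  proof (cases "\<exists>c v. w = Inl c # v")
    case True
    then obtain c v where w: "w = Inl c # v" by blast
    have c: "c \<in> carrier G" "c \<noteq> \<one>\<^bsub>G\<^esub>"
      using assms(4) by (auto simp: w reduced_word_Cons_iff)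
    have v: "syl_mult G H (Inl x) v = Inl x # v" for x
      using assms(4) by (cases v rule: list.exhaust; cases "hd v")
        (auto simp: w reduced_word_Cons_iff)
    have 1: "a \<otimes>\<^bsub>G\<^esub> b = \<one>\<^bsub>G\<^esub> \<Longrightarrow> a \<otimes>\<^bsub>G\<^esub> (b \<otimes>\<^bsub>G\<^esub> c) = c"
      using ab c by (metis G.l_one G.m_assoc)
    have 2: "b \<otimes>\<^bsub>G\<^esub> c = \<one>\<^bsub>G\<^esub> \<Longrightarrow> a \<otimes>\<^bsub>G\<^esub> b \<otimes>\<^bsub>G\<^esub> c = a"
      using ab c by (metis G.r_one G.m_assoc)
    show ?thesis
      using ab c 1 2 by (auto simp: w v G.m_assoc)
  next
    case False
    then have "syl_mult G H (Inl x) w = Inl x # w" for x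
      by (cases w; cases "hd w") auto
    then show ?thesis by auto
  qed
qed

lemma syl_mult_syl_mult_Inr:
  assumes "group H" "reduced_word G H [Inr a]" "reduced_word G H [Inr b]" "reduced_word G H w"
  shows "syl_mult G H (Inr a) (syl_mult G H (Inr b) w) =
    (if a \<otimes>\<^bsub>H\<^esub> b = \<one>\<^bsub>H\<^esub> then w else syl_mult G H (Inr (a \<otimes>\<^bsub>H\<^esub> b)) w)"
proof -
  interpret H: group H by fact
  have ab: "a \<in> carrier H" "b \<in> carrier H" "a \<noteq> \<one>\<^bsub>H\<^esub>" "b \<noteq> \<one>\<^bsub>H\<^esub>"
    using assms by auto
  show ?thesis
  proof (cases "\<exists>c v. w = Inr c # v")
    case True
    then obtain c v where w: "w = Inr c # v" by blast
    have c: "c \<in> carrier H" "c \<noteq> \<one>\<^bsub>H\<^esub>"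
      using assms(4) by (auto simp: w reduced_word_Cons_iff)
    have v: "syl_mult G H (Inr x) v = Inr x # v" for x
      using assms(4) by (cases v rule: list.exhaust; cases "hd v")
        (auto simp: w reduced_word_Cons_iff)
    have 1: "a \<otimes>\<^bsub>H\<^esub> b = \<one>\<^bsub>H\<^esub> \<Longrightarrow> a \<otimes>\<^bsub>H\<^esub> (b \<otimes>\<^bsub>H\<^esub> c) = c"
      using ab c by (metis H.l_one H.m_assoc)
    have 2: "b \<otimes>\<^bsub>H\<^esub> c = \<one>\<^bsub>H\<^esub> \<Longrightarrow> a \<otimes>\<^bsub>H\<^esub> b \<otimes>\<^bsub>H\<^esub> c = a"
      using ab c by (metis H.r_one H.m_assoc)
    show ?thesis
      using ab c 1 2 by (auto simp: w v H.m_assoc)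
  next
    case False
    then have "syl_mult G H (Inr x) w = Inr x # w" for x
      by (cases w; cases "hd w") auto
    then show ?thesis by auto
  qed
qed

lemma word_mult_reduced:
  assumes "group G" "group H" "reduced_word G H u" "reduced_word G H v"
  shows "reduced_word G H (foldr (syl_mult G H) u v)"
  using assms(3)
  by (induction u)
     (auto intro: syl_mult_reduced[OF assms(1,2)] assms(4) dest: reduced_word_ConsD reduced_word_sylD)

lemma word_mult_syl_mult:
  assumes "group G" "group H" "reduced_word G H [s]" "reduced_word G H v" "reduced_word G H w"
  shows "foldr (syl_mult G H) (syl_mult G H s v) w = syl_mult G H s (foldr (syl_mult G H) v w)"
proof (cases "(G, H, s, v)" rule: syl_mult.cases)
  case (1 G' H' a b v')
  then have v: "v = Inl b # v'" and s: "s = Inl a" by auto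
  have b: "reduced_word G H [Inl b]" and v': "reduced_word G H v'"
    using assms(4) by (auto simp: v reduced_word_Cons_iff)
  show ?thesis
    using syl_mult_syl_mult_Inl[OF assms(1) _ b word_mult_reduced[OF assms(1,2) v' assms(5)], of a]
      assms(3) by (simp add: v s)
next
  case (2 G' H' a b v')
  then have v: "v = Inr b # v'" and s: "s = Inr a" by auto
  have b: "reduced_word G H [Inr b]" and v': "reduced_word G H v'"
    using assms(4) by (auto simp: v reduced_word_Cons_iff)
  show ?thesis
    using syl_mult_syl_mult_Inr[OF assms(2) _ b word_mult_reduced[OF assms(1,2) v' assms(5)], of a]
      assms(3) by (simp add: v s)
qed auto

lemma group_free_product:
  assumes "group G" "group H"
  shows "group (free_product G H)"
proof -
  interpret G: group G by fact
  interpret H: group H by fact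
  let ?m = "foldr (syl_mult G H)"
  have assoc: "?m (?m u v) w = ?m u (?m v w)"
    if "reduced_word G H u" "reduced_word G H v" "reduced_word G H w" for u v w
    using that(1)
  proof (induction u)
    case (Cons s u)
    have u: "reduced_word G H u" and s: "reduced_word G H [s]"
      using Cons.prems reduced_word_ConsD reduced_word_sylD by auto
    show ?case
      using word_mult_syl_mult[OF assms s word_mult_reduced[OF assms u that(2)] that(3)] Cons.IH[OF u]
      by simp
  qed simp
  define iv where "iv = map_sum (\<lambda>a. inv\<^bsub>G\<^esub> a) (\<lambda>b. inv\<^bsub>H\<^esub> b)"
  have isl_iv: "isl (iv s) = isl s" for s
    by (cases s) (auto simp: iv_def)
  have red_inv: "reduced_word G H (rev (map iv w))" if "reduced_word G H w" for w
  proof -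
    have "set (map iv w) \<subseteq> Inl ` (carrier G - {\<one>\<^bsub>G\<^esub>}) \<union> Inr ` (carrier H - {\<one>\<^bsub>H\<^esub>})"
      using that by (auto simp: reduced_word_def iv_def) (force simp: G.inv_eq_1_iff H.inv_eq_1_iff)+
    moreover have "successively (\<lambda>s s'. isl s \<noteq> isl s') (rev (map iv w))"
      using that
      by (auto simp: reduced_word_def successively_map isl_iv elim: successively_mono)
    ultimately show ?thesis by (simp add: reduced_word_def)
  qed
  have linv: "?m (rev (map iv w)) w = []" if "reduced_word G H w" for w
    using that
  proof (induction w)
    case (Cons s w)
    have "syl_mult G H (iv s) (s # w) = w"
      using Cons.prems by (cases s) (auto simp: iv_def reduced_word_Cons_iff)
    then show ?case using Cons reduced_word_ConsD by auto
  qed simp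
  have "\<exists>y. reduced_word G H y \<and> ?m y w = []" if "reduced_word G H w" for w
    using red_inv[OF that] linv[OF that] by blast
  then show ?thesis
    by (intro groupI) (use word_mult_reduced[OF assms] assoc in \<open>auto simp: free_product_def\<close>)
qed

section \<open>Heat kernel of the weighted Cayley graph\<close>

text \<open>Functions on \<open>X\<close> are total functions; only their values on \<open>X\<close> matter below.\<close>

definition ell2 :: "'x set \<Rightarrow> ('x \<Rightarrow> complex) set" where
  "ell2 X = {f. (\<lambda>x. (cmod (f x))\<^sup>2) summable_on X}"

definition ell2_norm :: "'x set \<Rightarrow> ('x \<Rightarrow> complex) \<Rightarrow> real" where
  "ell2_norm X f = sqrt (\<Sum>\<^sub>\<infinity>x\<in>X. (cmod (f x))\<^sup>2)"

text \<open>\<open>T\<close> is the exponential of the operator \<open>A\<close> on \<^term>\<open>ell2 X\<close>: the exponential series of \<open>A\<close>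
  converges to \<open>T\<close> in operator norm. This determines the values of \<open>T f\<close> on \<open>X\<close> for
  \<open>f\<close> in \<^term>\<open>ell2 X\<close>.\<close>

definition is_operator_exp :: "'x set \<Rightarrow> (('x \<Rightarrow> complex) \<Rightarrow> ('x \<Rightarrow> complex)) \<Rightarrow>
    (('x \<Rightarrow> complex) \<Rightarrow> ('x \<Rightarrow> complex)) \<Rightarrow> bool" where
  "is_operator_exp X A T \<longleftrightarrow>
     (\<forall>f\<in>ell2 X. T f \<in> ell2 X) \<and>
     (\<forall>e>0. \<forall>\<^sub>F n in sequentially. \<forall>f\<in>ell2 X.
        ell2_norm X (\<lambda>x. T f x - (\<Sum>j<n. (A ^^ j) f x / fact j)) \<le> e * ell2_norm X f)"

definition kappa :: "nat \<Rightarrow> nat \<Rightarrow> real \<Rightarrow> real \<Rightarrow> real" where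
  "kappa M N \<omega>\<^sub>1 \<omega>\<^sub>2 = real M * \<omega>\<^sub>1 + real N * \<omega>\<^sub>2"

definition laplacian :: "('a, 'c) monoid_scheme \<Rightarrow> ('b, 'd) monoid_scheme \<Rightarrow> real \<Rightarrow> real \<Rightarrow>
    (('a + 'b) list \<Rightarrow> complex) \<Rightarrow> ('a + 'b) list \<Rightarrow> complex" where
  "laplacian G H \<omega>\<^sub>1 \<omega>\<^sub>2 f x =
     f x - 1 / of_real (kappa (card (carrier G) - 1) (card (carrier H) - 1) \<omega>\<^sub>1 \<omega>\<^sub>2) *
       ((\<Sum>a\<in>carrier G - {\<one>\<^bsub>G\<^esub>}. of_real \<omega>\<^sub>1 * f (x \<otimes>\<^bsub>free_product G H\<^esub> [Inl a])) +
        (\<Sum>b\<in>carrier H - {\<one>\<^bsub>H\<^esub>}. of_real \<omega>\<^sub>2 * f (x \<otimes>\<^bsub>free_product G H\<^esub> [Inr b])))"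

definition is_heat_operator :: "('a, 'c) monoid_scheme \<Rightarrow> ('b, 'd) monoid_scheme \<Rightarrow>
    real \<Rightarrow> real \<Rightarrow> real \<Rightarrow>
    ((('a + 'b) list \<Rightarrow> complex) \<Rightarrow> (('a + 'b) list \<Rightarrow> complex)) \<Rightarrow> bool" where
  "is_heat_operator G H \<omega>\<^sub>1 \<omega>\<^sub>2 t T \<longleftrightarrow>
     is_operator_exp (carrier (free_product G H))
       (\<lambda>f x. - of_real t * laplacian G H \<omega>\<^sub>1 \<omega>\<^sub>2 f x) T"

definition is_heat_kernel :: "('a, 'c) monoid_scheme \<Rightarrow> ('b, 'd) monoid_scheme \<Rightarrow>
    real \<Rightarrow> real \<Rightarrow> real \<Rightarrow> (('a + 'b) list \<Rightarrow> real) \<Rightarrow> bool" where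
  "is_heat_kernel G H \<omega>\<^sub>1 \<omega>\<^sub>2 t k \<longleftrightarrow>
     (let \<B> = free_product G H in
      \<exists>T. is_heat_operator G H \<omega>\<^sub>1 \<omega>\<^sub>2 t T \<and>
        (\<forall>f\<in>ell2 (carrier \<B>). \<forall>x\<in>carrier \<B>.
           ((\<lambda>y. of_real (k (inv\<^bsub>\<B>\<^esub> y \<otimes>\<^bsub>\<B>\<^esub> x)) * f y) has_sum T f x) (carrier \<B>)))"

fun pi_e :: "('a + 'b) list \<Rightarrow> int" where
  "pi_e [] = 0"
| "pi_e (Inr b # w) = int (length (Inr b # w))"
| "pi_e (Inl a # w) = - int (length (Inl a # w))"

section \<open>Discrete spectral data\<close>

definition eigval1 :: "nat \<Rightarrow> nat \<Rightarrow> real \<Rightarrow> real \<Rightarrow> real" where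
  "eigval1 M N \<omega>\<^sub>1 \<omega>\<^sub>2 = (real N + 1) * \<omega>\<^sub>2 / kappa M N \<omega>\<^sub>1 \<omega>\<^sub>2"

definition eigval2 :: "nat \<Rightarrow> nat \<Rightarrow> real \<Rightarrow> real \<Rightarrow> real" where
  "eigval2 M N \<omega>\<^sub>1 \<omega>\<^sub>2 = 1 + (\<omega>\<^sub>1 + \<omega>\<^sub>2) / kappa M N \<omega>\<^sub>1 \<omega>\<^sub>2"

definition beta1 :: "nat \<Rightarrow> nat \<Rightarrow> real" where
  "beta1 M N = sqrt ((real N - real M) / ((real M + 1) * (real N + 1)))"

definition beta2 :: "nat \<Rightarrow> nat \<Rightarrow> real" where
  "beta2 M N = sqrt ((real M * real N - 1) / ((real M + 1) * (real N + 1)))"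

definition eigfun1 :: "nat \<Rightarrow> nat \<Rightarrow> int \<Rightarrow> real" where
  "eigfun1 M N m =
     (if even m then
        let n = m div 2 in beta1 M N * (-1) powi n * (real M / real N) powr (\<bar>n\<bar> / 2)
      else if m \<ge> 0 then
        let n = nat (m div 2)
        in beta1 M N * (-1) ^ (n + 1) * real M powr (n / 2) * real N powr (- (n + 1) / 2)
      else
        let n = nat ((- m - 1) div 2)
        in beta1 M N * (-1) ^ n * real M powr ((n + 1) / 2) * real N powr (- n / 2))"

definition eigfun2 :: "nat \<Rightarrow> nat \<Rightarrow> int \<Rightarrow> real" where
  "eigfun2 M N m =
     (if even m then
        let n = m div 2 in beta2 M N * (real M * real N) powr (- \<bar>n\<bar> / 2)
      else if m \<ge> 0 then
        let n = nat (m div 2)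
        in - beta2 M N * real M powr (- n / 2) * real N powr (- (n + 1) / 2)
      else
        let n = nat ((- m - 1) div 2)
        in - beta2 M N * real M powr (- (n + 1) / 2) * real N powr (- n / 2))"

lemma eigfun1_simps:
  "eigfun1 M N (2 * i) = beta1 M N * (-1) powi i * (real M / real N) powr (\<bar>real_of_int i\<bar> / 2)"
  "eigfun1 M N (2 * int n + 1) =
     beta1 M N * (-1) ^ (n + 1) * real M powr (real n / 2) * real N powr (- (real n + 1) / 2)"
  "eigfun1 M N (- 2 * int n - 1) =
     beta1 M N * (-1) ^ n * real M powr ((real n + 1) / 2) * real N powr (- real n / 2)"
  by (simp_all add: eigfun1_def Let_def add.commute)

lemma eigfun2_simps:
  "eigfun2 M N (2 * i) = beta2 M N * (real M * real N) powr (- \<bar>real_of_int i\<bar> / 2)"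
  "eigfun2 M N (2 * int n + 1) =
     - beta2 M N * real M powr (- real n / 2) * real N powr (- (real n + 1) / 2)"
  "eigfun2 M N (- 2 * int n - 1) =
     - beta2 M N * real M powr (- (real n + 1) / 2) * real N powr (- real n / 2)"
  by (simp_all add: eigfun2_def Let_def add.commute)

section \<open>Continuous spectral data\<close>

definition R_fun :: "nat \<Rightarrow> nat \<Rightarrow> real \<Rightarrow> real \<Rightarrow> real \<Rightarrow> real" where
  "R_fun M N \<omega>\<^sub>1 \<omega>\<^sub>2 x =
     sqrt (((real M + 1) * \<omega>\<^sub>1 - (real N + 1) * \<omega>\<^sub>2)\<^sup>2 + 4 * (real M + real N) * \<omega>\<^sub>1 * \<omega>\<^sub>2
           + 8 * sqrt (real M * real N) * \<omega>\<^sub>1 * \<omega>\<^sub>2 * cos x)"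

definition lambda_fun :: "nat \<Rightarrow> nat \<Rightarrow> real \<Rightarrow> real \<Rightarrow> real \<Rightarrow> real \<Rightarrow> real" where
  "lambda_fun M N \<omega>\<^sub>1 \<omega>\<^sub>2 \<epsilon> x =
     ((real M + 1) * \<omega>\<^sub>1 + (real N + 1) * \<omega>\<^sub>2 - \<epsilon> * R_fun M N \<omega>\<^sub>1 \<omega>\<^sub>2 x) / (2 * kappa M N \<omega>\<^sub>1 \<omega>\<^sub>2)"

definition rho_fun :: "nat \<Rightarrow> nat \<Rightarrow> real \<Rightarrow> real \<Rightarrow> real \<Rightarrow> real \<Rightarrow> real" where
  "rho_fun M N \<omega>\<^sub>1 \<omega>\<^sub>2 \<epsilon> x = kappa M N \<omega>\<^sub>1 \<omega>\<^sub>2 * (1 - lambda_fun M N \<omega>\<^sub>1 \<omega>\<^sub>2 \<epsilon> x)"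

definition A_fun :: "nat \<Rightarrow> nat \<Rightarrow> real \<Rightarrow> real \<Rightarrow> real \<Rightarrow> real \<Rightarrow> real" where
  "A_fun M N \<omega>\<^sub>1 \<omega>\<^sub>2 \<epsilon> x = rho_fun M N \<omega>\<^sub>1 \<omega>\<^sub>2 \<epsilon> x - (real N - 1) * \<omega>\<^sub>2"

definition B_fun :: "nat \<Rightarrow> nat \<Rightarrow> real \<Rightarrow> real \<Rightarrow> real \<Rightarrow> real \<Rightarrow> real" where
  "B_fun M N \<omega>\<^sub>1 \<omega>\<^sub>2 \<epsilon> x = rho_fun M N \<omega>\<^sub>1 \<omega>\<^sub>2 \<epsilon> x - (real M - 1) * \<omega>\<^sub>1"

definition D_fun :: "nat \<Rightarrow> nat \<Rightarrow> real \<Rightarrow> real \<Rightarrow> real \<Rightarrow> real \<Rightarrow> real" where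
  "D_fun M N \<omega>\<^sub>1 \<omega>\<^sub>2 \<epsilon> x =
     (let A = A_fun M N \<omega>\<^sub>1 \<omega>\<^sub>2 \<epsilon> x; B = B_fun M N \<omega>\<^sub>1 \<omega>\<^sub>2 \<epsilon> x in
      (A * B * ((real M - 1) * \<omega>\<^sub>1 + (real N - 1) * \<omega>\<^sub>2)
         - (A - B) * (real M * \<omega>\<^sub>1\<^sup>2 - real N * \<omega>\<^sub>2\<^sup>2))
      / (2 * A * sqrt (real M * real N) * \<omega>\<^sub>1 * \<omega>\<^sub>2 * sin x))"

definition gen_eigfun1 ::
  "nat \<Rightarrow> nat \<Rightarrow> real \<Rightarrow> real \<Rightarrow> real \<Rightarrow> real \<Rightarrow> int \<Rightarrow> real" where
  "gen_eigfun1 M N \<omega>\<^sub>1 \<omega>\<^sub>2 \<epsilon> x m =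
     (let A = A_fun M N \<omega>\<^sub>1 \<omega>\<^sub>2 \<epsilon> x; B = B_fun M N \<omega>\<^sub>1 \<omega>\<^sub>2 \<epsilon> x; D = D_fun M N \<omega>\<^sub>1 \<omega>\<^sub>2 \<epsilon> x in
      if m \<ge> 0 then
        let n = m div 2 in
        if even m then cos (n * x)
        else (sqrt N * \<omega>\<^sub>2 * cos (n * x) + sqrt M * \<omega>\<^sub>1 * cos ((n + 1) * x)) / A
      else if even m then
        let n = (- m) div 2 in cos (n * x) + D * sin (n * x)
      else
        let n = (- m - 1) div 2 in
        (sqrt M * \<omega>\<^sub>1 * (cos (n * x) + D * sin (n * x))
           + sqrt N * \<omega>\<^sub>2 * (cos ((n + 1) * x) + D * sin ((n + 1) * x))) / B)"

definition gen_eigfun2 ::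
  "nat \<Rightarrow> nat \<Rightarrow> real \<Rightarrow> real \<Rightarrow> real \<Rightarrow> real \<Rightarrow> int \<Rightarrow> real" where
  "gen_eigfun2 M N \<omega>\<^sub>1 \<omega>\<^sub>2 \<epsilon> x m =
     (let A = A_fun M N \<omega>\<^sub>1 \<omega>\<^sub>2 \<epsilon> x; B = B_fun M N \<omega>\<^sub>1 \<omega>\<^sub>2 \<epsilon> x in
      if m \<ge> 0 then
        let n = m div 2 in
        if even m then sin (n * x)
        else (sqrt N * \<omega>\<^sub>2 * sin (n * x) + sqrt M * \<omega>\<^sub>1 * sin ((n + 1) * x)) / A
      else if even m then
        let n = (- m) div 2 in - (B / A) * sin (n * x)
      else
        let n = (- m - 1) div 2 in
        - ((sqrt M * \<omega>\<^sub>1 * sin (n * x) + sqrt N * \<omega>\<^sub>2 * sin ((n + 1) * x)) / A))"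

lemma gen_eigfun1_simps:
  fixes M N n :: nat and \<omega>\<^sub>1 \<omega>\<^sub>2 \<epsilon> x :: real
  defines "A \<equiv> A_fun M N \<omega>\<^sub>1 \<omega>\<^sub>2 \<epsilon> x" and "B \<equiv> B_fun M N \<omega>\<^sub>1 \<omega>\<^sub>2 \<epsilon> x" and "D \<equiv> D_fun M N \<omega>\<^sub>1 \<omega>\<^sub>2 \<epsilon> x"
  shows "gen_eigfun1 M N \<omega>\<^sub>1 \<omega>\<^sub>2 \<epsilon> x (2 * int n) = cos (real n * x)"
    "gen_eigfun1 M N \<omega>\<^sub>1 \<omega>\<^sub>2 \<epsilon> x (2 * int n + 1) =
       (sqrt (real N) * \<omega>\<^sub>2 * cos (real n * x) + sqrt (real M) * \<omega>\<^sub>1 * cos ((real n + 1) * x)) / A"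
    "gen_eigfun1 M N \<omega>\<^sub>1 \<omega>\<^sub>2 \<epsilon> x (- 2 * int n) = cos (real n * x) + D * sin (real n * x)"
    "gen_eigfun1 M N \<omega>\<^sub>1 \<omega>\<^sub>2 \<epsilon> x (- 2 * int n - 1) =
       (sqrt (real M) * \<omega>\<^sub>1 * (cos (real n * x) + D * sin (real n * x)) +
        sqrt (real N) * \<omega>\<^sub>2 * (cos ((real n + 1) * x) + D * sin ((real n + 1) * x))) / B"
  by (simp_all add: gen_eigfun1_def A_def B_def D_def Let_def)

lemma gen_eigfun2_simps:
  fixes M N n :: nat and \<omega>\<^sub>1 \<omega>\<^sub>2 \<epsilon> x :: real
  defines "A \<equiv> A_fun M N \<omega>\<^sub>1 \<omega>\<^sub>2 \<epsilon> x" and "B \<equiv> B_fun M N \<omega>\<^sub>1 \<omega>\<^sub>2 \<epsilon> x"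
  shows "gen_eigfun2 M N \<omega>\<^sub>1 \<omega>\<^sub>2 \<epsilon> x (2 * int n) = sin (real n * x)"
    "gen_eigfun2 M N \<omega>\<^sub>1 \<omega>\<^sub>2 \<epsilon> x (2 * int n + 1) =
       (sqrt (real N) * \<omega>\<^sub>2 * sin (real n * x) + sqrt (real M) * \<omega>\<^sub>1 * sin ((real n + 1) * x)) / A"
    "gen_eigfun2 M N \<omega>\<^sub>1 \<omega>\<^sub>2 \<epsilon> x (- 2 * int n) = - (B / A) * sin (real n * x)"
    "gen_eigfun2 M N \<omega>\<^sub>1 \<omega>\<^sub>2 \<epsilon> x (- 2 * int n - 1) =
       - ((sqrt (real M) * \<omega>\<^sub>1 * sin (real n * x) + sqrt (real N) * \<omega>\<^sub>2 * sin ((real n + 1) * x)) / A)"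
  by (simp_all add: gen_eigfun2_def A_def B_def Let_def)

definition F_vec :: "nat \<Rightarrow> nat \<Rightarrow> real \<Rightarrow> real \<Rightarrow> real \<Rightarrow> real \<Rightarrow> int \<Rightarrow> real ^ 2" where
  "F_vec M N \<omega>\<^sub>1 \<omega>\<^sub>2 \<epsilon> x m =
     vector [gen_eigfun1 M N \<omega>\<^sub>1 \<omega>\<^sub>2 \<epsilon> x m, gen_eigfun2 M N \<omega>\<^sub>1 \<omega>\<^sub>2 \<epsilon> x m]"

definition H_mat :: "nat \<Rightarrow> nat \<Rightarrow> real \<Rightarrow> real \<Rightarrow> real \<Rightarrow> real \<Rightarrow> real ^ 2 ^ 2" where
  "H_mat M N \<omega>\<^sub>1 \<omega>\<^sub>2 \<epsilon> x =
     (let A = A_fun M N \<omega>\<^sub>1 \<omega>\<^sub>2 \<epsilon> x; B = B_fun M N \<omega>\<^sub>1 \<omega>\<^sub>2 \<epsilon> x; D = D_fun M N \<omega>\<^sub>1 \<omega>\<^sub>2 \<epsilon> x in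
      (pi / 2 * (1 + B / A)) *\<^sub>R
        vector [vector [1 + A / B + A / B * D\<^sup>2, - D],
                vector [- D, 1 + B / A]])"

definition spectral_integrand ::
  "nat \<Rightarrow> nat \<Rightarrow> real \<Rightarrow> real \<Rightarrow> real \<Rightarrow> int \<Rightarrow> real \<Rightarrow> real" where
  "spectral_integrand M N \<omega>\<^sub>1 \<omega>\<^sub>2 t n x =
     (\<Sum>\<epsilon>\<in>{1, -1}. exp (- t * lambda_fun M N \<omega>\<^sub>1 \<omega>\<^sub>2 \<epsilon> x) *
        (F_vec M N \<omega>\<^sub>1 \<omega>\<^sub>2 \<epsilon> x 0 \<bullet>
          (matrix_inv (H_mat M N \<omega>\<^sub>1 \<omega>\<^sub>2 \<epsilon> x) *v F_vec M N \<omega>\<^sub>1 \<omega>\<^sub>2 \<epsilon> x n)))"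

definition heat_profile :: "('a, 'c) monoid_scheme \<Rightarrow> ('b, 'd) monoid_scheme \<Rightarrow>
    nat \<Rightarrow> nat \<Rightarrow> real \<Rightarrow> real \<Rightarrow> real \<Rightarrow> int \<Rightarrow> real" where
  "heat_profile G H M N \<omega>\<^sub>1 \<omega>\<^sub>2 t n =
     1 / sqrt (real (card {x \<in> carrier (free_product G H). pi_e x = n})) *
     (exp (- t * eigval1 M N \<omega>\<^sub>1 \<omega>\<^sub>2) * eigfun1 M N 0 * eigfun1 M N n
      + exp (- t * eigval2 M N \<omega>\<^sub>1 \<omega>\<^sub>2) * eigfun2 M N 0 * eigfun2 M N n
      + (LBINT x:{0<..<pi}. spectral_integrand M N \<omega>\<^sub>1 \<omega>\<^sub>2 t n x))"

end

theory Submission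
  imports Defs
begin

text \<open>
  The Laplacian \<open>L\<close> is bounded and commutes with left translations. Hence its exponential is
  given by convolution with a unique function, the exponential series of \<open>- t L\<close> applied to the
  point mass at the identity (\<open>is_heat_kernel_iff\<close>).

  How many neighbours of a word lie on which fibre of \<open>pi_e\<close> depends only on the value of
  \<open>pi_e\<close> at the word. Therefore \<open>L\<close> preserves the functions of \<open>pi_e\<close>, and acts on them as a
  nearest-neighbour operator on the integers (\<open>laplacian_radial\<close>). Multiplying by the square roots
  of the sizes of the fibres turns this operator into \<open>1 - J / \<kappa>\<close> with a symmetric Jacobi matrix
  \<open>J\<close>, whose off-diagonal entries alternate between \<open>a = sqrt M \<omega>\<^sub>1\<close> and \<open>b = sqrt N \<omega>\<^sub>2\<close>
  (\<open>radial_adjacency_symmetrised\<close>). It remains to compute the powers of \<open>1 - J / \<kappa>\<close> on the point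
  mass at \<open>0\<close>.

  As functions of \<open>n\<close>, both \<open>f\<^sub>k n\<close> and \<open>F(0)\<^sup>T \<H>\<^sup>-\<^sup>1 F(n)\<close> satisfy the eigenvalue equation of
  \<open>1 - J / \<kappa>\<close> for the attached eigenvalue. For a test function \<open>\<phi>\<close> let \<open>spectral_pairing \<phi> n\<close> be
  the bracket in the formula for the kernel, with \<open>\<phi> \<lambda>\<close> in place of \<open>exp (- t \<lambda>)\<close>. The
  eigenvalue equations say that multiplying \<open>\<phi>\<close> by \<open>\<lambda>\<close> amounts to applying \<open>1 - J / \<kappa>\<close>
  (\<open>spectral_pairing_mult\<close>). So if \<open>\<phi> = 1\<close> gives the point mass at \<open>0\<close>, then \<open>\<phi> = \<lambda>^j\<close> gives
  its image under the \<open>j\<close>-th power, and \<open>\<phi> = exp (- t \<lambda>)\<close> gives the heat kernel by dominated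
  convergence, the coefficients being bounded by \<open>1\<close> (\<open>spec_coeff_bound\<close>).

  What is left is the case \<open>\<phi> = 1\<close> (\<open>spectral_pairing_one\<close>). The product \<open>A B\<close> is
  \<open>Q = \<bar>b + a exp (\<i> x)\<bar>\<^sup>2\<close>. Like \<open>A D\<close>, it does not depend on \<open>\<epsilon>\<close>, while
  \<open>A + B = \<epsilon> R\<close> changes sign with \<open>\<epsilon>\<close>. At position \<open>2 m\<close> the matrix expression equals
  \<open>(2 / \<pi>) Q / (R\<^sup>2 + (A D)\<^sup>2) (cos m x + (A D / (\<epsilon> R)) sin m x)\<close>. Summing over \<open>\<epsilon>\<close> removes
  the sine. Moreover \<open>sin\<^sup>2 x (R\<^sup>2 + (A D)\<^sup>2)\<close> is a constant times the product of \<open>Q\<close> and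
  two linear polynomials in \<open>Q\<close>, whose zeros are the values of \<open>A B\<close> at the eigenvalues
  \<open>\<lambda>\<^sub>1\<close>, \<open>\<lambda>\<^sub>2\<close>. The weights \<open>\<omega>\<^sub>1\<close>, \<open>\<omega>\<^sub>2\<close> cancel and the integrand becomes
  \<open>(4 / \<pi>) M N sin\<^sup>2 x cos m x / ((M + N + 2 sqrt (M N) cos x) (1 + M N - 2 sqrt (M N) cos x))\<close>.
  Up to constants the two factors are Poisson denominators \<open>1 + r\<^sup>2 - 2 r cos x\<close> for
  \<open>r = - sqrt (M / N)\<close> and \<open>r = 1 / sqrt (M N)\<close>, both of modulus less than \<open>1\<close> because \<open>N > M \<ge> 1\<close>.
  The resulting integrals are geometric sequences in these \<open>r\<close>, and they are minus the products
  \<open>f\<^sub>k 0 f\<^sub>k n\<close>, up to the point mass at \<open>0\<close>. Odd positions behave in the same way.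
\<close>

section \<open>Square-summable functions\<close>

text \<open>Membership and norm are both tested on finite subsets, where Minkowski's inequality for
  \<^const>\<open>L2_set\<close> is available; the estimates below all go through this characterisation.\<close>

lemma ell2_norm_le_iff:
  assumes "0 \<le> c"
  shows "f \<in> ell2 X \<and> ell2_norm X f \<le> c \<longleftrightarrow>
    (\<forall>F. finite F \<longrightarrow> F \<subseteq> X \<longrightarrow> L2_set (\<lambda>x. cmod (f x)) F \<le> c)"
proof (intro iffI conjI allI impI)
  fix F assume f: "f \<in> ell2 X \<and> ell2_norm X f \<le> c" and F: "finite F" "F \<subseteq> X"
  then have "(\<Sum>x\<in>F. (cmod (f x))\<^sup>2) \<le> (\<Sum>\<^sub>\<infinity>x\<in>X. (cmod (f x))\<^sup>2)"
    by (intro finite_sum_le_infsum) (auto simp: ell2_def)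
  then have "L2_set (\<lambda>x. cmod (f x)) F \<le> ell2_norm X f"
    by (simp add: L2_set_def ell2_norm_def)
  with f show "L2_set (\<lambda>x. cmod (f x)) F \<le> c" by linarith
next
  assume *: "\<forall>F. finite F \<longrightarrow> F \<subseteq> X \<longrightarrow> L2_set (\<lambda>x. cmod (f x)) F \<le> c"
  have bd: "(\<Sum>x\<in>F. (cmod (f x))\<^sup>2) \<le> c\<^sup>2" if "finite F" "F \<subseteq> X" for F
    using * that by (auto simp: L2_set_def dest!: sqrt_le_D)
  have summ: "(\<lambda>x. (cmod (f x))\<^sup>2) summable_on X"
    by (rule nonneg_bdd_above_summable_on) (auto intro!: bdd_aboveI[of _ "c\<^sup>2"] bd)
  then show "f \<in> ell2 X" by (simp add: ell2_def)
  have "(\<Sum>\<^sub>\<infinity>x\<in>X. (cmod (f x))\<^sup>2) \<le> c\<^sup>2"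
    using summ by (rule infsum_le_finite_sums) (use bd in auto)
  then show "ell2_norm X f \<le> c"
    unfolding ell2_norm_def by (rule real_le_lsqrt[OF assms])
qed

lemma ell2_norm_nonneg [simp]: "0 \<le> ell2_norm X f"
  by (simp add: ell2_norm_def infsum_nonneg)

lemma L2_set_le_ell2_norm:
  assumes "f \<in> ell2 X" "finite F" "F \<subseteq> X"
  shows "L2_set (\<lambda>x. cmod (f x)) F \<le> ell2_norm X f"
  using ell2_norm_le_iff[of "ell2_norm X f" f X] assms by auto

lemma ell2I:
  assumes "\<And>F. finite F \<Longrightarrow> F \<subseteq> X \<Longrightarrow> L2_set (\<lambda>x. cmod (f x)) F \<le> c"
  shows "f \<in> ell2 X" "ell2_norm X f \<le> c"
proof -
  have "0 \<le> c" using assms[of "{}"] by simp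
  then show "f \<in> ell2 X" "ell2_norm X f \<le> c" using ell2_norm_le_iff[of c f X] assms by auto
qed

lemma cmod_le_ell2_norm:
  assumes "f \<in> ell2 X" "x \<in> X" shows "cmod (f x) \<le> ell2_norm X f"
  using L2_set_le_ell2_norm[OF assms(1), of "{x}"] assms(2) by (simp add: L2_set_def)

lemma L2_set_sum_triangle:
  "L2_set (\<lambda>x. cmod (\<Sum>i\<in>I. g i x)) F \<le> (\<Sum>i\<in>I. L2_set (\<lambda>x. cmod (g i x)) F)"
proof (induction I rule: infinite_finite_induct)
  case (insert i I)
  have "L2_set (\<lambda>x. cmod (\<Sum>i\<in>insert i I. g i x)) F
      \<le> L2_set (\<lambda>x. cmod (g i x) + cmod (\<Sum>i\<in>I. g i x)) F"
    by (rule L2_set_mono) (use insert in \<open>auto simp: norm_triangle_ineq\<close>)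
  also have "\<dots> \<le> L2_set (\<lambda>x. cmod (g i x)) F + L2_set (\<lambda>x. cmod (\<Sum>i\<in>I. g i x)) F"
    by (rule L2_set_triangle_ineq)
  finally show ?case using insert by simp
qed (auto simp: L2_set_def)

lemma L2_set_scale: "L2_set (\<lambda>x. cmod (c * f x)) F = cmod c * L2_set (\<lambda>x. cmod (f x)) F"
  by (simp add: norm_mult L2_set_right_distrib)

lemma ell2_sum:
  assumes "\<And>i. i \<in> I \<Longrightarrow> g i \<in> ell2 X"
  shows "(\<lambda>x. \<Sum>i\<in>I. g i x) \<in> ell2 X"
    and "ell2_norm X (\<lambda>x. \<Sum>i\<in>I. g i x) \<le> (\<Sum>i\<in>I. ell2_norm X (g i))"
  by (rule ell2I[where c = "\<Sum>i\<in>I. ell2_norm X (g i)"];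
      rule order_trans[OF L2_set_sum_triangle sum_mono]; rule L2_set_le_ell2_norm[OF assms]; assumption)+

lemma ell2_scale:
  assumes "f \<in> ell2 X"
  shows "(\<lambda>x. c * f x) \<in> ell2 X" "ell2_norm X (\<lambda>x. c * f x) \<le> cmod c * ell2_norm X f"
proof -
  have "L2_set (\<lambda>x. cmod (c * f x)) F \<le> cmod c * ell2_norm X f" if "finite F" "F \<subseteq> X" for F
    unfolding L2_set_scale using L2_set_le_ell2_norm[OF assms that] by (rule mult_left_mono) simp
  then show "(\<lambda>x. c * f x) \<in> ell2 X" "ell2_norm X (\<lambda>x. c * f x) \<le> cmod c * ell2_norm X f"
    using ell2I[of X "\<lambda>x. c * f x"] by blast+
qed

lemma ell2_diff:
  assumes "f \<in> ell2 X" "g \<in> ell2 X"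
  shows "(\<lambda>x. f x - c * g x) \<in> ell2 X"
proof -
  have "(\<lambda>x. if b then f x else (- c) * g x) \<in> ell2 X" for b
    using assms(1) ell2_scale(1)[OF assms(2), of "- c"] by (cases b) simp_all
  from ell2_sum(1)[of "UNIV :: bool set" "\<lambda>b x. if b then f x else (- c) * g x", OF this] show ?thesis
    by (simp add: UNIV_bool)
qed

lemma ell2_add:
  assumes "f \<in> ell2 X" "g \<in> ell2 X"
  shows "(\<lambda>x. f x + g x) \<in> ell2 X" "ell2_norm X (\<lambda>x. f x + g x) \<le> ell2_norm X f + ell2_norm X g"
proof -
  have "(\<lambda>x. if b then f x else g x) \<in> ell2 X" for b
    using assms by (cases b) simp_all
  from ell2_sum[of "UNIV :: bool set" "\<lambda>b x. if b then f x else g x", OF this]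
  show "(\<lambda>x. f x + g x) \<in> ell2 X" "ell2_norm X (\<lambda>x. f x + g x) \<le> ell2_norm X f + ell2_norm X g"
    by (simp_all add: UNIV_bool add.commute)
qed

lemma ell2_reindex:
  assumes "bij_betw \<phi> X X"
  shows "(\<lambda>x. f (\<phi> x)) \<in> ell2 X \<longleftrightarrow> f \<in> ell2 X"
    and "ell2_norm X (\<lambda>x. f (\<phi> x)) = ell2_norm X f"
  using summable_on_reindex_bij_betw[OF assms, of "\<lambda>x. (cmod (f x))\<^sup>2"]
    infsum_reindex_bij_betw[OF assms, of "\<lambda>x. (cmod (f x))\<^sup>2"]
  by (auto simp: ell2_def ell2_norm_def)

definition point_mass :: "'x \<Rightarrow> 'x \<Rightarrow> complex" where
  "point_mass y x = (if x = y then 1 else 0)"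

lemma point_mass_ell2: "point_mass y \<in> ell2 X"
proof (rule ell2I)
  fix F :: "'a set" assume "finite F"
  then have "(\<Sum>x\<in>F. (cmod (point_mass y x))\<^sup>2) = (\<Sum>x\<in>F. if x = y then 1 else 0)"
    by (intro sum.cong) (auto simp: point_mass_def)
  with \<open>finite F\<close> have "(\<Sum>x\<in>F. (cmod (point_mass y x))\<^sup>2) \<le> 1" by simp
  then show "L2_set (\<lambda>x. cmod (point_mass y x)) F \<le> 1" by (simp add: L2_set_def)
qed

lemma finite_sums_sum_point_mass:
  assumes "finite F"
  shows "(\<Sum>y\<in>F. f y * point_mass y x) = (if x \<in> F then f x else 0)"
  using assms by (simp add: point_mass_def if_distrib sum.delta cong: if_cong)

text \<open>Finitely supported functions are dense. The threshold \<open>F0\<close> serves all larger finite sets, as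
  the limit over finite sets in \<^const>\<open>has_sum\<close> demands.\<close>

lemma ell2_tail_small:
  assumes f: "f \<in> ell2 X" and "e > 0"
  shows "\<exists>F0. finite F0 \<and> F0 \<subseteq> X \<and> (\<forall>F. finite F \<longrightarrow> F0 \<subseteq> F \<longrightarrow> F \<subseteq> X \<longrightarrow>
     (\<lambda>x. f x - (\<Sum>y\<in>F. f y * point_mass y x)) \<in> ell2 X \<and>
     ell2_norm X (\<lambda>x. f x - (\<Sum>y\<in>F. f y * point_mass y x)) \<le> e)"
proof -
  let ?g = "\<lambda>x. (cmod (f x))\<^sup>2"
  have summ: "?g summable_on X" using f by (simp add: ell2_def)
  obtain F0 where F0: "finite F0" "F0 \<subseteq> X" "dist (sum ?g F0) (infsum ?g X) \<le> e\<^sup>2"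
    using infsum_finite_approximation[OF summ, of "e\<^sup>2"] \<open>e > 0\<close> by auto
  have "L2_set (\<lambda>x. cmod (f x - (\<Sum>y\<in>F. f y * point_mass y x))) K \<le> e"
    if F: "finite F" "F0 \<subseteq> F" "F \<subseteq> X" and K: "finite K" "K \<subseteq> X" for F K
  proof -
    have "sum ?g F0 + sum ?g (K - F) = sum ?g (F0 \<union> (K - F))"
      by (rule sum.union_disjoint[symmetric]) (use F0 F K in auto)
    also have "\<dots> \<le> infsum ?g X"
      by (rule finite_sum_le_infsum) (use summ F0 F K in auto)
    finally have "sum ?g (K - F) \<le> e\<^sup>2"
      using F0(3) by (auto simp: dist_real_def)
    moreover have "(\<Sum>x\<in>K. (cmod (f x - (\<Sum>y\<in>F. f y * point_mass y x)))\<^sup>2) = sum ?g (K - F)"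
      by (rule sum.mono_neutral_cong_right) (use F K in \<open>auto simp: finite_sums_sum_point_mass\<close>)
    ultimately show ?thesis
      using \<open>e > 0\<close> by (simp add: L2_set_def real_le_lsqrt)
  qed
  note * = this
  show ?thesis
    by (rule exI[of _ F0], intro conjI allI impI F0(1,2); rule ell2I; erule (4) *)
qed

section \<open>Exponentials of bounded operators on square-summable functions\<close>

text \<open>Linearity is an identity of total functions, so that it passes to powers without side
  conditions; the norm sees the values on \<open>X\<close> only.\<close>

locale bounded_ell2_operator =
  fixes X :: "'x set" and A :: "('x \<Rightarrow> complex) \<Rightarrow> 'x \<Rightarrow> complex" and C :: real
  assumes A_diff: "A (\<lambda>x. f x - g x) = (\<lambda>x. A f x - A g x)"
    and A_scale: "A (\<lambda>x. c * f x) = (\<lambda>x. c * A f x)"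
    and A_ell2: "f \<in> ell2 X \<Longrightarrow> A f \<in> ell2 X"
    and A_bound: "f \<in> ell2 X \<Longrightarrow> ell2_norm X (A f) \<le> C * ell2_norm X f"
    and C_nonneg: "0 \<le> C"
begin

definition op_exp :: "('x \<Rightarrow> complex) \<Rightarrow> 'x \<Rightarrow> complex" where
  "op_exp f x = (\<Sum>j. (A ^^ j) f x / fact j)"

lemma pow_ell2: "f \<in> ell2 X \<Longrightarrow> (A ^^ j) f \<in> ell2 X"
  by (induction j) (auto intro: A_ell2)

lemma pow_bound: "f \<in> ell2 X \<Longrightarrow> ell2_norm X ((A ^^ j) f) \<le> C ^ j * ell2_norm X f"
proof (induction j)
  case (Suc j)
  have "ell2_norm X ((A ^^ Suc j) f) \<le> C * ell2_norm X ((A ^^ j) f)"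
    using A_bound[OF pow_ell2[OF Suc.prems]] by simp
  also have "\<dots> \<le> C * (C ^ j * ell2_norm X f)"
    using Suc C_nonneg by (intro mult_left_mono) auto
  finally show ?case by (simp add: mult_ac)
qed simp

lemma pow_diff: "(A ^^ j) (\<lambda>x. f x - g x) = (\<lambda>x. (A ^^ j) f x - (A ^^ j) g x)"
  by (induction j) (auto simp: A_diff)

lemma pow_scale: "(A ^^ j) (\<lambda>x. c * f x) = (\<lambda>x. c * (A ^^ j) f x)"
  by (induction j) (auto simp: A_scale)

lemma exp_tail_tendsto_0: "(\<lambda>n. \<Sum>j. C ^ (j + n) / fact (j + n)) \<longlonglongrightarrow> 0"
  using suminf_exist_split2[OF summable_exp[of C]] by (simp add: field_simps inverse_eq_divide)

lemma summable_C: "summable (\<lambda>j. C ^ j / fact j)"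
  using summable_exp[of C] by (simp add: field_simps inverse_eq_divide)

lemma summable_op_exp:
  assumes "f \<in> ell2 X" "x \<in> X"
  shows "summable (\<lambda>j. (A ^^ j) f x / fact j)"
proof (rule summable_comparison_test')
  show "summable (\<lambda>j. C ^ j / fact j * ell2_norm X f)"
    by (intro summable_mult2 summable_C)
  show "norm ((A ^^ j) f x / fact j) \<le> C ^ j / fact j * ell2_norm X f" if "j \<ge> 0" for j
    using order_trans[OF cmod_le_ell2_norm[OF pow_ell2[OF assms(1)] assms(2)] pow_bound[OF assms(1)]]
    by (simp add: norm_divide divide_right_mono)
qed

text \<open>On a finite subset of \<open>X\<close>, the partial sums of the tail obey the triangle inequality, and
  pointwise convergence suffices to pass to the limit there.\<close>

lemma op_exp_remainder:
  assumes f: "f \<in> ell2 X"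
  defines "g \<equiv> \<lambda>n x. op_exp f x - (\<Sum>j<n. (A ^^ j) f x / fact j)"
  shows "g n \<in> ell2 X"
    and "ell2_norm X (g n) \<le> (\<Sum>j. C ^ (j + n) / fact (j + n)) * ell2_norm X f"
proof -
  have *: "L2_set (\<lambda>x. cmod (g n x)) F \<le> (\<Sum>j. C ^ (j + n) / fact (j + n)) * ell2_norm X f"
    if F: "finite F" "F \<subseteq> X" for F
  proof -
    have summ: "summable (\<lambda>j. C ^ (j + n) / fact (j + n))"
      using summable_C by (rule summable_ignore_initial_segment)
    have lim: "(\<lambda>m. \<Sum>j<m. (A ^^ (j + n)) f x / fact (j + n)) \<longlonglongrightarrow> g n x" if "x \<in> F" for x
    proof -
      have "x \<in> X" using that F by auto
      from summable_sums[OF summable_op_exp[OF f this]]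
      have "(\<lambda>j. (A ^^ (j + n)) f x / fact (j + n)) sums g n x"
        unfolding g_def op_exp_def by (rule sums_split_initial_segment)
      then show ?thesis by (simp add: sums_def)
    qed
    have "(\<lambda>m. L2_set (\<lambda>x. cmod (\<Sum>j<m. (A ^^ (j + n)) f x / fact (j + n))) F)
        \<longlonglongrightarrow> L2_set (\<lambda>x. cmod (g n x)) F"
      unfolding L2_set_def by (intro tendsto_intros lim)
    moreover have "L2_set (\<lambda>x. cmod (\<Sum>j<m. (A ^^ (j + n)) f x / fact (j + n))) F
        \<le> (\<Sum>j. C ^ (j + n) / fact (j + n)) * ell2_norm X f" for m
    proof -
      have "L2_set (\<lambda>x. cmod (\<Sum>j<m. (A ^^ (j + n)) f x / fact (j + n))) F
          \<le> (\<Sum>j<m. L2_set (\<lambda>x. cmod ((A ^^ (j + n)) f x / fact (j + n))) F)"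
        by (rule L2_set_sum_triangle)
      also have "\<dots> \<le> (\<Sum>j<m. C ^ (j + n) / fact (j + n) * ell2_norm X f)"
      proof (rule sum_mono)
        fix j
        have "L2_set (\<lambda>x. cmod ((A ^^ (j + n)) f x / fact (j + n))) F
            = L2_set (\<lambda>x. cmod ((A ^^ (j + n)) f x)) F / fact (j + n)"
          using L2_set_scale[of "1 / fact (j + n)" "(A ^^ (j + n)) f" F]
          by (simp add: norm_divide)
        also have "\<dots> \<le> C ^ (j + n) * ell2_norm X f / fact (j + n)"
          by (intro divide_right_mono order_trans[OF L2_set_le_ell2_norm pow_bound] pow_ell2 f F) auto
        finally show "L2_set (\<lambda>x. cmod ((A ^^ (j + n)) f x / fact (j + n))) F
            \<le> C ^ (j + n) / fact (j + n) * ell2_norm X f" by simp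
      qed
      also have "\<dots> = (\<Sum>j<m. C ^ (j + n) / fact (j + n)) * ell2_norm X f"
        by (simp add: sum_distrib_right)
      also have "\<dots> \<le> (\<Sum>j. C ^ (j + n) / fact (j + n)) * ell2_norm X f"
        by (intro mult_right_mono sum_le_suminf summ) (auto simp: C_nonneg)
      finally show ?thesis .
    qed
    ultimately show ?thesis by (intro LIMSEQ_le_const2) auto
  qed
  show "g n \<in> ell2 X" by (rule ell2I(1)[OF *])
  show "ell2_norm X (g n) \<le> (\<Sum>j. C ^ (j + n) / fact (j + n)) * ell2_norm X f"
    by (rule ell2I(2)[OF *])
qed

lemma op_exp_ell2: "f \<in> ell2 X \<Longrightarrow> op_exp f \<in> ell2 X"
  and op_exp_bound: "f \<in> ell2 X \<Longrightarrow> ell2_norm X (op_exp f) \<le> (\<Sum>j. C ^ j / fact j) * ell2_norm X f"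
  using op_exp_remainder[of f 0] by simp_all

lemma is_operator_exp_op_exp: "is_operator_exp X A op_exp"
  unfolding is_operator_exp_def
proof (intro conjI ballI allI impI op_exp_ell2)
  fix e :: real assume "e > 0"
  show "\<forall>\<^sub>F n in sequentially. \<forall>f\<in>ell2 X.
      ell2_norm X (\<lambda>x. op_exp f x - (\<Sum>j<n. (A ^^ j) f x / fact j)) \<le> e * ell2_norm X f"
    using order_tendstoD(2)[OF exp_tail_tendsto_0 \<open>e > 0\<close>]
  proof eventually_elim
    case (elim n)
    show ?case
    proof
      fix f assume "f \<in> ell2 X"
      then show "ell2_norm X (\<lambda>x. op_exp f x - (\<Sum>j<n. (A ^^ j) f x / fact j)) \<le> e * ell2_norm X f"
        using op_exp_remainder(2)[of f n] mult_right_mono[OF less_imp_le[OF elim] ell2_norm_nonneg[of X f]]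
        by linarith
    qed
  qed
qed

text \<open>Convergence in norm forces convergence of every value, because a value of a function is
  bounded by its norm.\<close>

lemma operator_exp_unique:
  assumes T: "is_operator_exp X A T" and f: "f \<in> ell2 X" and x: "x \<in> X"
  shows "T f x = op_exp f x"
proof -
  let ?s = "\<lambda>n. \<Sum>j<n. (A ^^ j) f x / fact j"
  have "?s \<longlonglongrightarrow> T f x"
  proof (rule LIMSEQ_I)
    fix e :: real assume "e > 0"
    \<comment> \<open>The summand \<open>1\<close> covers the case that the norm of \<open>f\<close> vanishes.\<close>
    define d where "d = e / (2 * (ell2_norm X f + 1))"
    have d: "d > 0" "d * ell2_norm X f < e"
    proof -
      have pos: "ell2_norm X f + 1 > 0" using ell2_norm_nonneg[of X f] by linarith
      then show "d > 0" using \<open>e > 0\<close> by (simp add: d_def)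
      have "d * ell2_norm X f \<le> d * (ell2_norm X f + 1)" using \<open>d > 0\<close> by simp
      also have "\<dots> = e / 2" using pos by (simp add: d_def field_simps)
      finally show "d * ell2_norm X f < e" using \<open>e > 0\<close> by linarith
    qed
    have "\<forall>\<^sub>F n in sequentially. ell2_norm X (\<lambda>x. T f x - (\<Sum>j<n. (A ^^ j) f x / fact j)) \<le> d * ell2_norm X f"
    proof -
      have "\<forall>\<^sub>F n in sequentially. \<forall>f\<in>ell2 X.
          ell2_norm X (\<lambda>x. T f x - (\<Sum>j<n. (A ^^ j) f x / fact j)) \<le> d * ell2_norm X f"
        using T d(1) by (simp add: is_operator_exp_def)
      then show ?thesis by eventually_elim (use f in blast)
    qed
    then obtain n0 where n0: "\<And>n. n \<ge> n0 \<Longrightarrow>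
        ell2_norm X (\<lambda>x. T f x - (\<Sum>j<n. (A ^^ j) f x / fact j)) \<le> d * ell2_norm X f"
      by (auto simp: eventually_sequentially)
    have mem: "(\<lambda>x. T f x - (\<Sum>j<n. (A ^^ j) f x / fact j)) \<in> ell2 X" for n
    proof -
      have "T f \<in> ell2 X" using T f by (auto simp: is_operator_exp_def)
      moreover have "(\<lambda>x. \<Sum>j<n. (A ^^ j) f x / fact j) \<in> ell2 X"
      proof (rule ell2_sum(1))
        fix j
        show "(\<lambda>x. (A ^^ j) f x / fact j) \<in> ell2 X"
          using ell2_scale(1)[OF pow_ell2[OF f], of "1 / fact j" j] by simp
      qed
      ultimately show ?thesis
        using ell2_diff[where c = 1] by auto
    qed
    have "norm (?s n - T f x) < e" if "n \<ge> n0" for n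
      using cmod_le_ell2_norm[OF mem x, of n] n0[OF that] d(2)
      by (simp add: norm_minus_commute)
    then show "\<exists>n0. \<forall>n\<ge>n0. norm (?s n - T f x) < e" by blast
  qed
  moreover have "?s \<longlonglongrightarrow> op_exp f x"
    using summable_LIMSEQ[OF summable_op_exp[OF f x]] by (simp add: op_exp_def)
  ultimately show ?thesis by (rule LIMSEQ_unique)
qed

lemma op_exp_sub:
  assumes "f \<in> ell2 X" "g \<in> ell2 X" "x \<in> X"
  shows "op_exp (\<lambda>x. f x - c * g x) x = op_exp f x - c * op_exp g x"
proof -
  note f = summable_op_exp[OF assms(1,3)] and g = summable_op_exp[OF assms(2,3)]
  have "op_exp (\<lambda>x. f x - c * g x) x = (\<Sum>j. (A ^^ j) f x / fact j - c * ((A ^^ j) g x / fact j))"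
    by (simp add: op_exp_def pow_diff pow_scale diff_divide_distrib)
  also have "\<dots> = (\<Sum>j. (A ^^ j) f x / fact j) - (\<Sum>j. c * ((A ^^ j) g x / fact j))"
    by (rule suminf_diff[symmetric, OF f summable_mult[OF g]])
  also have "(\<Sum>j. c * ((A ^^ j) g x / fact j)) = c * op_exp g x"
    unfolding op_exp_def by (rule suminf_mult[OF g])
  finally show ?thesis by (simp add: op_exp_def)
qed

text \<open>For fixed \<open>x\<close>, the value \<open>op_exp f x\<close> depends on \<open>f\<close> linearly and continuously. Since \<open>f\<close> is
  the limit in norm of its finite truncations, the value is the sum of its contributions from
  point masses.\<close>

lemma op_exp_kernel_expansion:
  assumes f: "f \<in> ell2 X" and x: "x \<in> X"
  shows "((\<lambda>y. op_exp (point_mass y) x * f y) has_sum op_exp f x) X"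
proof -
  define c where "c = (\<Sum>j. C ^ j / fact j)"
  have finite: "(\<lambda>x. f x - (\<Sum>y\<in>F. f y * point_mass y x)) \<in> ell2 X \<and>
      op_exp (\<lambda>x. f x - (\<Sum>y\<in>F. f y * point_mass y x)) x
      = op_exp f x - (\<Sum>y\<in>F. op_exp (point_mass y) x * f y)" if "finite F" for F
    using that
  proof (induction F)
    case (insert z F)
    let ?g = "\<lambda>x. f x - (\<Sum>y\<in>F. f y * point_mass y x)"
    have eq: "(\<lambda>x. f x - (\<Sum>y\<in>insert z F. f y * point_mass y x)) = (\<lambda>x. ?g x - f z * point_mass z x)"
      using insert.hyps by (simp add: fun_eq_iff diff_diff_eq add.commute)
    have "(\<lambda>x. ?g x - f z * point_mass z x) \<in> ell2 X"
      using insert.IH by (intro ell2_diff point_mass_ell2) auto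
    moreover have "op_exp (\<lambda>x. ?g x - f z * point_mass z x) x = op_exp ?g x - f z * op_exp (point_mass z) x"
      using insert.IH by (intro op_exp_sub point_mass_ell2 x) auto
    ultimately show ?case unfolding eq using insert.hyps insert.IH by (simp add: mult.commute)
  qed (use f in auto)
  have "c > 0" unfolding c_def
    using suminf_pos2[OF summable_C, of 0] C_nonneg by simp
  show ?thesis
    unfolding has_sum_def tendsto_iff eventually_finite_subsets_at_top
  proof (intro allI impI)
    fix e :: real assume "e > 0"
    then obtain F0 where F0: "finite F0" "F0 \<subseteq> X" "\<And>F. finite F \<Longrightarrow> F0 \<subseteq> F \<Longrightarrow> F \<subseteq> X \<Longrightarrow>
       ell2_norm X (\<lambda>x. f x - (\<Sum>y\<in>F. f y * point_mass y x)) \<le> e / (2 * c)"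
      using ell2_tail_small[OF f divide_pos_pos[OF \<open>e > 0\<close>], of "2 * c"] \<open>c > 0\<close> by auto
    have "dist (\<Sum>y\<in>F. op_exp (point_mass y) x * f y) (op_exp f x) < e"
      if F: "finite F" "F \<subseteq> X" "F0 \<subseteq> F" for F
    proof -
      let ?g = "\<lambda>x. f x - (\<Sum>y\<in>F. f y * point_mass y x)"
      have g: "?g \<in> ell2 X" using finite[OF F(1)] by blast
      have "cmod (op_exp ?g x) \<le> c * ell2_norm X ?g"
        unfolding c_def using cmod_le_ell2_norm[OF op_exp_ell2[OF g] x] op_exp_bound[OF g] by linarith
      also have "\<dots> \<le> c * (e / (2 * c))"
        using F0(3)[OF F(1,3,2)] \<open>c > 0\<close> by (intro mult_left_mono) auto
      also have "\<dots> < e" using \<open>c > 0\<close> \<open>e > 0\<close> by simp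
      finally show ?thesis using finite[OF F(1)] by (simp add: dist_norm norm_minus_commute)
    qed
    then show "\<exists>F0. finite F0 \<and> F0 \<subseteq> X \<and> (\<forall>F. finite F \<and> F0 \<subseteq> F \<and> F \<subseteq> X \<longrightarrow>
        dist (\<Sum>y\<in>F. op_exp (point_mass y) x * f y) (op_exp f x) < e)"
      using F0(1,2) by blast
  qed
qed

end

section \<open>Spheres and radial functions on the free product\<close>

text \<open>The weighted sum over the neighbours of a word at position \<open>n\<close>. For \<open>n \<noteq> 0\<close> the condition
  \<open>(n > 0) = even n\<close> says that the last syllable lies in \<open>G\<close>. Then exactly one neighbour along
  \<open>G\<close> drops that syllable and is closer to \<open>0\<close>, the other \<open>M - 1\<close> of them replace it, and the
  neighbours along \<open>H\<close> are one step further away.\<close>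

definition radial_adjacency ::
  "nat \<Rightarrow> nat \<Rightarrow> real \<Rightarrow> real \<Rightarrow> (int \<Rightarrow> real) \<Rightarrow> int \<Rightarrow> real" where
  "radial_adjacency M N \<omega>\<^sub>1 \<omega>\<^sub>2 g n =
     (if n = 0 then real M * \<omega>\<^sub>1 * g (- 1) + real N * \<omega>\<^sub>2 * g 1
      else if (n > 0) = even n
      then \<omega>\<^sub>1 * (g (n - sgn n) + (real M - 1) * g n) + real N * \<omega>\<^sub>2 * g (n + sgn n)
      else \<omega>\<^sub>2 * (g (n - sgn n) + (real N - 1) * g n) + real M * \<omega>\<^sub>1 * g (n + sgn n))"

lemma pi_e_snoc:
  "pi_e (u @ [s]) = (if u = [] then (if isl s then - 1 else 1) else pi_e u + sgn (pi_e u))"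
  by (cases u rule: pi_e.cases; cases s) auto

lemma pi_e_eq_0_iff: "pi_e u = 0 \<longleftrightarrow> u = []"
  by (cases u rule: pi_e.cases) auto

lemma reduced_word_snoc_iff:
  "reduced_word G H (u @ [s]) \<longleftrightarrow>
     reduced_word G H u \<and> reduced_word G H [s] \<and> (u = [] \<or> isl (last u) \<noteq> isl s)"
  by (auto simp: reduced_word_def successively_append_iff)

text \<open>The sign of \<^const>\<open>pi_e\<close> records the kind of the first syllable. As the kinds alternate, the
  parity of the length then fixes the kind of the last one.\<close>

lemma isl_last_iff:
  assumes "reduced_word G H u" "u \<noteq> []"
  shows "isl (last u) \<longleftrightarrow> ((pi_e u > 0) = even (pi_e u))"
  using assms
proof (induction u rule: rev_induct)
  case (snoc s u)
  show ?case
  proof (cases "u = []")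
    case False
    then have "isl (last u) \<longleftrightarrow> ((pi_e u > 0) = even (pi_e u))" "isl s \<noteq> isl (last u)"
      using snoc by (auto simp: reduced_word_snoc_iff)
    moreover have "pi_e u \<noteq> 0" using False by (simp add: pi_e_eq_0_iff)
    ultimately show ?thesis using False
      by (auto simp: pi_e_snoc sgn_if)
  qed (cases s; simp)
qed simp

lemma syl_mult_Cons_reduced:
  "reduced_word G H (s # w) \<Longrightarrow> syl_mult G H s w = s # w"
  by (cases "(G, H, s, w)" rule: syl_mult.cases) (auto simp: reduced_word_Cons_iff)

lemma foldr_syl_mult_append:
  "reduced_word G H (u @ v) \<Longrightarrow> foldr (syl_mult G H) u v = u @ v"
proof (induction u)
  case (Cons s u)
  then have "foldr (syl_mult G H) u v = u @ v" using reduced_word_ConsD by fastforce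
  with Cons.prems show ?case by (simp add: syl_mult_Cons_reduced)
qed simp

locale free_product_graph =
  fixes G :: "('a, 'c) monoid_scheme" and H :: "('b, 'd) monoid_scheme"
    and M N :: nat and \<omega>\<^sub>1 \<omega>\<^sub>2 :: real
  assumes group_G: "group G" and group_H: "group H"
    and finite_G: "finite (carrier G)" and finite_H: "finite (carrier H)"
    and card_G: "card (carrier G) = M + 1" and card_H: "card (carrier H) = N + 1"
begin

sublocale G: group G by (rule group_G)
sublocale H: group H by (rule group_H)
sublocale FP: group "free_product G H" by (rule group_free_product[OF group_G group_H])

abbreviation FP_carrier :: "('a + 'b) list set" where
  "FP_carrier \<equiv> carrier (free_product G H)"

lemma FP_carrier_iff: "x \<in> FP_carrier \<longleftrightarrow> reduced_word G H x"
  by (simp add: free_product_def)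

lemma FP_one: "\<one>\<^bsub>free_product G H\<^esub> = []"
  by (simp add: free_product_def)

lemma FP_mult: "x \<otimes>\<^bsub>free_product G H\<^esub> y = foldr (syl_mult G H) x y"
  by (simp add: free_product_def)

lemma FP_mult_snoc:
  assumes "reduced_word G H (u @ [s'])" "reduced_word G H [s]"
  shows "isl s \<noteq> isl s' \<Longrightarrow> (u @ [s']) \<otimes>\<^bsub>free_product G H\<^esub> [s] = u @ [s'] @ [s]"
    and "s' = Inl c \<Longrightarrow> s = Inl a \<Longrightarrow> (u @ [s']) \<otimes>\<^bsub>free_product G H\<^esub> [s] =
      (if c \<otimes>\<^bsub>G\<^esub> a = \<one>\<^bsub>G\<^esub> then u else u @ [Inl (c \<otimes>\<^bsub>G\<^esub> a)])"
    and "s' = Inr d \<Longrightarrow> s = Inr b \<Longrightarrow> (u @ [s']) \<otimes>\<^bsub>free_product G H\<^esub> [s] =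
      (if d \<otimes>\<^bsub>H\<^esub> b = \<one>\<^bsub>H\<^esub> then u else u @ [Inr (d \<otimes>\<^bsub>H\<^esub> b)])"
proof -
  have u: "reduced_word G H u" "u = [] \<or> isl (last u) \<noteq> isl s'"
    using assms(1) by (auto simp: reduced_word_snoc_iff)
  show "(u @ [s']) \<otimes>\<^bsub>free_product G H\<^esub> [s] = u @ [s'] @ [s]" if "isl s \<noteq> isl s'"
  proof -
    have "reduced_word G H ((u @ [s']) @ [s])"
      unfolding reduced_word_snoc_iff[of G H "u @ [s']"] using assms that by auto
    then show ?thesis
      using foldr_syl_mult_append[of G H "u @ [s']" "[s]"] by (simp add: FP_mult)
  qed
  show "(u @ [s']) \<otimes>\<^bsub>free_product G H\<^esub> [s] =
      (if c \<otimes>\<^bsub>G\<^esub> a = \<one>\<^bsub>G\<^esub> then u else u @ [Inl (c \<otimes>\<^bsub>G\<^esub> a)])" if "s' = Inl c" "s = Inl a"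
    using u assms that foldr_syl_mult_append[of G H u "[]"]
      foldr_syl_mult_append[of G H u "[Inl (c \<otimes>\<^bsub>G\<^esub> a)]"]
    by (auto simp: FP_mult reduced_word_snoc_iff)
  show "(u @ [s']) \<otimes>\<^bsub>free_product G H\<^esub> [s] =
      (if d \<otimes>\<^bsub>H\<^esub> b = \<one>\<^bsub>H\<^esub> then u else u @ [Inr (d \<otimes>\<^bsub>H\<^esub> b)])" if "s' = Inr d" "s = Inr b"
    using u assms that foldr_syl_mult_append[of G H u "[]"]
      foldr_syl_mult_append[of G H u "[Inr (d \<otimes>\<^bsub>H\<^esub> b)]"]
    by (auto simp: FP_mult reduced_word_snoc_iff)
qed

text \<open>Multiplying the last syllable \<open>c\<close> by the nontrivial elements of its factor cancels it exactly
  once, namely for the inverse of \<open>c\<close>.\<close>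

lemma sum_over_factor:
  fixes K :: "('k, 'e) monoid_scheme" and y z :: "'y :: real_vector"
  assumes "group K" "finite (carrier K)" "c \<in> carrier K" "c \<noteq> \<one>\<^bsub>K\<^esub>"
  shows "(\<Sum>a\<in>carrier K - {\<one>\<^bsub>K\<^esub>}. if c \<otimes>\<^bsub>K\<^esub> a = \<one>\<^bsub>K\<^esub> then y else z)
       = y + (real (card (carrier K)) - 2) *\<^sub>R z"
proof -
  interpret K: group K by fact
  let ?K' = "carrier K - {\<one>\<^bsub>K\<^esub>}"
  have inv_mem: "inv\<^bsub>K\<^esub> c \<in> ?K'"
    using assms by simp
  have "(\<Sum>a\<in>?K'. if c \<otimes>\<^bsub>K\<^esub> a = \<one>\<^bsub>K\<^esub> then y else z)
      = (\<Sum>a\<in>?K'. z + (if a = inv\<^bsub>K\<^esub> c then y - z else 0))"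
  proof (rule sum.cong)
    fix a assume "a \<in> ?K'"
    then have "c \<otimes>\<^bsub>K\<^esub> a = \<one>\<^bsub>K\<^esub> \<longleftrightarrow> a = inv\<^bsub>K\<^esub> c"
      using assms(3) by (metis DiffD1 K.inv_equality K.inv_inv K.r_inv)
    then show "(if c \<otimes>\<^bsub>K\<^esub> a = \<one>\<^bsub>K\<^esub> then y else z) = z + (if a = inv\<^bsub>K\<^esub> c then y - z else 0)" by simp
  qed simp
  also have "\<dots> = of_nat (card ?K') *\<^sub>R z + (y - z)"
    using inv_mem assms(2) by (simp add: sum.distrib sum.delta scaleR_conv_of_real sum_constant_scaleR)
  also have "real (card ?K') = real (card (carrier K)) - 1"
    using assms(2) card_gt_0_iff[of "carrier K"] by (auto simp: card_Diff_singleton of_nat_diff)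
  finally show ?thesis by (simp add: algebra_simps scaleR_2)
qed

lemma card_G_minus_one: "card (carrier G - {\<one>\<^bsub>G\<^esub>}) = M"
  and card_H_minus_one: "card (carrier H - {\<one>\<^bsub>H\<^esub>}) = N"
  using card_G card_H finite_G finite_H by (auto simp: card_Diff_singleton)

abbreviation "lap \<equiv> laplacian G H \<omega>\<^sub>1 \<omega>\<^sub>2"

lemma laplacian_radial:
  assumes f: "\<And>y. y \<in> FP_carrier \<Longrightarrow> f y = of_real (g (pi_e y))" and x: "x \<in> FP_carrier"
  shows "lap f x = of_real (g (pi_e x) - radial_adjacency M N \<omega>\<^sub>1 \<omega>\<^sub>2 g (pi_e x) / kappa M N \<omega>\<^sub>1 \<omega>\<^sub>2)"
proof -
  let ?m = "\<lambda>s. x \<otimes>\<^bsub>free_product G H\<^esub> [s]"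
  let ?G' = "carrier G - {\<one>\<^bsub>G\<^esub>}" and ?H' = "carrier H - {\<one>\<^bsub>H\<^esub>}"
  define n where "n = pi_e x"
  have xw: "reduced_word G H x" using x by (simp add: FP_carrier_iff)
  have fm: "f (?m s) = of_real (g (pi_e (?m s)))" if "reduced_word G H [s]" for s
    using that x by (intro f FP.m_closed) (auto simp: FP_carrier_iff)
  have "(\<Sum>a\<in>?G'. of_real \<omega>\<^sub>1 * f (?m (Inl a))) + (\<Sum>b\<in>?H'. of_real \<omega>\<^sub>2 * f (?m (Inr b)))
      = of_real (\<omega>\<^sub>1 * (\<Sum>a\<in>?G'. g (pi_e (?m (Inl a)))) + \<omega>\<^sub>2 * (\<Sum>b\<in>?H'. g (pi_e (?m (Inr b)))))"
    by (simp add: fm sum_distrib_left)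
  also have "\<omega>\<^sub>1 * (\<Sum>a\<in>?G'. g (pi_e (?m (Inl a)))) + \<omega>\<^sub>2 * (\<Sum>b\<in>?H'. g (pi_e (?m (Inr b))))
      = radial_adjacency M N \<omega>\<^sub>1 \<omega>\<^sub>2 g n"
  proof (cases x rule: rev_cases)
    case Nil
    have "(\<Sum>a\<in>?G'. g (pi_e (?m (Inl a)))) = M * g (-1)" "(\<Sum>b\<in>?H'. g (pi_e (?m (Inr b)))) = N * g 1"
      by (simp_all add: Nil FP_mult card_G_minus_one card_H_minus_one)
    then show ?thesis by (simp add: n_def Nil radial_adjacency_def)
  next
    case (snoc u s')
    have n0: "n \<noteq> 0" using snoc by (simp add: n_def pi_e_eq_0_iff)
    have inward: "pi_e u = n - sgn n"
      using n0 by (auto simp: n_def snoc pi_e_snoc pi_e_eq_0_iff sgn_if split: if_splits)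
    have stay: "pi_e (u @ [s]) = n" if "isl s = isl s'" for s
      using that by (simp add: n_def snoc pi_e_snoc)
    have outward: "pi_e (u @ [s'] @ [s]) = n + sgn n" for s
      using pi_e_snoc[of x s] by (simp add: n_def snoc)
    have last: "isl s' \<longleftrightarrow> ((n > 0) = even n)"
      using isl_last_iff[OF xw] by (simp add: n_def snoc)
    note mult = FP_mult_snoc[OF xw[unfolded snoc]]
    show ?thesis
    proof (cases s')
      case (Inl c)
      have c: "c \<in> carrier G" "c \<noteq> \<one>\<^bsub>G\<^esub>"
        using xw by (auto simp: snoc Inl reduced_word_snoc_iff)
      have "(\<Sum>a\<in>?G'. g (pi_e (?m (Inl a))))
          = (\<Sum>a\<in>?G'. if c \<otimes>\<^bsub>G\<^esub> a = \<one>\<^bsub>G\<^esub> then g (n - sgn n) else g n)"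
        by (rule sum.cong) (use mult(2) inward stay in \<open>auto simp: snoc Inl\<close>)
      also have "\<dots> = g (n - sgn n) + (real M - 1) * g n"
        using sum_over_factor[OF group_G finite_G c, of "g (n - sgn n)" "g n"] by (simp add: card_G)
      finally have G: "(\<Sum>a\<in>?G'. g (pi_e (?m (Inl a)))) = \<dots>" .
      have "(\<Sum>b\<in>?H'. g (pi_e (?m (Inr b)))) = (\<Sum>b\<in>?H'. g (n + sgn n))"
        by (rule sum.cong) (use mult(1) outward in \<open>auto simp: snoc Inl\<close>)
      then have H: "(\<Sum>b\<in>?H'. g (pi_e (?m (Inr b)))) = N * g (n + sgn n)"
        by (simp add: card_H_minus_one)
      show ?thesis using n0 last unfolding G H radial_adjacency_def by (simp add: Inl)
    next
      case (Inr d)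
      have d: "d \<in> carrier H" "d \<noteq> \<one>\<^bsub>H\<^esub>"
        using xw by (auto simp: snoc Inr reduced_word_snoc_iff)
      have "(\<Sum>b\<in>?H'. g (pi_e (?m (Inr b))))
          = (\<Sum>b\<in>?H'. if d \<otimes>\<^bsub>H\<^esub> b = \<one>\<^bsub>H\<^esub> then g (n - sgn n) else g n)"
        by (rule sum.cong) (use mult(3) inward stay in \<open>auto simp: snoc Inr\<close>)
      also have "\<dots> = g (n - sgn n) + (real N - 1) * g n"
        using sum_over_factor[OF group_H finite_H d, of "g (n - sgn n)" "g n"] by (simp add: card_H)
      finally have H: "(\<Sum>b\<in>?H'. g (pi_e (?m (Inr b)))) = \<dots>" .
      have "(\<Sum>a\<in>?G'. g (pi_e (?m (Inl a)))) = (\<Sum>a\<in>?G'. g (n + sgn n))"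
        by (rule sum.cong) (use mult(1) outward in \<open>auto simp: snoc Inr\<close>)
      then have G: "(\<Sum>a\<in>?G'. g (pi_e (?m (Inl a)))) = M * g (n + sgn n)"
        by (simp add: card_G_minus_one)
      show ?thesis using n0 last unfolding G H radial_adjacency_def by (simp add: Inr)
    qed
  qed
  finally show ?thesis
    using f[OF x] by (simp add: laplacian_def card_G card_H n_def)
qed

definition sphere :: "int \<Rightarrow> ('a + 'b) list set" where
  "sphere n = {x \<in> FP_carrier. pi_e x = n}"

lemma sphere_0: "sphere 0 = {[]}"
  by (auto simp: sphere_def pi_e_eq_0_iff FP_carrier_iff)

definition letters :: "bool \<Rightarrow> ('a + 'b) set" where
  "letters l = (if l then Inl ` (carrier G - {\<one>\<^bsub>G\<^esub>}) else Inr ` (carrier H - {\<one>\<^bsub>H\<^esub>}))"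

lemma letters_iff: "s \<in> letters l \<longleftrightarrow> reduced_word G H [s] \<and> isl s = l"
  by (cases s) (auto simp: letters_def)

lemma card_letters: "card (letters l) = (if l then M else N)"
  using card_G_minus_one card_H_minus_one by (simp add: letters_def card_image)

text \<open>Words one step further from the identity arise, each in one way, by appending a syllable of
  the kind opposite to the last one.\<close>

lemma card_sphere_step:
  assumes "n = 0 \<and> \<bar>e\<bar> = 1 \<or> n \<noteq> 0 \<and> e = sgn n"
  shows "card (sphere (n + e)) = card (sphere n) * (if (e > 0) = odd n then M else N)"
proof -
  have "sphere (n + e) = (\<lambda>(u, s). u @ [s]) ` (sphere n \<times> letters ((e > 0) = odd n))"
  proof (intro equalityI subsetI)
    fix x assume "x \<in> sphere (n + e)"
    then have x: "reduced_word G H x" "pi_e x = n + e" by (auto simp: sphere_def FP_carrier_iff)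
    have ne: "n + e \<noteq> 0" using assms by (auto simp: sgn_if split: if_splits)
    then obtain u s where us: "x = u @ [s]" using x(2) by (cases x rule: rev_cases) auto
    have "isl s \<longleftrightarrow> ((n + e > 0) = even (n + e))" using isl_last_iff[OF x(1)] by (simp add: us x(2)[unfolded us])
    also have "\<dots> \<longleftrightarrow> ((e > 0) = odd n)" using assms by (auto simp: sgn_if abs_if split: if_splits)
    finally have s: "isl s \<longleftrightarrow> ((e > 0) = odd n)" .
    have "pi_e u = n"
      using x(2) assms by (auto simp: us pi_e_snoc sgn_if pi_e_eq_0_iff abs_if split: if_splits)
    with s x(1) show "x \<in> (\<lambda>(u, s). u @ [s]) ` (sphere n \<times> letters ((e > 0) = odd n))"
      by (auto simp: us sphere_def FP_carrier_iff letters_iff reduced_word_snoc_iff)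
  next
    fix x assume "x \<in> (\<lambda>(u, s). u @ [s]) ` (sphere n \<times> letters ((e > 0) = odd n))"
    then obtain u s where us: "x = u @ [s]" "reduced_word G H u" "pi_e u = n"
        "reduced_word G H [s]" "isl s = ((e > 0) = odd n)"
      by (auto simp: sphere_def FP_carrier_iff letters_iff)
    have "u = [] \<or> isl (last u) \<noteq> isl s"
      using isl_last_iff[OF us(2)] us(3,5) assms by (auto simp: sgn_if pi_e_eq_0_iff split: if_splits)
    moreover have "pi_e (u @ [s]) = n + e"
      using us(3,5) assms by (auto simp: pi_e_snoc pi_e_eq_0_iff abs_if split: if_splits)
    ultimately show "x \<in> sphere (n + e)"
      using us by (simp add: sphere_def FP_carrier_iff reduced_word_snoc_iff)
  qed
  moreover have "inj_on (\<lambda>(u, s). u @ [s]) (sphere n \<times> letters ((e > 0) = odd n))"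
    by (auto simp: inj_on_def)
  ultimately show ?thesis
    by (simp add: card_image card_cartesian_product card_letters)
qed

lemma card_sphere_pos:
  assumes "0 < M" "0 < N"
  shows "0 < card (sphere n)"
proof -
  have "0 < card (sphere (int m)) \<and> 0 < card (sphere (- int m))" for m
  proof (induction m)
    case 0
    then show ?case by (simp add: sphere_0)
  next
    case (Suc m)
    have "card (sphere (int m + 1)) = card (sphere (int m)) * (if (1 > (0::int)) = odd (int m) then M else N)"
      by (rule card_sphere_step) (auto simp: sgn_if)
    moreover have "card (sphere (- int m + - 1)) = card (sphere (- int m)) * (if (- 1 > (0::int)) = odd (- int m) then M else N)"
      by (rule card_sphere_step) (auto simp: sgn_if)
    moreover have "int (Suc m) = int m + 1" "- int (Suc m) = - int m + - 1" by simp_all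
    ultimately show ?case using Suc assms by (simp only: mult_pos_pos split: if_splits) auto
  qed
  from this[of "nat \<bar>n\<bar>"] show ?thesis by (cases "n \<ge> 0") simp_all
qed

lemma laplacian_left_invariant:
  assumes f: "\<And>x. x \<in> FP_carrier \<Longrightarrow> f x = h (y \<otimes>\<^bsub>free_product G H\<^esub> x)"
    and y: "y \<in> FP_carrier" and x: "x \<in> FP_carrier"
  shows "lap f x = lap h (y \<otimes>\<^bsub>free_product G H\<^esub> x)"
proof -
  have "f (x \<otimes>\<^bsub>free_product G H\<^esub> [s]) = h (y \<otimes>\<^bsub>free_product G H\<^esub> x \<otimes>\<^bsub>free_product G H\<^esub> [s])"
    if "reduced_word G H [s]" for s
  proof -
    have s: "[s] \<in> FP_carrier" using that by (simp add: FP_carrier_iff)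
    show ?thesis using f[OF FP.m_closed[OF x s]] FP.m_assoc[OF y x s] by simp
  qed
  then show ?thesis using f[OF x] by (simp add: laplacian_def)
qed

text \<open>Right translations permute the group and are therefore isometries.\<close>

lemma translate_ell2:
  assumes f: "f \<in> ell2 FP_carrier" and s: "s \<in> FP_carrier"
  shows "(\<lambda>x. c * f (x \<otimes>\<^bsub>free_product G H\<^esub> s)) \<in> ell2 FP_carrier"
    and "ell2_norm FP_carrier (\<lambda>x. c * f (x \<otimes>\<^bsub>free_product G H\<^esub> s)) \<le> cmod c * ell2_norm FP_carrier f"
proof -
  have "bij_betw (\<lambda>x. x \<otimes>\<^bsub>free_product G H\<^esub> s) FP_carrier FP_carrier"
    by (rule bij_betw_byWitness[of _ "\<lambda>x. x \<otimes>\<^bsub>free_product G H\<^esub> inv\<^bsub>free_product G H\<^esub> s"])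
      (use s in \<open>auto simp: FP.m_assoc\<close>)
  from ell2_reindex[OF this, of f] f
  show "(\<lambda>x. c * f (x \<otimes>\<^bsub>free_product G H\<^esub> s)) \<in> ell2 FP_carrier"
    and "ell2_norm FP_carrier (\<lambda>x. c * f (x \<otimes>\<^bsub>free_product G H\<^esub> s)) \<le> cmod c * ell2_norm FP_carrier f"
    using ell2_scale[of "\<lambda>x. f (x \<otimes>\<^bsub>free_product G H\<^esub> s)" FP_carrier c] by simp_all
qed

definition heat_gen :: "real \<Rightarrow> (('a + 'b) list \<Rightarrow> complex) \<Rightarrow> ('a + 'b) list \<Rightarrow> complex" where
  "heat_gen t f x = - of_real t * lap f x"

lemma heat_gen_left_invariant:
  assumes "\<And>x. x \<in> FP_carrier \<Longrightarrow> f x = h (y \<otimes>\<^bsub>free_product G H\<^esub> x)"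
    and "y \<in> FP_carrier" and "x \<in> FP_carrier"
  shows "heat_gen t f x = heat_gen t h (y \<otimes>\<^bsub>free_product G H\<^esub> x)"
  by (simp add: heat_gen_def laplacian_left_invariant[where f = f and h = h, OF assms])

lemma heat_gen_radial:
  assumes "\<And>y. y \<in> FP_carrier \<Longrightarrow> f y = of_real (g (pi_e y))" and "x \<in> FP_carrier"
  shows "heat_gen t f x =
    of_real (- t * (g (pi_e x) - radial_adjacency M N \<omega>\<^sub>1 \<omega>\<^sub>2 g (pi_e x) / kappa M N \<omega>\<^sub>1 \<omega>\<^sub>2))"
  by (simp add: heat_gen_def laplacian_radial[where f = f and g = g, OF assms])

text \<open>The operator is a finite linear combination of right translations.\<close>

lemma heat_gen_bounded: "\<exists>C. bounded_ell2_operator FP_carrier (heat_gen t) C"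
proof -
  let ?X = FP_carrier
  let ?G' = "carrier G - {\<one>\<^bsub>G\<^esub>}" and ?H' = "carrier H - {\<one>\<^bsub>H\<^esub>}"
  define c0 c1 c2 :: complex where "c0 = - of_real t" and "c1 = of_real (t * \<omega>\<^sub>1 / kappa M N \<omega>\<^sub>1 \<omega>\<^sub>2)"
    and "c2 = of_real (t * \<omega>\<^sub>2 / kappa M N \<omega>\<^sub>1 \<omega>\<^sub>2)"
  let ?P1 = "\<lambda>f x. \<Sum>a\<in>?G'. c1 * f (x \<otimes>\<^bsub>free_product G H\<^esub> [Inl a])"
  let ?P2 = "\<lambda>f x. \<Sum>b\<in>?H'. c2 * f (x \<otimes>\<^bsub>free_product G H\<^esub> [Inr b])"
  have split: "heat_gen t f x = (c0 * f x + ?P1 f x) + ?P2 f x" for f x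
  proof -
    have "heat_gen t f x = c0 * f x + (\<Sum>a\<in>?G'. of_real \<omega>\<^sub>1 * (of_real t / of_real (kappa M N \<omega>\<^sub>1 \<omega>\<^sub>2)) * f (x \<otimes>\<^bsub>free_product G H\<^esub> [Inl a]))
        + (\<Sum>b\<in>?H'. of_real \<omega>\<^sub>2 * (of_real t / of_real (kappa M N \<omega>\<^sub>1 \<omega>\<^sub>2)) * f (x \<otimes>\<^bsub>free_product G H\<^esub> [Inr b]))"
      unfolding heat_gen_def laplacian_def mult.assoc sum_distrib_left[symmetric]
      by (simp add: card_G card_H c0_def algebra_simps)
    then show ?thesis by (simp add: c1_def c2_def mult.commute)
  qed
  have P1: "?P1 f \<in> ell2 ?X" "ell2_norm ?X (?P1 f) \<le> (\<Sum>a\<in>?G'. cmod c1) * ell2_norm ?X f"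
    if f: "f \<in> ell2 ?X" for f
  proof -
    have l: "[Inl a] \<in> ?X" if "a \<in> ?G'" for a using that by (auto simp: FP_carrier_iff)
    show "?P1 f \<in> ell2 ?X" by (intro ell2_sum(1) translate_ell2(1) f l)
    have "ell2_norm ?X (?P1 f) \<le> (\<Sum>a\<in>?G'. ell2_norm ?X (\<lambda>x. c1 * f (x \<otimes>\<^bsub>free_product G H\<^esub> [Inl a])))"
      by (intro ell2_sum(2) translate_ell2(1) f l)
    also have "\<dots> \<le> (\<Sum>a\<in>?G'. cmod c1 * ell2_norm ?X f)"
      by (intro sum_mono translate_ell2(2) f l)
    finally show "ell2_norm ?X (?P1 f) \<le> (\<Sum>a\<in>?G'. cmod c1) * ell2_norm ?X f"
      by (simp add: sum_distrib_right)
  qed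
  have P2: "?P2 f \<in> ell2 ?X" "ell2_norm ?X (?P2 f) \<le> (\<Sum>b\<in>?H'. cmod c2) * ell2_norm ?X f"
    if f: "f \<in> ell2 ?X" for f
  proof -
    have l: "[Inr a] \<in> ?X" if "a \<in> ?H'" for a using that by (auto simp: FP_carrier_iff)
    show "?P2 f \<in> ell2 ?X" by (intro ell2_sum(1) translate_ell2(1) f l)
    have "ell2_norm ?X (?P2 f) \<le> (\<Sum>b\<in>?H'. ell2_norm ?X (\<lambda>x. c2 * f (x \<otimes>\<^bsub>free_product G H\<^esub> [Inr b])))"
      by (intro ell2_sum(2) translate_ell2(1) f l)
    also have "\<dots> \<le> (\<Sum>b\<in>?H'. cmod c2 * ell2_norm ?X f)"
      by (intro sum_mono translate_ell2(2) f l)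
    finally show "ell2_norm ?X (?P2 f) \<le> (\<Sum>b\<in>?H'. cmod c2) * ell2_norm ?X f"
      by (simp add: sum_distrib_right)
  qed
  define C where "C = cmod c0 + (\<Sum>a\<in>?G'. cmod c1) + (\<Sum>b\<in>?H'. cmod c2)"
  have mem: "heat_gen t f \<in> ell2 ?X" and bound: "ell2_norm ?X (heat_gen t f) \<le> C * ell2_norm ?X f"
    if f: "f \<in> ell2 ?X" for f
  proof -
    note s0 = ell2_scale[OF f, of c0]
    note s1 = ell2_add[OF s0(1) P1(1)[OF f]]
    note s2 = ell2_add[OF s1(1) P2(1)[OF f]]
    have eq: "heat_gen t f = (\<lambda>x. (c0 * f x + ?P1 f x) + ?P2 f x)" by (rule ext) (rule split)
    show "heat_gen t f \<in> ell2 ?X" unfolding eq by (rule s2(1))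
    show "ell2_norm ?X (heat_gen t f) \<le> C * ell2_norm ?X f"
      unfolding eq using s2(2) s1(2) s0(2) P1(2)[OF f] P2(2)[OF f] by (simp add: C_def distrib_right)
  qed
  have "bounded_ell2_operator ?X (heat_gen t) C"
  proof
    show "heat_gen t (\<lambda>x. f x - g x) = (\<lambda>x. heat_gen t f x - heat_gen t g x)" for f g
      unfolding split by (simp add: fun_eq_iff right_diff_distrib sum_subtractf)
    show "heat_gen t (\<lambda>x. c * f x) = (\<lambda>x. c * heat_gen t f x)" for c f
      unfolding split by (simp add: fun_eq_iff distrib_left sum_distrib_left mult.left_commute)
    show "0 \<le> C" unfolding C_def by (intro add_nonneg_nonneg sum_nonneg) auto
  qed (fact mem bound)+
  then show ?thesis ..
qed

text \<open>Applied to the point mass at the identity, the convolution formula has a single term, so the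
  kernel must be the image of that point mass. Conversely, by left invariance the image of the point
  mass at \<open>y\<close> is the translate by \<open>y\<close>, and the expansion over point masses becomes the convolution
  formula.\<close>

theorem is_heat_kernel_iff:
  "is_heat_kernel G H \<omega>\<^sub>1 \<omega>\<^sub>2 t k \<longleftrightarrow>
     (\<forall>x\<in>FP_carrier. of_real (k x) = (\<Sum>j. (heat_gen t ^^ j) (point_mass []) x / fact j))"
proof -
  let ?B = "free_product G H"
  obtain C where "bounded_ell2_operator FP_carrier (heat_gen t) C" using heat_gen_bounded by blast
  then interpret A: bounded_ell2_operator FP_carrier "heat_gen t" C .
  have hg: "(\<lambda>f x. - of_real t * lap f x) = heat_gen t"
    by (simp add: fun_eq_iff heat_gen_def)
  have shift: "(heat_gen t ^^ j) (point_mass y) x = (heat_gen t ^^ j) (point_mass []) (inv\<^bsub>?B\<^esub> y \<otimes>\<^bsub>?B\<^esub> x)"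
    if "x \<in> FP_carrier" "y \<in> FP_carrier" for j x y
    using that(1)
  proof (induction j arbitrary: x)
    case 0
    have "inv\<^bsub>?B\<^esub> y \<otimes>\<^bsub>?B\<^esub> x = [] \<longleftrightarrow> x = y"
      using FP.Units_l_cancel[of "inv\<^bsub>?B\<^esub> y" x y] FP.l_inv[OF that(2)] 0 that(2) by (simp add: FP_one)
    then show ?case by (simp add: point_mass_def)
  next
    case (Suc j)
    then show ?case
      using heat_gen_left_invariant[where h = "(heat_gen t ^^ j) (point_mass [])"
          and f = "(heat_gen t ^^ j) (point_mass y)", OF Suc.IH FP.inv_closed[OF that(2)] Suc.prems]
      by simp
  qed
  have exp_shift: "A.op_exp (point_mass y) x = A.op_exp (point_mass []) (inv\<^bsub>?B\<^esub> y \<otimes>\<^bsub>?B\<^esub> x)"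
    if "x \<in> FP_carrier" "y \<in> FP_carrier" for x y
    using shift[OF that] by (simp add: A.op_exp_def)
  have "is_heat_kernel G H \<omega>\<^sub>1 \<omega>\<^sub>2 t k \<longleftrightarrow> (\<forall>x\<in>FP_carrier. of_real (k x) = A.op_exp (point_mass []) x)"
  proof
    assume "is_heat_kernel G H \<omega>\<^sub>1 \<omega>\<^sub>2 t k"
    then obtain T where T: "is_operator_exp FP_carrier (heat_gen t) T"
      and k: "\<And>f x. f \<in> ell2 FP_carrier \<Longrightarrow> x \<in> FP_carrier \<Longrightarrow>
        ((\<lambda>y. of_real (k (inv\<^bsub>?B\<^esub> y \<otimes>\<^bsub>?B\<^esub> x)) * f y) has_sum T f x) FP_carrier"
      unfolding is_heat_kernel_def is_heat_operator_def hg Let_def by blast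
    show "\<forall>x\<in>FP_carrier. of_real (k x) = A.op_exp (point_mass []) x"
    proof
      fix x assume x: "x \<in> FP_carrier"
      have "((\<lambda>y. of_real (k (inv\<^bsub>?B\<^esub> y \<otimes>\<^bsub>?B\<^esub> x)) * point_mass [] y) has_sum
          of_real (k x)) FP_carrier"
      proof (rule has_sum_finite_neutralI[where B = "{[]}"])
        show "of_real (k x) = (\<Sum>y\<in>{[]}. of_real (k (inv\<^bsub>?B\<^esub> y \<otimes>\<^bsub>?B\<^esub> x)) * point_mass [] y)"
          using FP.inv_one FP.l_one[OF x] by (simp add: FP_one point_mass_def)
      qed (auto simp: point_mass_def FP_carrier_iff)
      then have "of_real (k x) = T (point_mass []) x"
        using k[OF point_mass_ell2 x] has_sum_unique by blast
      then show "of_real (k x) = A.op_exp (point_mass []) x"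
        using A.operator_exp_unique[OF T point_mass_ell2 x] by simp
    qed
  next
    assume k: "\<forall>x\<in>FP_carrier. of_real (k x) = A.op_exp (point_mass []) x"
    have "((\<lambda>y. of_real (k (inv\<^bsub>?B\<^esub> y \<otimes>\<^bsub>?B\<^esub> x)) * f y) has_sum A.op_exp f x) FP_carrier"
      if "f \<in> ell2 FP_carrier" "x \<in> FP_carrier" for f x
      using A.op_exp_kernel_expansion[OF that]
      by (rule has_sum_cong[THEN iffD1, rotated]) (use k that(2) exp_shift in auto)
    then show "is_heat_kernel G H \<omega>\<^sub>1 \<omega>\<^sub>2 t k"
      unfolding is_heat_kernel_def is_heat_operator_def hg Let_def
      using A.is_operator_exp_op_exp by blast
  qed
  then show ?thesis by (simp add: A.op_exp_def)
qed

lemma heat_gen_pow_radial: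
  assumes g0: "\<And>n. g 0 n = (if n = 0 then 1 else 0)"
    and step: "\<And>j n. g (Suc j) n = g j n - radial_adjacency M N \<omega>\<^sub>1 \<omega>\<^sub>2 (g j) n / kappa M N \<omega>\<^sub>1 \<omega>\<^sub>2"
    and x: "x \<in> FP_carrier"
  shows "(heat_gen t ^^ j) (point_mass []) x = of_real ((- t) ^ j * g j (pi_e x))"
  using x
proof (induction j arbitrary: x)
  case 0
  then show ?case by (simp add: point_mass_def g0 pi_e_eq_0_iff)
next
  case (Suc j)
  have "heat_gen t ((heat_gen t ^^ j) (point_mass [])) x
      = of_real (- t * ((- t) ^ j * g j (pi_e x)
          - radial_adjacency M N \<omega>\<^sub>1 \<omega>\<^sub>2 (\<lambda>n. (- t) ^ j * g j n) (pi_e x) / kappa M N \<omega>\<^sub>1 \<omega>\<^sub>2))"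
    by (rule heat_gen_radial[where g = "\<lambda>n. (- t) ^ j * g j n" and f = "(heat_gen t ^^ j) (point_mass [])",
      OF Suc.IH Suc.prems])
  also have "radial_adjacency M N \<omega>\<^sub>1 \<omega>\<^sub>2 (\<lambda>n. (- t) ^ j * g j n) (pi_e x)
      = (- t) ^ j * radial_adjacency M N \<omega>\<^sub>1 \<omega>\<^sub>2 (g j) (pi_e x)"
    by (simp add: radial_adjacency_def algebra_simps)
  finally show ?case by (simp add: step algebra_simps)
qed

end

section \<open>Auxiliary facts on integrals, matrices and integers\<close>

lemma has_integral_cos_int:
  fixes k :: int
  shows "((\<lambda>x. cos (real_of_int k * x)) has_integral (if k = 0 then pi else 0)) {0..pi}"
proof (cases "k = 0")
  case True
  then show ?thesis using has_integral_const_real[of "1 :: real" 0 pi] by simp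
next
  case False
  have "((\<lambda>x. cos (real_of_int k * x)) has_integral
      (sin (real_of_int k * pi) / real_of_int k - sin (real_of_int k * 0) / real_of_int k)) {0..pi}"
    by (rule fundamental_theorem_of_calculus)
      (use False in \<open>auto intro!: derivative_eq_intros simp flip: has_real_derivative_iff_has_vector_derivative\<close>)
  then show ?thesis using False by (simp add: mult.commute sin_integer_2pi)
qed

lemma has_integral_sin_sin:
  fixes j k :: nat
  shows "((\<lambda>x. sin (real (Suc j) * x) * sin (real (Suc k) * x)) has_integral
    (if j = k then pi / 2 else 0)) {0..pi}"
proof -
  have "((\<lambda>x. (cos (real_of_int (int j - int k) * x) - cos (real_of_int (int j + int k + 2) * x)) / 2)
      has_integral ((if int j - int k = 0 then pi else 0) - (if int j + int k + 2 = 0 then pi else 0)) / 2) {0..pi}"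
    by (intro has_integral_divide has_integral_diff has_integral_cos_int)
  moreover have "(cos (real_of_int (int j - int k) * x) - cos (real_of_int (int j + int k + 2) * x)) / 2
      = sin (real (Suc j) * x) * sin (real (Suc k) * x)" for x
    by (simp add: sin_times_sin algebra_simps)
  ultimately show ?thesis by (cases "j = k") auto
qed

lemma poisson_denominator_ge:
  fixes r x :: real
  assumes "\<bar>r\<bar> < 1"
  shows "(1 - \<bar>r\<bar>)\<^sup>2 \<le> 1 + r\<^sup>2 - 2 * r * cos x" "0 < 1 + r\<^sup>2 - 2 * r * cos x"
proof -
  have "\<bar>r * cos x\<bar> \<le> \<bar>r\<bar> * 1" unfolding abs_mult by (intro mult_left_mono) auto
  then show le: "(1 - \<bar>r\<bar>)\<^sup>2 \<le> 1 + r\<^sup>2 - 2 * r * cos x"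
    by (simp add: power2_diff abs_le_iff)
  have "0 < (1 - \<bar>r\<bar>)\<^sup>2" using assms by simp
  with le show "0 < 1 + r\<^sup>2 - 2 * r * cos x" by linarith
qed

text \<open>Partial sum with remainder of the expansion of the conjugate Poisson kernel,
  \<open>sin x / (1 + r\<^sup>2 - 2 r cos x) = (\<Sum>j. r^j sin ((j + 1) x))\<close>.\<close>

lemma poisson_telescope:
  fixes r x :: real
  shows "sin x = (1 + r\<^sup>2 - 2 * r * cos x) * (\<Sum>j<n. r ^ j * sin (real (Suc j) * x))
    + r ^ n * (sin (real (Suc n) * x) - r * sin (real n * x))"
proof (induction n)
  case (Suc n)
  have "2 * cos x * sin (real (Suc n) * x) = sin (real (Suc (Suc n)) * x) + sin (real n * x)"
  proof -
    have "real (Suc (Suc n)) * x = real (Suc n) * x + x" "real n * x = real (Suc n) * x - x"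
      by (simp_all add: algebra_simps)
    then show ?thesis by (simp only: sin_add sin_diff) (simp add: algebra_simps)
  qed
  then have "(1 + r\<^sup>2 - 2 * r * cos x) * (r ^ n * sin (real (Suc n) * x))
      = r ^ n * ((1 + r\<^sup>2) * sin (real (Suc n) * x) - r * (sin (real (Suc (Suc n)) * x) + sin (real n * x)))"
    by (simp add: algebra_simps)
  with Suc show ?case by (simp add: algebra_simps power2_eq_square)
qed simp

text \<open>In the expansion of the conjugate Poisson kernel the orthogonality of the sines singles out
  one term. The remainder is uniformly of order \<open>\<bar>r\<bar>^n\<close>, the denominator being at least
  \<open>(1 - \<bar>r\<bar>)\<^sup>2\<close>.\<close>

lemma has_integral_poisson:
  fixes r :: real
  assumes r: "\<bar>r\<bar> < 1"
  shows "((\<lambda>x. sin x * sin (real (Suc k) * x) / (1 + r\<^sup>2 - 2 * r * cos x)) has_integral (pi / 2 * r ^ k)) {0..pi}"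
proof -
  let ?d = "\<lambda>x. 1 + r\<^sup>2 - 2 * r * cos x"
  let ?s = "\<lambda>k x. sin (real (Suc k) * x)"
  let ?e = "\<lambda>n x. (sin (real (Suc n) * x) - r * sin (real n * x)) * ?s k x / ?d x"
  note d = poisson_denominator_ge[OF r]
  have d0: "?d x \<noteq> 0" for x using d(2)[of x] by simp
  define I where "I = integral {0..pi} (\<lambda>x. sin x * ?s k x / ?d x)"
  have I: "((\<lambda>x. sin x * ?s k x / ?d x) has_integral I) {0..pi}"
    unfolding I_def using d0 by (intro integrable_integral integrable_continuous_real continuous_intros) auto
  define c where "c = 2 / (1 - \<bar>r\<bar>)\<^sup>2"
  have bound: "\<bar>I - pi / 2 * r ^ k\<bar> \<le> c * pi * \<bar>r\<bar> ^ n" if "n > k" for n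
  proof -
    define E where "E = integral {0..pi} (?e n)"
    have E: "(?e n has_integral E) {0..pi}"
      unfolding E_def using d0 by (intro integrable_integral integrable_continuous_real continuous_intros) auto
    have "((\<lambda>x. (\<Sum>j<n. r ^ j * (?s j x * ?s k x)) + r ^ n * ?e n x) has_integral
        (\<Sum>j<n. r ^ j * (if j = k then pi / 2 else 0)) + r ^ n * E) {0..pi}"
      by (intro has_integral_add has_integral_sum has_integral_mult_right has_integral_sin_sin E) auto
    moreover have "(\<Sum>j<n. r ^ j * (?s j x * ?s k x)) + r ^ n * ?e n x = sin x * ?s k x / ?d x" for x
    proof -
      have "sin x * ?s k x / ?d x = (?d x * (\<Sum>j<n. r ^ j * ?s j x)
          + r ^ n * (sin (real (Suc n) * x) - r * sin (real n * x))) * ?s k x / ?d x"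
        using poisson_telescope[of x r n] by simp
      also have "\<dots> = (\<Sum>j<n. r ^ j * ?s j x) * ?s k x + r ^ n * ?e n x"
        using d0[of x] by (simp add: add_divide_distrib distrib_right)
      finally show ?thesis by (simp add: sum_distrib_right mult.assoc)
    qed
    ultimately have "I = (\<Sum>j<n. r ^ j * (if j = k then pi / 2 else 0)) + r ^ n * E"
      using has_integral_unique I by auto
    also have "(\<Sum>j<n. r ^ j * (if j = k then pi / 2 else 0)) = pi / 2 * r ^ k"
      using that by (simp add: if_distrib sum.delta cong: if_cong)
    finally have eq: "I - pi / 2 * r ^ k = r ^ n * E" by simp
    have "\<bar>?e n x\<bar> \<le> c" for x
    proof -
      have "\<bar>r * sin (real n * x)\<bar> \<le> 1 * 1" unfolding abs_mult using r by (intro mult_mono) auto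
      moreover have "\<bar>sin (real (Suc n) * x)\<bar> \<le> 1" by simp
      ultimately have "\<bar>sin (real (Suc n) * x) - r * sin (real n * x)\<bar> \<le> 2"
        by linarith
      moreover have "\<bar>?s k x\<bar> \<le> 1" by simp
      ultimately have "\<bar>(sin (real (Suc n) * x) - r * sin (real n * x)) * ?s k x\<bar> \<le> 2 * 1"
        unfolding abs_mult by (intro mult_mono) auto
      then show ?thesis
        unfolding c_def abs_divide using d[of x] r by (intro frac_le) auto
    qed
    then have "\<bar>E\<bar> \<le> c * pi"
      using has_integral_bound_real[OF _ _ E, of c "{}"] by (simp add: c_def)
    then have "\<bar>r ^ n * E\<bar> \<le> \<bar>r\<bar> ^ n * (c * pi)"
      unfolding abs_mult power_abs by (intro mult_left_mono) auto
    then show ?thesis unfolding eq by (simp add: mult_ac)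
  qed
  have "(\<lambda>n. c * pi * \<bar>r\<bar> ^ n) \<longlonglongrightarrow> c * pi * 0"
    using r by (intro tendsto_mult_left LIMSEQ_power_zero) simp
  then have "\<bar>I - pi / 2 * r ^ k\<bar> \<le> 0"
    by (intro LIMSEQ_le_const[of _ 0 "\<bar>I - pi / 2 * r ^ k\<bar>"]) (use bound in \<open>auto intro: exI[of _ "Suc k"] simp: Suc_le_eq\<close>)
  then have "I = pi / 2 * r ^ k" by linarith
  with I show ?thesis by (simp only:)
qed

text \<open>Reduces to the previous integral by \<open>2 sin x cos m x = sin (m + 1) x - sin (m - 1) x\<close>; the two
  small values of \<open>m\<close> stand apart because \<open>sin (m - 1) x\<close> is then zero or of the opposite sign.\<close>

lemma has_integral_poisson_sin_sq:
  fixes r :: real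
  assumes r: "\<bar>r\<bar> < 1"
  shows "((\<lambda>x. (sin x)\<^sup>2 * cos (real m * x) / (1 + r\<^sup>2 - 2 * r * cos x)) has_integral
    (if m = 0 then pi / 2 else if m = 1 then pi / 4 * r else pi / 4 * (r ^ m - r ^ (m - 2)))) {0..pi}"
proof -
  let ?d = "\<lambda>x. 1 + r\<^sup>2 - 2 * r * cos x"
  note P = has_integral_poisson[OF r]
  consider "m = 0" | "m = 1" | l where "m = Suc (Suc l)" by (metis One_nat_def not0_implies_Suc)
  then show ?thesis
  proof cases
    case 1
    then show ?thesis using P[of 0] by (simp add: power2_eq_square)
  next
    case 2
    have scale: "u * (2 * u * v) / w / 2 = u\<^sup>2 * v / w" for u v w :: real
      by (simp add: power2_eq_square)
    have "((\<lambda>x. (sin x * sin (real (Suc 1) * x) / ?d x) / 2) has_integral pi / 2 * r ^ 1 / 2) {0..pi}"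
      by (intro has_integral_divide P)
    moreover have "sin x * sin (real (Suc 1) * x) / ?d x / 2 = (sin x)\<^sup>2 * cos x / ?d x" for x
    using scale[of "sin x" "cos x" "?d x"] by (simp add: sin_double)
    ultimately show ?thesis using 2 by (simp add: mult.commute)
  next
    case 3
    have scale: "(u * v / w - u * v' / w) / 2 = u\<^sup>2 * c / w" if "v - v' = 2 * u * c" for u v v' w c :: real
    proof -
      have "(u * v / w - u * v' / w) / 2 = u * (v - v') / w / 2"
        by (simp add: right_diff_distrib diff_divide_distrib)
      then show ?thesis by (simp add: that power2_eq_square)
    qed
    have "((\<lambda>x. (sin x * sin (real (Suc m) * x) / ?d x - sin x * sin (real (Suc l) * x) / ?d x) / 2)
        has_integral (pi / 2 * r ^ m - pi / 2 * r ^ l) / 2) {0..pi}"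
      by (intro has_integral_divide has_integral_diff P)
    moreover have "(sin x * sin (real (Suc m) * x) / ?d x - sin x * sin (real (Suc l) * x) / ?d x) / 2
        = (sin x)\<^sup>2 * cos (real m * x) / ?d x" for x
    proof -
      have "sin (real (Suc m) * x) - sin (real (Suc l) * x) = 2 * sin x * cos (real m * x)"
      proof -
        have "real (Suc m) * x = real m * x + x" "real (Suc l) * x = real m * x - x"
          using 3 by (simp_all add: algebra_simps)
        then show ?thesis by (simp only: sin_add sin_diff) (simp add: algebra_simps)
      qed
      then show ?thesis by (rule scale)
    qed
    moreover have "(pi / 2 * r ^ m - pi / 2 * r ^ l) / 2 = pi / 4 * (r ^ m - r ^ (m - 2))"
    proof -
      have "m - 2 = l" using 3 by simp
      then show ?thesis by (simp add: right_diff_distrib diff_divide_distrib)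
    qed
    moreover have "(m = 0) = False" "(m = 1) = False" using 3 by simp_all
    ultimately show ?thesis by (simp only: if_False)
  qed
qed

lemma matrix_inv_2x2:
  fixes p q r s :: real
  assumes "p * s - q * r \<noteq> 0"
  shows "matrix_inv (vector [vector [p, q], vector [r, s]] :: real ^ 2 ^ 2)
    = (1 / (p * s - q * r)) *\<^sub>R vector [vector [s, - q], vector [- r, p]]"
    (is "matrix_inv ?H = ?K")
proof -
  define d where "d = p * s - q * r"
  have inverse: "?H ** ?K = mat 1" "?K ** ?H = mat 1"
    using assms unfolding d_def[symmetric]
    by (simp_all add: vec_eq_iff forall_2 sum_2 matrix_matrix_mult_def mat_def
        flip: diff_divide_distrib add_divide_distrib) (simp_all add: d_def algebra_simps)
  show ?thesis
    unfolding matrix_inv_def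
  proof (rule some_equality)
    fix K' assume K': "?H ** K' = mat 1 \<and> K' ** ?H = mat 1"
    have "K' = K' ** (?H ** ?K)" by (simp only: inverse(1) matrix_mul_rid)
    also have "\<dots> = (K' ** ?H) ** ?K" by (rule matrix_mul_assoc)
    also have "\<dots> = ?K" by (simp only: K' matrix_mul_lid)
    finally show "K' = ?K" .
  qed (use inverse in simp)
qed

lemma int_parity_cases:
  obtains (zero) "n = 0"
    | (pos_even) m where "n = 2 * int (Suc m)"
    | (pos_odd) m where "n = 2 * int m + 1"
    | (neg_even) m where "n = - 2 * int (Suc m)"
    | (neg_odd) m where "n = - 2 * int m - 1"
proof -
  consider "n = 0" | "n > 0" "even n" | "n > 0" "odd n" | "n < 0" "even n" | "n < 0" "odd n"
    by linarith
  then show thesis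
  proof cases
    case 2
    then have "n = 2 * int (Suc (nat (n div 2 - 1)))" by (auto elim!: evenE)
    then show thesis by (rule pos_even)
  next
    case 3
    then have "n = 2 * int (nat (n div 2)) + 1" by (auto elim!: oddE)
    then show thesis by (rule pos_odd)
  next
    case 4
    then have "n = - 2 * int (Suc (nat (- n div 2 - 1)))" by (auto elim!: evenE)
    then show thesis by (rule neg_even)
  next
    case 5
    then have "n = - 2 * int (nat ((- n - 1) div 2)) - 1" by (auto elim!: oddE)
    then show thesis by (rule neg_odd)
  qed (use zero in auto)
qed

lemma set_integrable_bounded:
  fixes h :: "real \<Rightarrow> real"
  assumes "h \<in> borel_measurable borel" "\<And>x. 0 < x \<Longrightarrow> x < pi \<Longrightarrow> \<bar>h x\<bar> \<le> K"
  shows "set_integrable lborel {0<..<pi} h"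
proof (rule set_integrable_bound[where f = "\<lambda>_. K"])
  show "set_integrable lborel {0<..<pi} (\<lambda>_. K)"
    by (simp add: set_integrable_def)
  show "set_borel_measurable lborel {0<..<pi} h"
    using assms(1) by (simp add: set_borel_measurable_def)
  show "AE x in lborel. x \<in> {0<..<pi} \<longrightarrow> norm (h x) \<le> norm K"
    using order_trans[OF assms(2) abs_ge_self[of K]] by (intro AE_I2) simp
qed

lemma powr_half_of_nat:
  assumes "(x::real) > 0"
  shows "x powr (real m / 2) = sqrt x ^ m" "x powr (- real m / 2) = 1 / sqrt x ^ m"
    "x powr ((real m + 1) / 2) = sqrt x ^ Suc m" "x powr (- (real m + 1) / 2) = 1 / sqrt x ^ Suc m"
proof -
  have pos: "x powr (real k / 2) = sqrt x ^ k" for k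
  proof -
    have "x powr (real k / 2) = (x powr (1 / 2)) powr real k" by (simp add: powr_powr)
    then show ?thesis using assms by (simp add: powr_half_sqrt powr_realpow)
  qed
  have neg: "x powr (- real k / 2) = 1 / sqrt x ^ k" for k
    using pos[of k] powr_minus_divide[of x "real k / 2"] by simp
  show "x powr (real m / 2) = sqrt x ^ m" "x powr (- real m / 2) = 1 / sqrt x ^ m" by (fact pos neg)+
  show "x powr ((real m + 1) / 2) = sqrt x ^ Suc m" "x powr (- (real m + 1) / 2) = 1 / sqrt x ^ Suc m"
    using pos[of "Suc m"] neg[of "Suc m"] by (simp_all add: add.commute)
qed

text \<open>With \<open>z = b + a exp (\<i> x)\<close> and its conjugate \<open>z'\<close> one has
  \<open>a\<^sup>2 - b\<^sup>2 + 2 \<i> a b sin x = z' (a exp (\<i> x) - b)\<close> and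
  \<open>z z' = a\<^sup>2 + b\<^sup>2 + 2 a b cos x\<close>. Multiplying the first identity by \<open>z exp (\<i> k x)\<close> and taking
  imaginary parts gives the claim.\<close>

lemma trig_factor:
  fixes a b k x :: real
  shows "(a\<^sup>2 - b\<^sup>2) * (b * sin (k * x) + a * sin ((k + 1) * x))
      + 2 * a * b * sin x * (b * cos (k * x) + a * cos ((k + 1) * x))
    = (a\<^sup>2 + b\<^sup>2 + 2 * a * b * cos x) * (a * sin ((k + 1) * x) - b * sin (k * x))"
proof -
  have arg: "(k + 1) * x = k * x + x" by (simp add: algebra_simps)
  have ring: "(a\<^sup>2 - b\<^sup>2) * (b * s0 + a * (s0 * c + c0 * s)) + 2 * a * b * s * (b * c0 + a * (c0 * c - s0 * s))
    = (a\<^sup>2 + b\<^sup>2 + 2 * a * b * c) * (a * (s0 * c + c0 * s) - b * s0)" if "s\<^sup>2 + c\<^sup>2 = 1" for s c s0 c0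
    using that by algebra
  show ?thesis unfolding arg sin_add cos_add by (rule ring) simp
qed

section \<open>The continuous spectrum of the Jacobi operator\<close>

locale spectral_data =
  fixes M N :: nat and \<omega>\<^sub>1 \<omega>\<^sub>2 :: real
  assumes M_ge_1: "1 \<le> M" and M_less_N: "M < N" and w1_pos: "\<omega>\<^sub>1 > 0" and w2_pos: "\<omega>\<^sub>2 > 0"
begin

text \<open>The entries of the Jacobi matrix below.\<close>

definition "offG = sqrt (real M) * \<omega>\<^sub>1"
definition "offH = sqrt (real N) * \<omega>\<^sub>2"
definition "diagG = (real M - 1) * \<omega>\<^sub>1"
definition "diagH = (real N - 1) * \<omega>\<^sub>2"

abbreviation "kap \<equiv> kappa M N \<omega>\<^sub>1 \<omega>\<^sub>2"
abbreviation "Rx \<equiv> R_fun M N \<omega>\<^sub>1 \<omega>\<^sub>2"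
abbreviation "lam \<equiv> lambda_fun M N \<omega>\<^sub>1 \<omega>\<^sub>2"
abbreviation "Ax \<equiv> A_fun M N \<omega>\<^sub>1 \<omega>\<^sub>2"
abbreviation "Bx \<equiv> B_fun M N \<omega>\<^sub>1 \<omega>\<^sub>2"
abbreviation "rho \<equiv> rho_fun M N \<omega>\<^sub>1 \<omega>\<^sub>2"

text \<open>This is \<open>\<bar>offH + offG exp (\<i> x)\<bar>\<^sup>2\<close>, which turns out to be \<open>A B\<close> for both signs \<open>\<epsilon>\<close>.\<close>

definition "symbol_sq x = offG\<^sup>2 + offH\<^sup>2 + 2 * offG * offH * cos x"

text \<open>This is \<open>A D\<close>, see \<open>D_eq\<close> below. Passing from \<open>D\<close> to \<open>A D\<close> removes the dependence on
  \<open>\<epsilon>\<close>.\<close>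

definition "phase x = (symbol_sq x * (diagG + diagH) - (diagG - diagH) * (offG\<^sup>2 - offH\<^sup>2))
  / (2 * offG * offH * sin x)"

lemma MN_pos: "real M > 0" "real N > 0" "sqrt (real M) > 0" "sqrt (real N) > 0"
  using M_ge_1 M_less_N by auto

lemma off_pos: "offG > 0" "offH > 0"
  using MN_pos w1_pos w2_pos by (simp_all add: offG_def offH_def)

lemma off_sq: "offG\<^sup>2 = real M * \<omega>\<^sub>1\<^sup>2" "offH\<^sup>2 = real N * \<omega>\<^sub>2\<^sup>2"
  by (simp_all add: offG_def offH_def power_mult_distrib)

lemma kap_pos: "kap > 0"
  using MN_pos w1_pos w2_pos by (simp add: kappa_def add_pos_pos)

lemma symbol_sq_eq: "symbol_sq x = (offG - offH)\<^sup>2 + 2 * (offG * offH) * (1 + cos x)"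
  by (simp add: symbol_sq_def power2_eq_square algebra_simps)

lemma symbol_sq_nonneg: "symbol_sq x \<ge> 0"
proof -
  have "1 + cos x \<ge> 0" using cos_ge_minus_one[of x] by linarith
  then show ?thesis unfolding symbol_sq_eq using off_pos by simp
qed

lemma symbol_sq_pos:
  assumes "0 < x" "x < pi" shows "symbol_sq x > 0"
proof -
  have "1 + cos x > 0" using cos_monotone_0_pi[of x pi] assms by simp
  then show ?thesis unfolding symbol_sq_eq using off_pos by (intro add_nonneg_pos) simp_all
qed

lemma R_eq: "Rx x = sqrt ((diagG - diagH)\<^sup>2 + 4 * symbol_sq x)"
proof -
  have "((real M + 1) * \<omega>\<^sub>1 - (real N + 1) * \<omega>\<^sub>2)\<^sup>2 + 4 * (real M + real N) * \<omega>\<^sub>1 * \<omega>\<^sub>2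
      + 8 * sqrt (real M * real N) * \<omega>\<^sub>1 * \<omega>\<^sub>2 * cos x = (diagG - diagH)\<^sup>2 + 4 * symbol_sq x"
    unfolding symbol_sq_def off_sq
    by (simp add: diagG_def diagH_def offG_def offH_def real_sqrt_mult power2_eq_square algebra_simps)
  then show ?thesis by (simp add: R_fun_def)
qed

lemma R_sq: "(Rx x)\<^sup>2 = (diagG - diagH)\<^sup>2 + 4 * symbol_sq x"
  unfolding R_eq using symbol_sq_nonneg[of x] by simp

lemma R_pos: "0 < x \<Longrightarrow> x < pi \<Longrightarrow> Rx x > 0"
  unfolding R_eq using symbol_sq_pos[of x] by (simp add: add_nonneg_pos)

lemma rho_eq: "rho \<epsilon> x = (diagG + diagH + \<epsilon> * Rx x) / 2"
  using kap_pos
  by (simp add: rho_fun_def lambda_fun_def right_diff_distrib diagG_def diagH_def)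
     (simp add: kappa_def field_simps)

lemma rho_minus_diag: "rho \<epsilon> x - diagH = Ax \<epsilon> x" "rho \<epsilon> x - diagG = Bx \<epsilon> x"
  by (simp_all add: A_fun_def B_fun_def diagG_def diagH_def)

lemma A_eq: "Ax \<epsilon> x = (diagG - diagH + \<epsilon> * Rx x) / 2"
  and B_eq: "Bx \<epsilon> x = (diagH - diagG + \<epsilon> * Rx x) / 2"
  unfolding rho_minus_diag[symmetric] rho_eq by (simp_all add: field_simps)

lemma AB_eq:
  assumes "\<epsilon> \<in> {1, -1}" shows "Ax \<epsilon> x * Bx \<epsilon> x = symbol_sq x"
proof -
  have "\<epsilon>\<^sup>2 = 1" using assms by auto
  then have "(\<epsilon> * Rx x)\<^sup>2 = (diagG - diagH)\<^sup>2 + 4 * symbol_sq x"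
    by (simp add: power_mult_distrib R_sq)
  then show ?thesis unfolding A_eq B_eq by (simp add: power2_eq_square algebra_simps)
qed

lemma A_plus_B: "Ax \<epsilon> x + Bx \<epsilon> x = \<epsilon> * Rx x"
  unfolding A_eq B_eq by (simp add: field_simps)

lemma AB_nonzero:
  assumes "\<epsilon> \<in> {1, -1}" "0 < x" "x < pi"
  shows "Ax \<epsilon> x \<noteq> 0" "Bx \<epsilon> x \<noteq> 0" "Ax \<epsilon> x + Bx \<epsilon> x \<noteq> 0"
  using AB_eq[OF assms(1), of x] symbol_sq_pos[OF assms(2,3)] A_plus_B[of \<epsilon> x] R_pos[OF assms(2,3)] assms(1)
  by auto

lemma D_eq: "D_fun M N \<omega>\<^sub>1 \<omega>\<^sub>2 \<epsilon> x = phase x / Ax \<epsilon> x" if "\<epsilon> \<in> {1, -1}"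
proof -
  have d: "Ax \<epsilon> x - Bx \<epsilon> x = diagG - diagH" unfolding A_eq B_eq by (simp add: field_simps)
  have o: "sqrt (real M * real N) * \<omega>\<^sub>1 * \<omega>\<^sub>2 = offG * offH"
    by (simp add: offG_def offH_def real_sqrt_mult)
  have "D_fun M N \<omega>\<^sub>1 \<omega>\<^sub>2 \<epsilon> x = (symbol_sq x * (diagG + diagH) - (diagG - diagH) * (offG\<^sup>2 - offH\<^sup>2))
      / (Ax \<epsilon> x * (2 * (sqrt (real M * real N) * \<omega>\<^sub>1 * \<omega>\<^sub>2) * sin x))"
    unfolding D_fun_def Let_def AB_eq[OF that] d off_sq by (simp add: diagG_def diagH_def mult_ac)
  then show ?thesis unfolding o phase_def by (simp add: mult_ac)
qed

text \<open>The density of the spectral measure between positions \<open>0\<close> and \<open>n\<close>, for one sign \<open>\<epsilon>\<close>.\<close>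

definition spec_coeff :: "real \<Rightarrow> real \<Rightarrow> int \<Rightarrow> real" where "spec_coeff \<epsilon> x n =
  F_vec M N \<omega>\<^sub>1 \<omega>\<^sub>2 \<epsilon> x 0 \<bullet> (matrix_inv (H_mat M N \<omega>\<^sub>1 \<omega>\<^sub>2 \<epsilon> x) *v F_vec M N \<omega>\<^sub>1 \<omega>\<^sub>2 \<epsilon> x n)"

text \<open>With \<open>wave\<close> below, the closed form of \<^const>\<open>spec_coeff\<close> at even positions is
  \<open>weight x * wave \<epsilon> x m\<close>; the sign \<open>\<epsilon>\<close> enters only as the sign of the sine term.\<close>

definition weight :: "real \<Rightarrow> real" where "weight x = 2 / pi * symbol_sq x / ((Rx x)\<^sup>2 + (phase x)\<^sup>2)"

definition wave :: "real \<Rightarrow> real \<Rightarrow> real \<Rightarrow> real" where "wave \<epsilon> x k = cos (k * x) + phase x / (\<epsilon> * Rx x) * sin (k * x)"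

text \<open>Since \<open>F(0) = (1, 0)\<close>, only the first row of the inverse matrix is needed. With \<open>S = A + B\<close> and
  \<open>d = A D\<close> the determinant of \<open>\<H>\<close> is \<open>(\<pi> S / (2 A))\<^sup>2 (S\<^sup>2 + d\<^sup>2) / (A B)\<close>.\<close>

lemma spec_coeff_eq:
  assumes e: "\<epsilon> \<in> {1, -1}" and x: "0 < x" "x < pi"
  shows "spec_coeff \<epsilon> x n = weight x * (gen_eigfun1 M N \<omega>\<^sub>1 \<omega>\<^sub>2 \<epsilon> x n
    + phase x / (\<epsilon> * Rx x) * gen_eigfun2 M N \<omega>\<^sub>1 \<omega>\<^sub>2 \<epsilon> x n)"
proof -
  define A where "A = Ax \<epsilon> x"
  define B where "B = Bx \<epsilon> x"
  define d where "d = phase x"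
  define S where "S = \<epsilon> * Rx x"
  define c where "c = pi / 2 * (S / A)"
  have nz: "A \<noteq> 0" "B \<noteq> 0" "S \<noteq> 0" and S: "S = A + B"
    using AB_nonzero[OF e x] A_plus_B[of \<epsilon> x] by (simp_all add: A_def B_def S_def)
  have pos: "S\<^sup>2 + d\<^sup>2 \<noteq> 0" using nz by (simp add: sum_power2_eq_zero_iff)
  have D: "D_fun M N \<omega>\<^sub>1 \<omega>\<^sub>2 \<epsilon> x = d / A" using D_eq[OF e] by (simp add: A_def d_def)
  have c0: "c \<noteq> 0" using nz by (simp add: c_def)
  let ?p = "c * ((S / B) + d\<^sup>2 / (A * B))" and ?q = "- (c * (d / A))" and ?s = "c * (S / A)"
  have H: "H_mat M N \<omega>\<^sub>1 \<omega>\<^sub>2 \<epsilon> x = vector [vector [?p, ?q], vector [?q, ?s]]"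
  proof -
    have "1 + A / B + A / B * (d / A)\<^sup>2 = S / B + d\<^sup>2 / (A * B)" "1 + B / A = S / A"
      using nz by (simp_all add: S field_simps power2_eq_square)
    then show ?thesis
      unfolding H_mat_def Let_def D A_def[symmetric] B_def[symmetric]
      by (simp add: vec_eq_iff forall_2 c_def)
  qed
  have det: "?p * ?s - ?q * ?q = c\<^sup>2 * (S\<^sup>2 + d\<^sup>2) / (A * B)"
  proof -
    have "(S / B + d\<^sup>2 / (A * B)) * (S / A) - (d / A)\<^sup>2 = (S\<^sup>2 + d\<^sup>2) / (A * B)"
      using nz by (simp add: divide_simps power2_eq_square) (simp add: S algebra_simps)
    moreover have "?p * ?s - ?q * ?q = c\<^sup>2 * ((S / B + d\<^sup>2 / (A * B)) * (S / A) - (d / A)\<^sup>2)"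
      by (simp add: power2_eq_square algebra_simps)
    ultimately show ?thesis by simp
  qed
  have det0: "?p * ?s - ?q * ?q \<noteq> 0" unfolding det using c0 pos nz by simp
  have inverse: "spec_coeff \<epsilon> x n = 1 / (p * s - q * q) *
      (s * gen_eigfun1 M N \<omega>\<^sub>1 \<omega>\<^sub>2 \<epsilon> x n - q * gen_eigfun2 M N \<omega>\<^sub>1 \<omega>\<^sub>2 \<epsilon> x n)"
    if "H_mat M N \<omega>\<^sub>1 \<omega>\<^sub>2 \<epsilon> x = vector [vector [p, q], vector [q, s]]" "p * s - q * q \<noteq> 0" for p q s
    unfolding spec_coeff_def that(1) matrix_inv_2x2[OF that(2)]
    using gen_eigfun1_simps(1)[of M N \<omega>\<^sub>1 \<omega>\<^sub>2 \<epsilon> x 0] gen_eigfun2_simps(1)[of M N \<omega>\<^sub>1 \<omega>\<^sub>2 \<epsilon> x 0]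
    by (simp add: F_vec_def inner_vec_def sum_2 matrix_vector_mult_def diff_divide_distrib)
  have "spec_coeff \<epsilon> x n = 1 / (?p * ?s - ?q * ?q) * (?s * gen_eigfun1 M N \<omega>\<^sub>1 \<omega>\<^sub>2 \<epsilon> x n - ?q * gen_eigfun2 M N \<omega>\<^sub>1 \<omega>\<^sub>2 \<epsilon> x n)"
    by (rule inverse[OF H det0])
  also have "\<dots> = 2 / pi * (A * B) / (S\<^sup>2 + d\<^sup>2) * (gen_eigfun1 M N \<omega>\<^sub>1 \<omega>\<^sub>2 \<epsilon> x n + d / S * gen_eigfun2 M N \<omega>\<^sub>1 \<omega>\<^sub>2 \<epsilon> x n)"
  proof -
    have "?s / (c\<^sup>2 * (S\<^sup>2 + d\<^sup>2) / (A * B)) = 2 / pi * (A * B) / (S\<^sup>2 + d\<^sup>2)"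
      using nz pos by (simp add: c_def power2_eq_square)
    moreover have "- ?q = ?s * (d / S)" using nz by simp
    moreover have "1 / E * (s * f - q * g) = s / E * (f + k * g)" if "- q = s * k" for E s q k f g :: real
    proof -
      have "s * f - q * g = s * f + (- q) * g" by simp
      also have "\<dots> = s * (f + k * g)" unfolding that by (simp add: distrib_left)
      finally show ?thesis by simp
    qed
    ultimately show ?thesis unfolding det by (simp only:)
  qed
  also have "A * B = symbol_sq x" using AB_eq[OF e] by (simp add: A_def B_def)
  also have "S\<^sup>2 = (Rx x)\<^sup>2" using e by (auto simp: S_def)
  finally show ?thesis by (simp add: weight_def d_def S_def)
qed

text \<open>On the negative side the contributions of the two solutions combine through
  \<open>D - (A D / S) (B / A) = A D / S\<close> with \<open>S = A + B\<close>, so that the coefficients there have the same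
  form as on the positive side, with the roles of \<open>G\<close> and \<open>H\<close> exchanged.\<close>

lemma
  assumes e: "\<epsilon> \<in> {1, -1}" and x: "0 < x" "x < pi"
  shows spec_coeff_even: "spec_coeff \<epsilon> x (2 * int m) = weight x * wave \<epsilon> x (real m)"
    and spec_coeff_neg_even: "spec_coeff \<epsilon> x (- 2 * int m) = weight x * wave \<epsilon> x (real m)"
    and spec_coeff_odd: "spec_coeff \<epsilon> x (2 * int m + 1) =
      weight x * (offH * wave \<epsilon> x (real m) + offG * wave \<epsilon> x (real m + 1)) / Ax \<epsilon> x"
    and spec_coeff_neg_odd: "spec_coeff \<epsilon> x (- 2 * int m - 1) =
      weight x * (offG * wave \<epsilon> x (real m) + offH * wave \<epsilon> x (real m + 1)) / Bx \<epsilon> x"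
proof -
  define A where "A = Ax \<epsilon> x"
  define B where "B = Bx \<epsilon> x"
  define d where "d = phase x"
  define S where "S = \<epsilon> * Rx x"
  have nz: "A \<noteq> 0" "B \<noteq> 0" "S \<noteq> 0" and S: "S = A + B"
    using AB_nonzero[OF e x] A_plus_B[of \<epsilon> x] by (simp_all add: A_def B_def S_def)
  have D: "D_fun M N \<omega>\<^sub>1 \<omega>\<^sub>2 \<epsilon> x = d / A" using D_eq[OF e] by (simp add: A_def d_def)
  note eq = spec_coeff_eq[OF e x] wave_def gen_eigfun1_simps gen_eigfun2_simps D
    A_def[symmetric] B_def[symmetric] d_def[symmetric] S_def[symmetric]
  have off: "sqrt (real M) * \<omega>\<^sub>1 = offG" "sqrt (real N) * \<omega>\<^sub>2 = offH"
    by (simp_all add: offG_def offH_def)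
  have key: "d / A - d / S * (B / A) = d / S"
    using nz by (simp add: field_simps) (simp add: S algebra_simps)
  have key': "d / A * u + d / S * (- (B / A) * u) = d / S * u" for u
  proof -
    have "d / A * u + d / S * (- (B / A) * u) = (d / A - d / S * (B / A)) * u"
      by (simp add: left_diff_distrib)
    then show ?thesis by (simp only: key)
  qed
  show "spec_coeff \<epsilon> x (2 * int m) = weight x * wave \<epsilon> x (real m)"
    unfolding eq by simp
  show "spec_coeff \<epsilon> x (- 2 * int m) = weight x * wave \<epsilon> x (real m)"
    unfolding eq using key'[of "sin (real m * x)"] by (simp add: algebra_simps)
  show "spec_coeff \<epsilon> x (2 * int m + 1) =
      weight x * (offH * wave \<epsilon> x (real m) + offG * wave \<epsilon> x (real m + 1)) / Ax \<epsilon> x"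
    unfolding eq off using nz by (simp add: add_divide_distrib algebra_simps)
  have neg: "(offG * (c0 + d / A * s0) + offH * (c1 + d / A * s1)) / B + d / S * - ((offG * s0 + offH * s1) / A)
      = (offG * (c0 + d / S * s0) + offH * (c1 + d / S * s1)) / B" for c0 c1 s0 s1
  proof -
    have "d / S * (u / A) = (d / A - d / S) * u / B" for u
    proof -
      have "d / A - d / S = d / S * (B / A)" using key by linarith
      then show ?thesis using nz by simp
    qed
    then have "d / S * ((offG * s0 + offH * s1) / A) = (d / A - d / S) * (offG * s0 + offH * s1) / B" .
    then show ?thesis by (simp add: add_divide_distrib diff_divide_distrib algebra_simps)
  qed
  show "spec_coeff \<epsilon> x (- 2 * int m - 1) =
      weight x * (offG * wave \<epsilon> x (real m) + offH * wave \<epsilon> x (real m + 1)) / Bx \<epsilon> x"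
    unfolding eq off neg by simp
qed

text \<open>The radial adjacency operator, conjugated by the square roots of the sphere sizes. The edge
  between \<open>n\<close> and \<open>n + 1\<close> belongs to \<open>H\<close> exactly for even \<open>n\<close>, on both sides of \<open>0\<close>.\<close>

definition jacobi :: "(int \<Rightarrow> real) \<Rightarrow> int \<Rightarrow> real" where
  "jacobi v n = (if even n then offG else offH) * v (n - 1)
     + (if n = 0 then 0 else if (n > 0) = even n then diagG else diagH) * v n
     + (if even n then offH else offG) * v (n + 1)"

lemma jacobi_eigenI:
  assumes "r * v 0 = offG * v (- 1) + offH * v 1"
    and "\<And>m. (r - diagH) * v (2 * int m + 1) = offH * v (2 * int m) + offG * v (2 * int (Suc m))"
    and "\<And>m. (r - diagG) * v (2 * int (Suc m)) = offG * v (2 * int m + 1) + offH * v (2 * int (Suc m) + 1)"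
    and "\<And>m. (r - diagG) * v (- 2 * int m - 1) = offG * v (- 2 * int m) + offH * v (- 2 * int (Suc m))"
    and "\<And>m. (r - diagH) * v (- 2 * int (Suc m)) = offH * v (- 2 * int m - 1) + offG * v (- 2 * int (Suc m) - 1)"
  shows "jacobi v n = r * v n"
proof (cases n rule: int_parity_cases)
  case zero
  then show ?thesis using assms(1) by (simp add: jacobi_def)
next
  case (pos_even m)
  have nb: "n - 1 = 2 * int m + 1" and n: "n > 0" "even n" using pos_even by simp_all
  show ?thesis
    unfolding jacobi_def nb using n assms(3)[of m, folded pos_even] by (simp add: left_diff_distrib)
next
  case (pos_odd m)
  have nb: "n + 1 = 2 * int (Suc m)" "n - 1 = 2 * int m" and n: "n > 0" "odd n" using pos_odd by simp_all
  show ?thesis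
    unfolding jacobi_def nb using n assms(2)[of m, folded pos_odd] by (simp add: left_diff_distrib)
next
  case (neg_even m)
  have nb: "n + 1 = - 2 * int m - 1" and n: "n < 0" "even n" using neg_even by simp_all
  show ?thesis
    unfolding jacobi_def nb using n assms(5)[of m, folded neg_even] by (simp add: left_diff_distrib)
next
  case (neg_odd m)
  have nb: "n + 1 = - 2 * int m" "n - 1 = - 2 * int (Suc m)" and n: "n < 0" "odd n" using neg_odd by simp_all
  show ?thesis
    unfolding jacobi_def nb using n assms(4)[of m, folded neg_odd] by (simp add: left_diff_distrib)
qed

lemma wave_recurrence: "wave \<epsilon> x k + wave \<epsilon> x (k + 2) = 2 * cos x * wave \<epsilon> x (k + 1)"
proof -
  have "k * x = (k + 1) * x - x" "(k + 2) * x = (k + 1) * x + x" by (simp_all add: algebra_simps)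
  then show ?thesis unfolding wave_def by (simp only: sin_add sin_diff cos_add cos_diff) (simp add: algebra_simps)
qed

lemma phase_sin:
  assumes "0 < x" "x < pi"
  shows "2 * (offG * offH) * (phase x * sin x)
    = symbol_sq x * (diagG + diagH) - (diagG - diagH) * (offG\<^sup>2 - offH\<^sup>2)"
  using off_pos sin_gt_zero[OF assms] by (simp add: phase_def)

text \<open>At odd positions the equation is the formula for the coefficient. At even positions other than
  \<open>0\<close> it follows from the three-term recurrence of \<open>wave\<close> and \<open>A B = symbol_sq x\<close>. At \<open>0\<close>, where
  the two half-lines meet, it is the condition that determines \<open>D\<close>.\<close>

lemma spec_coeff_jacobi:
  assumes e: "\<epsilon> \<in> {1, -1}" and x: "0 < x" "x < pi"
  shows "jacobi (spec_coeff \<epsilon> x) n = rho \<epsilon> x * spec_coeff \<epsilon> x n"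
proof (rule jacobi_eigenI)
  define A where "A = Ax \<epsilon> x"
  define B where "B = Bx \<epsilon> x"
  define S where "S = \<epsilon> * Rx x"
  define Q where "Q = symbol_sq x"
  define w where "w k = wave \<epsilon> x k" for k
  define W where "W = weight x"
  have nz: "A \<noteq> 0" "B \<noteq> 0" "S \<noteq> 0" and S: "S = A + B"
    using AB_nonzero[OF e x] A_plus_B[of \<epsilon> x] by (simp_all add: A_def B_def S_def)
  have AB: "A * B = Q" using AB_eq[OF e] by (simp add: A_def B_def Q_def)
  note c = spec_coeff_even[OF e x] spec_coeff_odd[OF e x] spec_coeff_neg_even[OF e x] spec_coeff_neg_odd[OF e x]
  note defs = A_def[symmetric] B_def[symmetric] S_def[symmetric] w_def[symmetric] W_def[symmetric] Q_def[symmetric]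
  have rA: "rho \<epsilon> x - diagH = A" and rB: "rho \<epsilon> x - diagG = B"
    by (simp_all add: A_def B_def rho_minus_diag)
  have cancel: "A * (u / A) = u" "B * (u / B) = u" for u using nz by simp_all
  have rec: "(offG\<^sup>2 + offH\<^sup>2) * w (k + 1) + offG * offH * (w k + w (k + 2)) = Q * w (k + 1)" for k
    unfolding w_def wave_recurrence Q_def symbol_sq_def by (simp add: algebra_simps)
  show "(rho \<epsilon> x - diagH) * spec_coeff \<epsilon> x (2 * int m + 1) = offH * spec_coeff \<epsilon> x (2 * int m) + offG * spec_coeff \<epsilon> x (2 * int (Suc m))" for m
    unfolding c rA defs cancel by (simp add: algebra_simps)
  show "(rho \<epsilon> x - diagG) * spec_coeff \<epsilon> x (- 2 * int m - 1) = offG * spec_coeff \<epsilon> x (- 2 * int m) + offH * spec_coeff \<epsilon> x (- 2 * int (Suc m))" for m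
    unfolding c rB defs cancel by (simp add: algebra_simps)
  have step: "u * (Q * w (real (Suc m))) = offG * (u * (offH * w (real m) + offG * w (real m + 1))) + offH * (u * (offH * w (real (Suc m)) + offG * w (real (Suc m) + 1)))"
    "u * (Q * w (real (Suc m))) = offH * (u * (offG * w (real m) + offH * w (real m + 1))) + offG * (u * (offG * w (real (Suc m)) + offH * w (real (Suc m) + 1)))" for u m
  proof -
    have nodes: "real (Suc m) = real m + 1" "real m + 1 + 1 = real m + 2" by simp_all
    have "u * (Q * w (real m + 1)) = u * ((offG\<^sup>2 + offH\<^sup>2) * w (real m + 1) + offG * offH * (w (real m) + w (real m + 2)))"
      unfolding rec ..
    then show "u * (Q * w (real (Suc m))) = offG * (u * (offH * w (real m) + offG * w (real m + 1))) + offH * (u * (offH * w (real (Suc m)) + offG * w (real (Suc m) + 1)))"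
      "u * (Q * w (real (Suc m))) = offH * (u * (offG * w (real m) + offH * w (real m + 1))) + offG * (u * (offG * w (real (Suc m)) + offH * w (real (Suc m) + 1)))"
      unfolding nodes by (simp_all add: power2_eq_square algebra_simps)
  qed
  show "(rho \<epsilon> x - diagG) * spec_coeff \<epsilon> x (2 * int (Suc m)) = offG * spec_coeff \<epsilon> x (2 * int m + 1) + offH * spec_coeff \<epsilon> x (2 * int (Suc m) + 1)" for m
  proof -
    have "B = Q / A" using AB nz by (simp add: field_simps)
    then show ?thesis unfolding c rB defs using step(1)[of "W / A" m] by (simp add: mult.left_commute)
  qed
  show "(rho \<epsilon> x - diagH) * spec_coeff \<epsilon> x (- 2 * int (Suc m)) = offH * spec_coeff \<epsilon> x (- 2 * int m - 1) + offG * spec_coeff \<epsilon> x (- 2 * int (Suc m) - 1)" for m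
  proof -
    have "A = Q / B" using AB nz by (simp add: field_simps)
    then show ?thesis unfolding c rA defs using step(2)[of "W / B" m] by (simp add: mult.left_commute)
  qed
  show "rho \<epsilon> x * spec_coeff \<epsilon> x 0 = offG * spec_coeff \<epsilon> x (- 1) + offH * spec_coeff \<epsilon> x 1"
  proof -
    define s where "s = phase x / S * sin x"
    have w01: "w 0 = 1" "w 1 = cos x + s" by (simp_all add: w_def wave_def s_def S_def)
    have r: "rho \<epsilon> x = (diagG + diagH + S) / 2" by (simp add: rho_eq S_def)
    have AmB: "A - B = diagG - diagH" by (simp add: A_def B_def A_eq B_eq field_simps)
    have cosx: "2 * (offG * offH) * cos x = Q - offG\<^sup>2 - offH\<^sup>2" by (simp add: Q_def symbol_sq_def)
    \<comment> \<open>The numerator of \<open>D\<close> enters the eigenvalue equation at \<open>0\<close> here.\<close>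
    have sinx: "2 * (offG * offH) * (S * s) = Q * (diagG + diagH) - (A - B) * (offG\<^sup>2 - offH\<^sup>2)"
      using phase_sin[OF x] nz by (simp add: s_def Q_def AmB)
    have "2 * (A * offG * (offG + offH * (cos x + s)) + B * offH * (offH + offG * (cos x + s)))
        = A * (2 * offG\<^sup>2) + B * (2 * offH\<^sup>2) + S * (2 * (offG * offH) * cos x) + 2 * (offG * offH) * (S * s)"
      by (simp add: S power2_eq_square algebra_simps)
    also have "\<dots> = Q * (diagG + diagH + S)"
      unfolding cosx sinx by (simp add: S power2_eq_square algebra_simps)
    finally have "A * offG * (offG + offH * (cos x + s)) + B * offH * (offH + offG * (cos x + s))
        = rho \<epsilon> x * (A * B)" unfolding r AB by (simp add: algebra_simps)
    then have "rho \<epsilon> x = offG * (offG + offH * (cos x + s)) / B + offH * (offH + offG * (cos x + s)) / A"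
      using nz by (simp add: field_simps)
    then have "rho \<epsilon> x * W = offG * (W * (offG * 1 + offH * (cos x + s)) / B) + offH * (W * (offH * 1 + offG * (cos x + s)) / A)"
      by (simp add: algebra_simps)
    then show ?thesis
      using c[of 0] by (simp add: defs w01 mult.commute)
  qed
qed

section \<open>Total spectral density and the discrete spectrum\<close>

abbreviation "sM \<equiv> sqrt (real M)"
abbreviation "sN \<equiv> sqrt (real N)"

text \<open>Positive multiples of the Poisson denominators for the ratios \<open>r1\<close> and \<open>r2\<close>. Multiplied by
  \<open>\<omega>\<^sub>1 \<omega>\<^sub>2\<close>, they are the distances of \<open>symbol_sq x\<close> from the values of \<open>A B\<close> at the two
  eigenvalues.\<close>

definition den1 :: "real \<Rightarrow> real" where "den1 x = real M + real N + 2 * sM * sN * cos x"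
definition den2 :: "real \<Rightarrow> real" where "den2 x = 1 + real M * real N - 2 * sM * sN * cos x"

text \<open>The ratios of the geometric sequences that \<^const>\<open>eigfun1\<close> and \<^const>\<open>eigfun2\<close> form on the
  even positions of either half-line.\<close>

definition "r1 = - sM / sN"
definition "r2 = 1 / (sM * sN)"

lemma sq_sqrt: "sM * sM = real M" "sN * sN = real N" "sM * (sM * y) = real M * y" "sN * (sN * y) = real N * y"
  by (simp_all flip: mult.assoc)

lemma r1_bound: "\<bar>r1\<bar> < 1"
  using MN_pos M_less_N by (simp add: r1_def)

lemma r2_bound: "\<bar>r2\<bar> < 1"
proof -
  have "1 * 1 < sM * sN" using M_ge_1 M_less_N by (intro mult_le_less_imp_less) auto
  then show ?thesis by (simp add: r2_def)
qed

lemma den1_eq: "den1 x = real N * (1 + r1\<^sup>2 - 2 * r1 * cos x)"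
  using MN_pos by (simp add: den1_def r1_def power_divide field_simps power2_eq_square)

lemma den2_eq: "den2 x = real M * real N * (1 + r2\<^sup>2 - 2 * r2 * cos x)"
  using MN_pos by (simp add: den2_def r2_def power_divide power_mult_distrib field_simps)

lemma den_pos: "den1 x > 0" "den2 x > 0"
  unfolding den1_eq den2_eq
  using MN_pos poisson_denominator_ge(2)[OF r1_bound, of x] poisson_denominator_ge(2)[OF r2_bound, of x]
  by simp_all

lemma den_sum: "den1 x + den2 x = (real M + 1) * (real N + 1)"
  by (simp add: den1_def den2_def algebra_simps)

text \<open>Multiplied by \<open>sin\<^sup>2 x\<close>, the denominator of the weight is a cubic polynomial in
  \<open>symbol_sq x\<close>. It is divisible by \<open>symbol_sq x\<close>, and the remaining quadratic splits into \<open>den1\<close>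
  and \<open>den2\<close>. The constants \<open>\<omega>\<^sub>1\<close>, \<open>\<omega>\<^sub>2\<close> disappear.\<close>

lemma weight_eq:
  assumes x: "0 < x" "x < pi"
  shows "weight x = 2 / pi * (real M * real N * (sin x)\<^sup>2) / (den1 x * den2 x)"
proof -
  define c where "c = 2 * (offG * offH) * cos x"
  have Q: "symbol_sq x = real M * \<omega>\<^sub>1\<^sup>2 + real N * \<omega>\<^sub>2\<^sup>2 + c"
    by (simp add: symbol_sq_def c_def off_sq)
  have o2: "(offG * offH)\<^sup>2 = real M * real N * (\<omega>\<^sub>1 * \<omega>\<^sub>2)\<^sup>2"
    by (simp add: power_mult_distrib off_sq)
  have sin2: "4 * (offG * offH)\<^sup>2 * (sin x)\<^sup>2 = 4 * (real M * real N * (\<omega>\<^sub>1 * \<omega>\<^sub>2)\<^sup>2) - c\<^sup>2"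
    unfolding sin_squared_eq c_def o2[symmetric] by (simp add: power_mult_distrib algebra_simps)
  have dens: "\<omega>\<^sub>1 * \<omega>\<^sub>2 * den1 x = \<omega>\<^sub>1 * \<omega>\<^sub>2 * (real M + real N) + c" "\<omega>\<^sub>1 * \<omega>\<^sub>2 * den2 x = \<omega>\<^sub>1 * \<omega>\<^sub>2 * (1 + real M * real N) - c"
    by (simp_all add: den1_def den2_def c_def offG_def offH_def algebra_simps)
  have ph: "(2 * (offG * offH) * (phase x * sin x))\<^sup>2
      = (symbol_sq x * (diagG + diagH) - (diagG - diagH) * (real M * \<omega>\<^sub>1\<^sup>2 - real N * \<omega>\<^sub>2\<^sup>2))\<^sup>2"
    unfolding phase_sin[OF x] off_sq ..
  have "((Rx x)\<^sup>2 + (phase x)\<^sup>2) * (4 * (offG * offH)\<^sup>2 * (sin x)\<^sup>2)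
      = (Rx x)\<^sup>2 * (4 * (offG * offH)\<^sup>2 * (sin x)\<^sup>2) + (2 * (offG * offH) * (phase x * sin x))\<^sup>2"
    by (simp add: power_mult_distrib algebra_simps)
  also have "\<dots> = 4 * symbol_sq x * ((\<omega>\<^sub>1 * \<omega>\<^sub>2 * den1 x) * (\<omega>\<^sub>1 * \<omega>\<^sub>2 * den2 x))"
    unfolding ph R_sq sin2 dens Q diagG_def diagH_def by algebra
  finally have "((Rx x)\<^sup>2 + (phase x)\<^sup>2) * (real M * real N * (sin x)\<^sup>2) * (4 * (\<omega>\<^sub>1 * \<omega>\<^sub>2)\<^sup>2)
      = symbol_sq x * (den1 x * den2 x) * (4 * (\<omega>\<^sub>1 * \<omega>\<^sub>2)\<^sup>2)"
    unfolding o2 by (simp add: power2_eq_square mult_ac)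
  then have "((Rx x)\<^sup>2 + (phase x)\<^sup>2) * (real M * real N * (sin x)\<^sup>2) = symbol_sq x * (den1 x * den2 x)"
    using w1_pos w2_pos by simp
  then have key: "symbol_sq x * (den1 x * den2 x) = real M * real N * (sin x)\<^sup>2 * ((Rx x)\<^sup>2 + (phase x)\<^sup>2)"
    by (simp only: mult.commute)
  have "(Rx x)\<^sup>2 + (phase x)\<^sup>2 > 0" using R_pos[OF x] by (simp add: add_pos_nonneg)
  then have "symbol_sq x / ((Rx x)\<^sup>2 + (phase x)\<^sup>2) = real M * real N * (sin x)\<^sup>2 / (den1 x * den2 x)"
    using den_pos[of x] by (intro frac_eq_eq[THEN iffD2, OF _ _ key]) auto
  moreover have "weight x = 2 / pi * (symbol_sq x / ((Rx x)\<^sup>2 + (phase x)\<^sup>2))"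
    by (simp add: weight_def)
  ultimately show ?thesis by (simp only: times_divide_eq_right)
qed

text \<open>The sine term of \<open>wave\<close> is odd in \<open>\<epsilon>\<close> and drops out.\<close>

lemma spec_coeff_sum_even:
  assumes x: "0 < x" "x < pi"
  shows "(\<Sum>\<epsilon>\<in>{1, -1}. spec_coeff \<epsilon> x (2 * int m))
      = 4 / pi * (real M * real N) * ((sin x)\<^sup>2 * cos (real m * x) / (den1 x * den2 x))"
    and "(\<Sum>\<epsilon>\<in>{1, -1}. spec_coeff \<epsilon> x (- 2 * int m))
      = 4 / pi * (real M * real N) * ((sin x)\<^sup>2 * cos (real m * x) / (den1 x * den2 x))"
proof -
  have "wave 1 x k + wave (- 1) x k = 2 * cos (k * x)" for k by (simp add: wave_def)
  then have "weight x * wave 1 x k + weight x * wave (- 1) x k = weight x * (2 * cos (k * x))" for k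
    by (simp flip: distrib_left)
  then show "(\<Sum>\<epsilon>\<in>{1, -1}. spec_coeff \<epsilon> x (2 * int m))
      = 4 / pi * (real M * real N) * ((sin x)\<^sup>2 * cos (real m * x) / (den1 x * den2 x))"
    and "(\<Sum>\<epsilon>\<in>{1, -1}. spec_coeff \<epsilon> x (- 2 * int m))
      = 4 / pi * (real M * real N) * ((sin x)\<^sup>2 * cos (real m * x) / (den1 x * den2 x))"
    using spec_coeff_even[OF _ x, of 1 m] spec_coeff_even[OF _ x, of "-1" m]
      spec_coeff_neg_even[OF _ x, of 1 m] spec_coeff_neg_even[OF _ x, of "-1" m]
    by (simp_all add: weight_eq[OF x] mult_ac)
qed

text \<open>By \<open>1 / A = B / symbol_sq x\<close> the coefficient is a polynomial in \<open>\<epsilon>\<close> and \<open>1 / \<epsilon>\<close>, of which the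
  even part survives. Then \<open>trig_factor\<close> cancels the remaining denominator \<open>symbol_sq x\<close>.\<close>

lemma spec_coeff_sum_odd:
  assumes x: "0 < x" "x < pi"
  shows "(\<Sum>\<epsilon>\<in>{1, -1}. spec_coeff \<epsilon> x (2 * int m + 1)) =
      2 / pi * (real M * real N) * (sin x * ((real N - 1) / sN * sin (real (Suc m) * x)
        + (real M - 1) / sM * sin (real m * x)) / (den1 x * den2 x))" (is ?odd)
    and "(\<Sum>\<epsilon>\<in>{1, -1}. spec_coeff \<epsilon> x (- 2 * int m - 1)) =
      2 / pi * (real M * real N) * (sin x * ((real M - 1) / sM * sin (real (Suc m) * x)
        + (real N - 1) / sN * sin (real m * x)) / (den1 x * den2 x))" (is ?neg)
proof -
  define Q where "Q = symbol_sq x"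
  define d where "d = phase x"
  define R where "R = Rx x"
  define s0 c0 s1 c1 where "s0 = sin (real m * x)" and "c0 = cos (real m * x)"
    and "s1 = sin ((real m + 1) * x)" and "c1 = cos ((real m + 1) * x)"
  have s: "sin x > 0" using sin_gt_zero[OF x] .
  have Q: "Q > 0" using symbol_sq_pos[OF x] by (simp add: Q_def)
  have R: "R > 0" using R_pos[OF x] by (simp add: R_def)
  have invA: "1 / Ax \<epsilon> x = (\<epsilon> * R - (diagG - diagH)) / (2 * Q)"
    and invB: "1 / Bx \<epsilon> x = (\<epsilon> * R + (diagG - diagH)) / (2 * Q)" if e: "\<epsilon> \<in> {1, -1}" for \<epsilon>
  proof -
    have "1 / Ax \<epsilon> x = Bx \<epsilon> x / Q" "1 / Bx \<epsilon> x = Ax \<epsilon> x / Q"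
      using AB_eq[OF e, of x] AB_nonzero[OF e x] Q by (simp_all add: Q_def[symmetric] field_simps)
    then show "1 / Ax \<epsilon> x = (\<epsilon> * R - (diagG - diagH)) / (2 * Q)"
      and "1 / Bx \<epsilon> x = (\<epsilon> * R + (diagG - diagH)) / (2 * Q)"
      unfolding A_eq B_eq R_def by (simp_all add: algebra_simps)
  qed
  have off: "diagH / offH = (real N - 1) / sN" "diagG / offG = (real M - 1) / sM"
    using w1_pos w2_pos by (simp_all add: diagG_def diagH_def offG_def offH_def)
  have ph: "2 * (offG * offH) * (d * sin x) = Q * (diagG + diagH) - (diagG - diagH) * (offG\<^sup>2 - offH\<^sup>2)"
    using phase_sin[OF x] by (simp add: d_def Q_def)
  have Qs: "Q = offG\<^sup>2 + offH\<^sup>2 + 2 * offG * offH * cos x" "Q = offH\<^sup>2 + offG\<^sup>2 + 2 * offH * offG * cos x"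
    by (simp_all add: Q_def symbol_sq_def)
  have tf: "(offG\<^sup>2 - offH\<^sup>2) * (offH * s0 + offG * s1) + 2 * offG * offH * sin x * (offH * c0 + offG * c1)
      = Q * (offG * s1 - offH * s0)"
    using trig_factor[of offG offH "real m" x] by (simp add: Qs(1) s0_def s1_def c0_def c1_def)
  have tf': "(offH\<^sup>2 - offG\<^sup>2) * (offG * s0 + offH * s1) + 2 * offH * offG * sin x * (offG * c0 + offH * c1)
      = Q * (offH * s1 - offG * s0)"
    using trig_factor[of offH offG "real m" x] by (simp add: Qs(2) s0_def s1_def c0_def c1_def)
  have split: "a * wave \<epsilon> x (real m) + b * wave \<epsilon> x (real m + 1)
      = (a * c0 + b * c1) + d / (\<epsilon> * R) * (a * s0 + b * s1)" for a b \<epsilon>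
    by (simp add: wave_def s0_def c0_def s1_def c1_def d_def R_def algebra_simps)
  \<comment> \<open>The contributions of both signs, with \<open>k\<close> the difference \<open>A - B\<close> up to sign.\<close>
  have sum2: "weight x * (C + d / R * Z) * ((R - k) / (2 * Q)) + weight x * (C + d / (- R) * Z) * ((- R - k) / (2 * Q))
      = weight x * ((d * Z - k * C) / Q)" for C Z k
    using R Q by (simp add: field_simps)
  have W: "weight x = 2 / pi * (real M * real N) * (sin x * sin x / (den1 x * den2 x))"
    by (simp add: weight_eq[OF x] power2_eq_square)
  show ?odd
  proof -
    let ?C = "offH * c0 + offG * c1" and ?Z = "offH * s0 + offG * s1" and ?k = "diagG - diagH"
    have coeff: "spec_coeff \<epsilon> x (2 * int m + 1) = weight x * (?C + d / (\<epsilon> * R) * ?Z) * ((\<epsilon> * R - ?k) / (2 * Q))"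
      if e: "\<epsilon> \<in> {1, -1}" for \<epsilon>
    proof -
      have "spec_coeff \<epsilon> x (2 * int m + 1) = weight x * (?C + d / (\<epsilon> * R) * ?Z) * (1 / Ax \<epsilon> x)"
        unfolding spec_coeff_odd[OF e x] split by simp
      then show ?thesis by (simp add: invA[OF e])
    qed
    have "(\<Sum>\<epsilon>\<in>{1, -1}. spec_coeff \<epsilon> x (2 * int m + 1)) = weight x * ((d * ?Z - ?k * ?C) / Q)"
      unfolding sum2[symmetric] using coeff[of 1] coeff[of "-1"] by simp
    also have "2 * (offG * offH) * sin x * (d * ?Z - ?k * ?C)
        = 2 * (offG * offH) * (d * sin x) * ?Z - ?k * (2 * offG * offH * sin x * ?C)" by (simp add: algebra_simps)
    then have "2 * (offG * offH) * sin x * (d * ?Z - ?k * ?C) = Q * (2 * (diagH * offG * s1 + diagG * offH * s0))"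
      unfolding ph using tf by algebra
    then have "(d * ?Z - ?k * ?C) / Q = (diagH / offH * s1 + diagG / offG * s0) / sin x"
      using s Q off_pos by (simp add: field_simps)
    also have "weight x * \<dots> = 2 / pi * (real M * real N) * (sin x * (diagH / offH * s1 + diagG / offG * s0) / (den1 x * den2 x))"
      unfolding W using s by simp
    finally show ?thesis unfolding off s0_def s1_def by (simp add: add.commute)
  qed
  show ?neg
  proof -
    let ?C = "offG * c0 + offH * c1" and ?Z = "offG * s0 + offH * s1" and ?k = "- (diagG - diagH)"
    have coeff: "spec_coeff \<epsilon> x (- 2 * int m - 1) = weight x * (?C + d / (\<epsilon> * R) * ?Z) * ((\<epsilon> * R - ?k) / (2 * Q))"
      if e: "\<epsilon> \<in> {1, -1}" for \<epsilon>
    proof -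
      have "spec_coeff \<epsilon> x (- 2 * int m - 1) = weight x * (?C + d / (\<epsilon> * R) * ?Z) * (1 / Bx \<epsilon> x)"
        unfolding spec_coeff_neg_odd[OF e x] split by simp
      then show ?thesis by (simp add: invB[OF e])
    qed
    have "(\<Sum>\<epsilon>\<in>{1, -1}. spec_coeff \<epsilon> x (- 2 * int m - 1)) = weight x * ((d * ?Z - ?k * ?C) / Q)"
      unfolding sum2[symmetric] using coeff[of 1] coeff[of "-1"] by simp
    also have "2 * (offG * offH) * sin x * (d * ?Z - ?k * ?C)
        = 2 * (offG * offH) * (d * sin x) * ?Z - ?k * (2 * offH * offG * sin x * ?C)" by (simp add: algebra_simps)
    then have "2 * (offG * offH) * sin x * (d * ?Z - ?k * ?C) = Q * (2 * (diagG * offH * s1 + diagH * offG * s0))"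
      unfolding ph using tf' by algebra
    then have "(d * ?Z - ?k * ?C) / Q = (diagG / offG * s1 + diagH / offH * s0) / sin x"
      using s Q off_pos by (simp add: field_simps)
    also have "weight x * \<dots> = 2 / pi * (real M * real N) * (sin x * (diagG / offG * s1 + diagH / offH * s0) / (den1 x * den2 x))"
      unfolding W using s by simp
    finally show ?thesis unfolding off s0_def s1_def by (simp add: add.commute)
  qed
qed

lemma eigfun1_values:
  "eigfun1 M N (2 * int m) = beta1 M N * r1 ^ m"
  "eigfun1 M N (- 2 * int m) = beta1 M N * r1 ^ m"
  "eigfun1 M N (2 * int m + 1) = - beta1 M N * r1 ^ m / sN"
  "eigfun1 M N (- 2 * int m - 1) = beta1 M N * sM * r1 ^ m"
proof -
  have r: "r1 ^ m = (- 1) ^ m * (sM ^ m / sN ^ m)"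
    by (simp add: r1_def power_minus[of "sM / sN"] power_divide)
  have q: "(real M / real N) powr (real m / 2) = sM ^ m / sN ^ m"
    using MN_pos by (simp add: powr_half_of_nat(1) real_sqrt_divide power_divide)
  show "eigfun1 M N (2 * int m) = beta1 M N * r1 ^ m"
    using eigfun1_simps(1)[of M N "int m"] by (simp add: q r)
  show "eigfun1 M N (- 2 * int m) = beta1 M N * r1 ^ m"
    using eigfun1_simps(1)[of M N "- int m"] by (simp add: q r power_int_minus power_inverse[symmetric])
  show "eigfun1 M N (2 * int m + 1) = - beta1 M N * r1 ^ m / sN"
    using MN_pos powr_half_of_nat(1)[of "real M" m] powr_half_of_nat(4)[of "real N" m]
    unfolding eigfun1_simps by (simp add: r mult_ac)
  show "eigfun1 M N (- 2 * int m - 1) = beta1 M N * sM * r1 ^ m"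
    using MN_pos powr_half_of_nat(3)[of "real M" m] powr_half_of_nat(2)[of "real N" m]
    unfolding eigfun1_simps by (simp add: r)
qed

lemma eigfun2_values:
  "eigfun2 M N (2 * int m) = beta2 M N * r2 ^ m"
  "eigfun2 M N (- 2 * int m) = beta2 M N * r2 ^ m"
  "eigfun2 M N (2 * int m + 1) = - beta2 M N * r2 ^ m / sN"
  "eigfun2 M N (- 2 * int m - 1) = - beta2 M N * r2 ^ m / sM"
proof -
  have r: "r2 ^ m = 1 / (sM ^ m * sN ^ m)"
    by (simp add: r2_def power_divide power_mult_distrib)
  have q: "(real M * real N) powr (- real m / 2) = 1 / (sM ^ m * sN ^ m)"
    using MN_pos by (subst powr_half_of_nat(2)) (simp_all add: real_sqrt_mult power_mult_distrib)
  show "eigfun2 M N (2 * int m) = beta2 M N * r2 ^ m"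
    using eigfun2_simps(1)[of M N "int m"] q by (simp add: r)
  show "eigfun2 M N (- 2 * int m) = beta2 M N * r2 ^ m"
    using eigfun2_simps(1)[of M N "- int m"] q by (simp add: r)
  show "eigfun2 M N (2 * int m + 1) = - beta2 M N * r2 ^ m / sN"
    using MN_pos powr_half_of_nat(2)[of "real M" m] powr_half_of_nat(4)[of "real N" m]
    unfolding eigfun2_simps by (simp add: r)
  show "eigfun2 M N (- 2 * int m - 1) = - beta2 M N * r2 ^ m / sM"
    using MN_pos powr_half_of_nat(2)[of "real N" m] powr_half_of_nat(4)[of "real M" m]
    unfolding eigfun2_simps by (simp add: r)
qed

lemma eigfun1_jacobi: "jacobi (eigfun1 M N) n = (real M * \<omega>\<^sub>1 - \<omega>\<^sub>2) * eigfun1 M N n"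
proof (rule jacobi_eigenI)
  note v = eigfun1_values
  show "(real M * \<omega>\<^sub>1 - \<omega>\<^sub>2) * eigfun1 M N 0 = offG * eigfun1 M N (- 1) + offH * eigfun1 M N 1"
    using v(1)[of 0] v(3)[of 0] v(4)[of 0] MN_pos by (simp add: offG_def offH_def algebra_simps)
  show "(real M * \<omega>\<^sub>1 - \<omega>\<^sub>2 - diagH) * eigfun1 M N (2 * int m + 1)
      = offH * eigfun1 M N (2 * int m) + offG * eigfun1 M N (2 * int (Suc m))" for m
    unfolding v using MN_pos by (simp add: offG_def offH_def diagH_def r1_def sq_sqrt field_simps)
  show "(real M * \<omega>\<^sub>1 - \<omega>\<^sub>2 - diagG) * eigfun1 M N (2 * int (Suc m))
      = offG * eigfun1 M N (2 * int m + 1) + offH * eigfun1 M N (2 * int (Suc m) + 1)" for m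
    unfolding v using MN_pos by (simp add: offG_def offH_def diagG_def r1_def sq_sqrt field_simps)
  show "(real M * \<omega>\<^sub>1 - \<omega>\<^sub>2 - diagG) * eigfun1 M N (- 2 * int m - 1)
      = offG * eigfun1 M N (- 2 * int m) + offH * eigfun1 M N (- 2 * int (Suc m))" for m
    unfolding v using MN_pos by (simp add: offG_def offH_def diagG_def r1_def sq_sqrt field_simps)
  show "(real M * \<omega>\<^sub>1 - \<omega>\<^sub>2 - diagH) * eigfun1 M N (- 2 * int (Suc m))
      = offH * eigfun1 M N (- 2 * int m - 1) + offG * eigfun1 M N (- 2 * int (Suc m) - 1)" for m
    unfolding v using MN_pos by (simp add: offG_def offH_def diagH_def r1_def sq_sqrt field_simps)
qed

lemma eigfun2_jacobi: "jacobi (eigfun2 M N) n = (- \<omega>\<^sub>1 - \<omega>\<^sub>2) * eigfun2 M N n"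
proof (rule jacobi_eigenI)
  note v = eigfun2_values
  show "(- \<omega>\<^sub>1 - \<omega>\<^sub>2) * eigfun2 M N 0 = offG * eigfun2 M N (- 1) + offH * eigfun2 M N 1"
    using v(1)[of 0] v(3)[of 0] v(4)[of 0] MN_pos by (simp add: offG_def offH_def algebra_simps)
  show "(- \<omega>\<^sub>1 - \<omega>\<^sub>2 - diagH) * eigfun2 M N (2 * int m + 1)
      = offH * eigfun2 M N (2 * int m) + offG * eigfun2 M N (2 * int (Suc m))" for m
    unfolding v using MN_pos by (simp add: offG_def offH_def diagH_def r2_def sq_sqrt field_simps)
  show "(- \<omega>\<^sub>1 - \<omega>\<^sub>2 - diagG) * eigfun2 M N (2 * int (Suc m))
      = offG * eigfun2 M N (2 * int m + 1) + offH * eigfun2 M N (2 * int (Suc m) + 1)" for m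
    unfolding v using MN_pos by (simp add: offG_def offH_def diagG_def r2_def sq_sqrt field_simps)
  show "(- \<omega>\<^sub>1 - \<omega>\<^sub>2 - diagG) * eigfun2 M N (- 2 * int m - 1)
      = offG * eigfun2 M N (- 2 * int m) + offH * eigfun2 M N (- 2 * int (Suc m))" for m
    unfolding v using MN_pos by (simp add: offG_def offH_def diagG_def r2_def sq_sqrt field_simps)
  show "(- \<omega>\<^sub>1 - \<omega>\<^sub>2 - diagH) * eigfun2 M N (- 2 * int (Suc m))
      = offH * eigfun2 M N (- 2 * int m - 1) + offG * eigfun2 M N (- 2 * int (Suc m) - 1)" for m
    unfolding v using MN_pos by (simp add: offG_def offH_def diagH_def r2_def sq_sqrt field_simps)
qed

text \<open>Partial fractions: the sum of \<open>den1\<close> and \<open>den2\<close> does not depend on \<open>x\<close>.\<close>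

lemma has_integral_over_dens:
  assumes "((\<lambda>x. g x / (1 + r1\<^sup>2 - 2 * r1 * cos x)) has_integral I1) {0..pi}"
    and "((\<lambda>x. g x / (1 + r2\<^sup>2 - 2 * r2 * cos x)) has_integral I2) {0..pi}"
  shows "((\<lambda>x. g x / (den1 x * den2 x)) has_integral
    (I1 / real N + I2 / (real M * real N)) / ((real M + 1) * (real N + 1))) {0..pi}"
proof -
  have "((\<lambda>x. (g x / (1 + r1\<^sup>2 - 2 * r1 * cos x) / real N
        + g x / (1 + r2\<^sup>2 - 2 * r2 * cos x) / (real M * real N)) / ((real M + 1) * (real N + 1)))
      has_integral (I1 / real N + I2 / (real M * real N)) / ((real M + 1) * (real N + 1))) {0..pi}"
    by (intro has_integral_divide has_integral_add assms)
  moreover have "(g x / (1 + r1\<^sup>2 - 2 * r1 * cos x) / real N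
        + g x / (1 + r2\<^sup>2 - 2 * r2 * cos x) / (real M * real N)) / ((real M + 1) * (real N + 1))
      = g x / (den1 x * den2 x)" for x
  proof -
    have "g x / (1 + r1\<^sup>2 - 2 * r1 * cos x) / real N = g x / den1 x"
      "g x / (1 + r2\<^sup>2 - 2 * r2 * cos x) / (real M * real N) = g x / den2 x"
      by (simp_all add: den1_eq den2_eq mult.commute)
    moreover have "(g x / den1 x + g x / den2 x) / (den1 x + den2 x) = g x / (den1 x * den2 x)"
    proof -
      have "g x / den1 x + g x / den2 x = g x * (den1 x + den2 x) / (den1 x * den2 x)"
        using den_pos[of x] by (simp add: field_simps)
      then show ?thesis using den_pos[of x] by simp
    qed
    ultimately show ?thesis by (simp only: den_sum)
  qed
  ultimately show ?thesis by simp
qed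

lemma beta_sq:
  "beta1 M N * beta1 M N = (real N - real M) / ((real M + 1) * (real N + 1))"
  "beta2 M N * beta2 M N = (real M * real N - 1) / ((real M + 1) * (real N + 1))"
proof -
  have "1 * 1 \<le> real M * real N" using M_ge_1 M_less_N by (intro mult_mono) auto
  then show "beta1 M N * beta1 M N = (real N - real M) / ((real M + 1) * (real N + 1))"
    "beta2 M N * beta2 M N = (real M * real N - 1) / ((real M + 1) * (real N + 1))"
    using M_less_N by (simp_all add: beta1_def beta2_def)
qed

lemma r_relations:
  "real N * (r1 * r1) = real M" "real M * real N * (r2 * r2) = 1" "real M * real N * r2 = - (real N * r1)"
  using MN_pos by (simp_all add: r1_def r2_def field_simps)

text \<open>The integral of the total density at even positions. The Poisson integrals produce
  \<open>r^m - r^(m - 2)\<close>, which \<open>r_relations\<close> turns into multiples of \<open>r^m\<close>; the multipliers are the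
  squares of \<^const>\<open>beta1\<close> and \<^const>\<open>beta2\<close>.\<close>

lemma plancherel_even:
  "((\<lambda>x. 4 / pi * (real M * real N) * ((sin x)\<^sup>2 * cos (real m * x) / (den1 x * den2 x))) has_integral
    ((if m = 0 then 1 else 0) - beta1 M N * beta1 M N * r1 ^ m - beta2 M N * beta2 M N * r2 ^ m)) {0..pi}"
proof -
  define K where "K = (real M + 1) * (real N + 1)"
  have K: "K > 0" by (simp add: K_def)
  define E where "E r = (if m = 0 then pi / 2 else if m = 1 then pi / 4 * r else pi / 4 * (r ^ m - r ^ (m - 2)))" for r :: real
  have "((\<lambda>x. 4 / pi * (real M * real N) * ((sin x)\<^sup>2 * cos (real m * x) / (den1 x * den2 x))) has_integral
      4 / pi * (real M * real N) * ((E r1 / real N + E r2 / (real M * real N)) / K)) {0..pi}"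
    unfolding K_def E_def
    by (intro has_integral_mult_right has_integral_over_dens has_integral_poisson_sin_sq r1_bound r2_bound)
  moreover have "4 / pi * (real M * real N) * ((E r1 / real N + E r2 / (real M * real N)) / K)
      = (if m = 0 then 1 else 0) - (real N - real M) / K * r1 ^ m - (real M * real N - 1) / K * r2 ^ m"
  proof -
    have "4 / pi * (real M * real N) * (E r1 / real N + E r2 / (real M * real N))
        = 4 / pi * (real M * E r1 + E r2)"
      using MN_pos by (simp add: field_simps)
    also have "\<dots> = (if m = 0 then K else 0) - (real N - real M) * r1 ^ m - (real M * real N - 1) * r2 ^ m"
    proof -
      consider "m = 0" | "m = 1" | l where "m = Suc (Suc l)" by (metis One_nat_def not0_implies_Suc)
      then show ?thesis
      proof cases
        case 1
        then show ?thesis by (simp add: E_def K_def field_simps)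
      next
        case 2
        then have "4 / pi * (real M * E r1 + E r2) = real M * r1 + r2"
          by (simp add: E_def field_simps)
        then show ?thesis using 2 r_relations(3) by (simp add: algebra_simps)
      next
        case 3
        have "4 / pi * (real M * E r1 + E r2) = real M * (r1 ^ m - r1 ^ l) + (r2 ^ m - r2 ^ l)"
          using 3 by (simp add: E_def field_simps)
        moreover have rel: "real M * r1 ^ l = real N * r1 ^ m" "r2 ^ l = real M * real N * r2 ^ m"
          using r_relations(1,2) by (simp_all add: 3 mult.assoc[symmetric])
        have "real M * (r1 ^ m - r1 ^ l) + (r2 ^ m - r2 ^ l)
            = 0 - (real N - real M) * r1 ^ m - (real M * real N - 1) * r2 ^ m"
          unfolding right_diff_distrib rel by (simp add: left_diff_distrib)
        moreover have "(m = 0) = False" using 3 by simp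
        ultimately show ?thesis by (simp only: if_False)
      qed
    qed
    finally have "4 / pi * (real M * real N) * (E r1 / real N + E r2 / (real M * real N)) / K
        = ((if m = 0 then K else 0) - (real N - real M) * r1 ^ m - (real M * real N - 1) * r2 ^ m) / K" by simp
    moreover have "((if m = 0 then K else 0) - a * u - b * v) / K = (if m = 0 then 1 else 0) - a / K * u - b / K * v" for a b u v
      using K by (simp add: diff_divide_distrib)
    ultimately show ?thesis by (simp only: times_divide_eq_right)
  qed
  ultimately show ?thesis unfolding beta_sq K_def by (simp only:)
qed

text \<open>The common part of the two half-lines, whose densities at odd positions differ only in the
  constants \<open>c\<close> and \<open>d\<close>.\<close>

lemma plancherel_odd_aux:
  "((\<lambda>x. 2 / pi * (real M * real N) * (sin x * (c * sin (real (Suc m) * x) + d * sin (real m * x)) / (den1 x * den2 x)))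
    has_integral (if m = 0 then (real M + 1) * c
      else real M * (c * r1 + d) * r1 ^ (m - 1) + (c * r2 + d) * r2 ^ (m - 1)) / ((real M + 1) * (real N + 1))) {0..pi}"
proof -
  define J where "J r = pi / 2 * (c * r ^ m + (if m = 0 then 0 else d * r ^ (m - 1)))" for r :: real
  have J: "((\<lambda>x. sin x * (c * sin (real (Suc m) * x) + d * sin (real m * x)) / (1 + r\<^sup>2 - 2 * r * cos x))
      has_integral J r) {0..pi}" if r: "\<bar>r\<bar> < 1" for r
  proof -
    have "((\<lambda>x. c * (sin x * sin (real (Suc m) * x) / (1 + r\<^sup>2 - 2 * r * cos x))
        + d * (sin x * sin (real m * x) / (1 + r\<^sup>2 - 2 * r * cos x)))
        has_integral c * (pi / 2 * r ^ m) + d * (if m = 0 then 0 else pi / 2 * r ^ (m - 1))) {0..pi}"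
    proof (intro has_integral_add has_integral_mult_right has_integral_poisson r)
      show "((\<lambda>x. sin x * sin (real m * x) / (1 + r\<^sup>2 - 2 * r * cos x)) has_integral
          (if m = 0 then 0 else pi / 2 * r ^ (m - 1))) {0..pi}"
        using has_integral_poisson[OF r, of "m - 1"] by (cases m) simp_all
    qed
    moreover have "c * (sin x * sin (real (Suc m) * x) / (1 + r\<^sup>2 - 2 * r * cos x))
        + d * (sin x * sin (real m * x) / (1 + r\<^sup>2 - 2 * r * cos x))
      = sin x * (c * sin (real (Suc m) * x) + d * sin (real m * x)) / (1 + r\<^sup>2 - 2 * r * cos x)" for x
      unfolding distrib_left add_divide_distrib by (simp add: mult.left_commute)
    moreover have "c * (pi / 2 * r ^ m) + d * (if m = 0 then 0 else pi / 2 * r ^ (m - 1)) = J r"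
      by (simp add: J_def algebra_simps)
    ultimately show ?thesis by (simp only:)
  qed
  have "((\<lambda>x. 2 / pi * (real M * real N) * (sin x * (c * sin (real (Suc m) * x) + d * sin (real m * x)) / (den1 x * den2 x)))
    has_integral 2 / pi * (real M * real N) * ((J r1 / real N + J r2 / (real M * real N)) / ((real M + 1) * (real N + 1)))) {0..pi}"
    by (intro has_integral_mult_right has_integral_over_dens J r1_bound r2_bound)
  moreover have "2 / pi * (real M * real N) * (J r1 / real N + J r2 / (real M * real N)) =
      (if m = 0 then (real M + 1) * c else real M * (c * r1 + d) * r1 ^ (m - 1) + (c * r2 + d) * r2 ^ (m - 1))"
  proof -
    have "2 / pi * (real M * real N) * (J r1 / real N + J r2 / (real M * real N)) = 2 / pi * (real M * J r1 + J r2)"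
      using MN_pos by (simp add: field_simps)
    also have "\<dots> = (if m = 0 then (real M + 1) * c else real M * (c * r1 + d) * r1 ^ (m - 1) + (c * r2 + d) * r2 ^ (m - 1))"
      by (cases m) (simp_all add: J_def field_simps)
    finally show ?thesis .
  qed
  ultimately show ?thesis by (simp only: times_divide_eq_right)
qed

lemma plancherel_odd:
  "((\<lambda>x. 2 / pi * (real M * real N) * (sin x * ((real N - 1) / sN * sin (real (Suc m) * x)
        + (real M - 1) / sM * sin (real m * x)) / (den1 x * den2 x))) has_integral
    (beta1 M N * beta1 M N * r1 ^ m + beta2 M N * beta2 M N * r2 ^ m) / sN) {0..pi}"
proof -
  define K where "K = (real M + 1) * (real N + 1)"
  define c d where "c = (real N - 1) / sN" and "d = (real M - 1) / sM"
  have "(if m = 0 then (real M + 1) * c else real M * (c * r1 + d) * r1 ^ (m - 1) + (c * r2 + d) * r2 ^ (m - 1))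
      = ((real N - real M) * r1 ^ m + (real M * real N - 1) * r2 ^ m) / sN"
  proof (cases m)
    case 0
    then show ?thesis using MN_pos by (simp add: c_def field_simps)
  next
    case (Suc l)
    have "real M * (c * r1 + d) = (real N - real M) * r1 / sN" "c * r2 + d = (real M * real N - 1) * r2 / sN"
      using MN_pos by (simp_all add: c_def d_def r1_def r2_def sq_sqrt field_simps)
    then show ?thesis by (simp add: Suc add_divide_distrib)
  qed
  moreover have "((real N - real M) * r1 ^ m + (real M * real N - 1) * r2 ^ m) / sN / K
      = ((real N - real M) / K * r1 ^ m + (real M * real N - 1) / K * r2 ^ m) / sN"
    by (simp add: add_divide_distrib mult.commute)
  ultimately show ?thesis
    using plancherel_odd_aux[of c m d] unfolding c_def[symmetric] d_def[symmetric] beta_sq K_def[symmetric]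
    by (simp only:)
qed

lemma plancherel_neg_odd:
  "((\<lambda>x. 2 / pi * (real M * real N) * (sin x * ((real M - 1) / sM * sin (real (Suc m) * x)
        + (real N - 1) / sN * sin (real m * x)) / (den1 x * den2 x))) has_integral
    - (beta1 M N * beta1 M N * r1 ^ m) * sM + beta2 M N * beta2 M N * r2 ^ m / sM) {0..pi}"
proof -
  define K where "K = (real M + 1) * (real N + 1)"
  define c d where "c = (real M - 1) / sM" and "d = (real N - 1) / sN"
  have "(if m = 0 then (real M + 1) * c else real M * (c * r1 + d) * r1 ^ (m - 1) + (c * r2 + d) * r2 ^ (m - 1))
      = - ((real N - real M) * r1 ^ m) * sM + (real M * real N - 1) * r2 ^ m / sM"
  proof (cases m)
    case 0
    then show ?thesis using MN_pos by (simp add: c_def sq_sqrt field_simps)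
  next
    case (Suc l)
    have "real M * (c * r1 + d) = - ((real N - real M) * r1) * sM" "c * r2 + d = (real M * real N - 1) * r2 / sM"
      using MN_pos by (simp_all add: c_def d_def r1_def r2_def sq_sqrt field_simps)
    then show ?thesis by (simp add: Suc)
  qed
  moreover have "(- ((real N - real M) * r1 ^ m) * sM + (real M * real N - 1) * r2 ^ m / sM) / K
      = - ((real N - real M) / K * r1 ^ m) * sM + (real M * real N - 1) / K * r2 ^ m / sM"
  proof -
    have "(- (a * p) * s + b * q / u) / K = - (a / K * p) * s + b / K * q / u" for a p s b q u :: real
      by (simp add: diff_divide_distrib mult.commute)
    then show ?thesis .
  qed
  ultimately show ?thesis
    using plancherel_odd_aux[of c m d] unfolding c_def[symmetric] d_def[symmetric] beta_sq K_def[symmetric]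
    by (simp only:)
qed

section \<open>Functional calculus for the Jacobi operator\<close>

text \<open>From \<open>4 symbol_sq x \<le> R\<^sup>2\<close> and \<open>2 R \<bar>phase x\<bar> \<le> R\<^sup>2 + (phase x)\<^sup>2\<close>. These bounds are uniform up
  to the ends of the interval, where \<^const>\<open>phase\<close> need not stay bounded.\<close>

lemma weight_bounds:
  assumes x: "0 < x" "x < pi"
  shows "symbol_sq x / ((Rx x)\<^sup>2 + (phase x)\<^sup>2) * (1 + \<bar>phase x\<bar> / Rx x) \<le> 1"
    and "Rx x / ((Rx x)\<^sup>2 + (phase x)\<^sup>2) * (1 + \<bar>phase x\<bar> / Rx x) * sqrt (symbol_sq x) \<le> 1"
proof -
  define R d Q where "R = Rx x" and "d = \<bar>phase x\<bar>" and "Q = symbol_sq x"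
  have R: "R > 0" and d: "d \<ge> 0" and Q: "Q > 0" using R_pos[OF x] symbol_sq_pos[OF x] by (simp_all add: R_def d_def Q_def)
  have QR: "4 * Q \<le> R\<^sup>2" unfolding R_def R_sq Q_def by simp
  have sQ: "2 * sqrt Q \<le> R" using QR R by (intro real_le_rsqrt[THEN order_trans, of "2 * sqrt Q" "R\<^sup>2"]) (simp_all add: power_mult_distrib Q[THEN less_imp_le])
  have pos: "R\<^sup>2 + d\<^sup>2 > 0" using R by (simp add: add_pos_nonneg)
  have "2 * R * d \<le> R\<^sup>2 + d\<^sup>2" by (rule sum_squares_bound)
  moreover have "0 \<le> R\<^sup>2" "0 \<le> d\<^sup>2" by simp_all
  moreover have "2 * (R * (R + d)) = 2 * R\<^sup>2 + 2 * R * d" by (simp add: power2_eq_square algebra_simps)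
  ultimately have main: "R * (R + d) \<le> 2 * (R\<^sup>2 + d\<^sup>2)" unfolding distrib_left[of 2] by linarith
  have fr: "1 + d / R = (R + d) / R" using R by (simp add: field_simps)
  have "Q * (R + d) \<le> R * (R\<^sup>2 + d\<^sup>2)"
  proof -
    have "4 * (Q * (R + d)) \<le> R\<^sup>2 * (R + d)" using mult_right_mono[OF QR, of "R + d"] R d by simp
    also have "\<dots> = R * (R * (R + d))" by (simp add: power2_eq_square)
    also have "\<dots> \<le> R * (2 * (R\<^sup>2 + d\<^sup>2))" using main R by (intro mult_left_mono) auto
    finally have "4 * (Q * (R + d)) \<le> 2 * (R * (R\<^sup>2 + d\<^sup>2))" by (simp only: mult.left_commute)
    moreover have "0 \<le> R * (R\<^sup>2 + d\<^sup>2)" using R pos by simp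
    ultimately show ?thesis by linarith
  qed
  then show "symbol_sq x / ((Rx x)\<^sup>2 + (phase x)\<^sup>2) * (1 + \<bar>phase x\<bar> / Rx x) \<le> 1"
    using pos R unfolding R_def[symmetric] d_def[symmetric] Q_def[symmetric] fr
    by (simp add: d_def divide_le_eq mult.commute)
  have "sqrt Q * (R + d) \<le> R\<^sup>2 + d\<^sup>2"
  proof -
    have "2 * (sqrt Q * (R + d)) \<le> R * (R + d)" using mult_right_mono[OF sQ, of "R + d"] R d by simp
    then have "2 * (sqrt Q * (R + d)) \<le> 2 * (R\<^sup>2 + d\<^sup>2)" using main by (rule order_trans)
    then show ?thesis by (simp only: mult_le_cancel_left_pos zero_less_numeral)
  qed
  then show "Rx x / ((Rx x)\<^sup>2 + (phase x)\<^sup>2) * (1 + \<bar>phase x\<bar> / Rx x) * sqrt (symbol_sq x) \<le> 1"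
    using pos R unfolding R_def[symmetric] d_def[symmetric] Q_def[symmetric] fr
    by (simp add: d_def divide_le_eq mult.commute)
qed

lemma wave_bound:
  assumes "\<epsilon> \<in> {1, -1}" "0 < x" "x < pi" and uv: "\<bar>u\<bar> \<le> c" "\<bar>v\<bar> \<le> c"
  shows "\<bar>u + phase x / (\<epsilon> * Rx x) * v\<bar> \<le> (1 + \<bar>phase x\<bar> / Rx x) * c"
proof -
  have "\<bar>phase x / (\<epsilon> * Rx x)\<bar> = \<bar>phase x\<bar> / Rx x"
    using assms(1) R_pos[OF assms(2,3)] by (auto simp: abs_divide abs_mult)
  then have "\<bar>u + phase x / (\<epsilon> * Rx x) * v\<bar> \<le> \<bar>u\<bar> + \<bar>phase x\<bar> / Rx x * \<bar>v\<bar>"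
    by (metis abs_mult abs_triangle_ineq)
  also have "\<dots> \<le> c + \<bar>phase x\<bar> / Rx x * c"
    using uv R_pos[OF assms(2,3)] by (intro add_mono mult_left_mono) auto
  finally show ?thesis by (simp add: distrib_right)
qed

text \<open>The two combinations are the real and imaginary parts of \<open>(a + b exp (\<i> x)) exp (\<i> k x)\<close>.\<close>

lemma trig_combination_bound:
  "\<bar>a * cos (k * x) + b * cos ((k + 1) * x)\<bar> \<le> sqrt (a\<^sup>2 + b\<^sup>2 + 2 * a * b * cos x)"
  "\<bar>a * sin (k * x) + b * sin ((k + 1) * x)\<bar> \<le> sqrt (a\<^sup>2 + b\<^sup>2 + 2 * a * b * cos x)"
proof -
  have "cos x = cos ((k + 1) * x - k * x)" by (simp add: algebra_simps)
  also have "\<dots> = cos ((k + 1) * x) * cos (k * x) + sin ((k + 1) * x) * sin (k * x)" by (rule cos_diff)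
  finally have c: "cos x = cos ((k + 1) * x) * cos (k * x) + sin ((k + 1) * x) * sin (k * x)" .
  have "(a * c0 + b * c1)\<^sup>2 + (a * s0 + b * s1)\<^sup>2 = a\<^sup>2 + b\<^sup>2 + 2 * a * b * (c1 * c0 + s1 * s0)"
    if "s0\<^sup>2 + c0\<^sup>2 = 1" "s1\<^sup>2 + c1\<^sup>2 = 1" for s0 c0 s1 c1
    using that by algebra
  from this[OF sin_cos_squared_add sin_cos_squared_add, of "k * x" "(k + 1) * x"]
  have "(a * cos (k * x) + b * cos ((k + 1) * x))\<^sup>2 + (a * sin (k * x) + b * sin ((k + 1) * x))\<^sup>2
      = a\<^sup>2 + b\<^sup>2 + 2 * a * b * cos x" by (simp add: c)
  then show "\<bar>a * cos (k * x) + b * cos ((k + 1) * x)\<bar> \<le> sqrt (a\<^sup>2 + b\<^sup>2 + 2 * a * b * cos x)"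
    "\<bar>a * sin (k * x) + b * sin ((k + 1) * x)\<bar> \<le> sqrt (a\<^sup>2 + b\<^sup>2 + 2 * a * b * cos x)"
    by (metis (no_types) real_sqrt_abs real_sqrt_le_iff le_add_same_cancel1 le_add_same_cancel2 zero_le_power2)+
qed

text \<open>At odd positions there is a division by \<open>A\<close> or \<open>B\<close>, which may be small. As
  \<open>1 / A = B / symbol_sq x\<close> with \<open>\<bar>B\<bar> \<le> R\<close>, it is compensated by the bound \<open>sqrt (symbol_sq x)\<close> on
  the trigonometric combination in the numerator.\<close>

lemma spec_coeff_bound:
  assumes e: "\<epsilon> \<in> {1, -1}" and x: "0 < x" "x < pi"
  shows "\<bar>spec_coeff \<epsilon> x n\<bar> \<le> 1"
proof -
  define E where "E = (Rx x)\<^sup>2 + (phase x)\<^sup>2"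
  have E: "E > 0" using R_pos[OF x] by (simp add: E_def add_pos_nonneg)
  have Q: "symbol_sq x > 0" using symbol_sq_pos[OF x] .
  have pi: "2 / pi \<le> 1" using pi_ge_two by simp
  have even: "\<bar>weight x * wave \<epsilon> x k\<bar> \<le> 1" for k
  proof -
    have "\<bar>wave \<epsilon> x k\<bar> \<le> (1 + \<bar>phase x\<bar> / Rx x) * 1"
      unfolding wave_def by (rule wave_bound[OF e x]) auto
    then have "2 / pi * symbol_sq x / E * \<bar>wave \<epsilon> x k\<bar> \<le> 2 / pi * symbol_sq x / E * (1 + \<bar>phase x\<bar> / Rx x)"
      using E Q by (intro mult_left_mono) simp_all
    moreover have "\<bar>weight x\<bar> = 2 / pi * symbol_sq x / E"
      using E Q by (simp add: weight_def E_def[symmetric])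
    ultimately have "\<bar>weight x * wave \<epsilon> x k\<bar> \<le> 2 / pi * (symbol_sq x / E * (1 + \<bar>phase x\<bar> / Rx x))"
      by (simp add: abs_mult)
    also have "\<dots> \<le> 1 * 1"
      using weight_bounds(1)[OF x] pi E Q R_pos[OF x] unfolding E_def[symmetric]
      by (intro mult_mono) auto
    finally show ?thesis by simp
  qed
  have odd: "\<bar>weight x * (a * wave \<epsilon> x k + b * wave \<epsilon> x (k + 1)) / A\<bar> \<le> 1"
    if ab: "a\<^sup>2 + b\<^sup>2 + 2 * a * b * cos x = symbol_sq x" and A: "A * B = symbol_sq x" "\<bar>B\<bar> \<le> Rx x" for a b A B k
  proof -
    let ?s = "(a * cos (k * x) + b * cos ((k + 1) * x)) + phase x / (\<epsilon> * Rx x) * (a * sin (k * x) + b * sin ((k + 1) * x))"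
    have "a * (c0 + q * s0) + b * (c1 + q * s1) = (a * c0 + b * c1) + q * (a * s0 + b * s1)" for q c0 c1 s0 s1 :: real
      by (simp add: algebra_simps)
    then have "a * wave \<epsilon> x k + b * wave \<epsilon> x (k + 1) = ?s"
      unfolding wave_def .
    moreover have s: "\<bar>?s\<bar> \<le> (1 + \<bar>phase x\<bar> / Rx x) * sqrt (symbol_sq x)"
      by (rule wave_bound[OF e x]) (use trig_combination_bound[of a k x b] in \<open>simp_all add: ab\<close>)
    moreover have "weight x / A = 2 / pi * B / E"
    proof -
      have "A \<noteq> 0" using A Q by auto
      then show ?thesis by (simp add: weight_def E_def[symmetric] A(1)[symmetric])
    qed
    ultimately have "weight x * (a * wave \<epsilon> x k + b * wave \<epsilon> x (k + 1)) / A = 2 / pi * B / E * ?s"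
      by (metis times_divide_eq_left)
    then have "\<bar>weight x * (a * wave \<epsilon> x k + b * wave \<epsilon> x (k + 1)) / A\<bar> = 2 / pi * (\<bar>B\<bar> / E * \<bar>?s\<bar>)"
      using E by (simp add: abs_mult)
    also have "\<dots> \<le> 1 * (Rx x / E * ((1 + \<bar>phase x\<bar> / Rx x) * sqrt (symbol_sq x)))"
      using pi E A(2) s by (intro mult_mono divide_right_mono) auto
    also have "\<dots> \<le> 1" using weight_bounds(2)[OF x] by (simp add: E_def mult.assoc)
    finally show ?thesis .
  qed
  have AB: "\<bar>Ax \<epsilon> x\<bar> \<le> Rx x" "\<bar>Bx \<epsilon> x\<bar> \<le> Rx x"
  proof -
    have "\<bar>diagG - diagH\<bar> \<le> Rx x"
      unfolding R_eq using symbol_sq_nonneg[of x] by (simp add: real_le_rsqrt)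
    then show "\<bar>Ax \<epsilon> x\<bar> \<le> Rx x" "\<bar>Bx \<epsilon> x\<bar> \<le> Rx x"
      unfolding A_eq B_eq using e by (auto simp: abs_le_iff)
  qed
  note AB_eq = AB_eq[OF e, of x]
  have sym: "offH\<^sup>2 + offG\<^sup>2 + 2 * offH * offG * cos x = symbol_sq x" "offG\<^sup>2 + offH\<^sup>2 + 2 * offG * offH * cos x = symbol_sq x"
    by (simp_all add: symbol_sq_def)
  show ?thesis
  proof (cases n rule: int_parity_cases)
    case zero
    then show ?thesis using even[of 0] spec_coeff_even[OF e x, of 0] by simp
  next
    case (pos_even m)
    show ?thesis unfolding pos_even spec_coeff_even[OF e x] by (rule even)
  next
    case (neg_even m)
    show ?thesis unfolding neg_even spec_coeff_neg_even[OF e x] by (rule even)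
  next
    case (pos_odd m)
    show ?thesis unfolding pos_odd spec_coeff_odd[OF e x] by (rule odd[OF sym(1) AB_eq AB(2)])
  next
    case (neg_odd m)
    show ?thesis unfolding neg_odd spec_coeff_neg_odd[OF e x]
      by (rule odd[OF sym(2) _ AB(1)]) (simp add: AB_eq mult.commute)
  qed
qed

text \<open>The coefficient itself contains \<^const>\<open>matrix_inv\<close>. It is measurable because on the interval
  it agrees with a closed form that is measurable on the whole line.\<close>

lemma spec_coeff_measurable:
  assumes e: "\<epsilon> \<in> {1, -1}"
  shows "\<exists>h\<in>borel_measurable borel. \<forall>x\<in>{0<..<pi}. spec_coeff \<epsilon> x n = h x"
proof -
  have [measurable]: "symbol_sq \<in> borel_measurable borel" unfolding symbol_sq_def[abs_def] by measurable
  have [measurable]: "phase \<in> borel_measurable borel" unfolding phase_def[abs_def] by measurable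
  have [measurable]: "(\<lambda>x. Rx x) \<in> borel_measurable borel" unfolding R_eq by measurable
  have [measurable]: "weight \<in> borel_measurable borel" unfolding weight_def[abs_def] by measurable
  have [measurable]: "(\<lambda>x. wave \<epsilon> x k) \<in> borel_measurable borel" for k unfolding wave_def[abs_def] by measurable
  have [measurable]: "(\<lambda>x. Ax \<epsilon> x) \<in> borel_measurable borel" "(\<lambda>x. Bx \<epsilon> x) \<in> borel_measurable borel"
    unfolding A_eq B_eq by measurable
  have even: "(\<lambda>x. weight x * wave \<epsilon> x k) \<in> borel_measurable borel" for k by measurable
  have odd: "(\<lambda>x. weight x * (a * wave \<epsilon> x k + b * wave \<epsilon> x (k + 1)) / Ax \<epsilon> x) \<in> borel_measurable borel"
    "(\<lambda>x. weight x * (a * wave \<epsilon> x k + b * wave \<epsilon> x (k + 1)) / Bx \<epsilon> x) \<in> borel_measurable borel" for a b k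
    by measurable
  show ?thesis
  proof (cases n rule: int_parity_cases)
    case zero
    show ?thesis by (rule bexI[OF _ even[of 0]]) (use spec_coeff_even[OF e, of _ 0] zero in simp)
  next
    case (pos_even m)
    show ?thesis by (rule bexI[OF _ even[of "real (Suc m)"]]) (use spec_coeff_even[OF e, of _ "Suc m"] pos_even in simp)
  next
    case (neg_even m)
    show ?thesis by (rule bexI[OF _ even[of "real (Suc m)"]]) (use spec_coeff_neg_even[OF e, of _ "Suc m"] neg_even in simp)
  next
    case (pos_odd m)
    show ?thesis by (rule bexI[OF _ odd(1)[of offH "real m" offG]]) (use spec_coeff_odd[OF e, of _ m] pos_odd in simp)
  next
    case (neg_odd m)
    show ?thesis by (rule bexI[OF _ odd(2)[of offG "real m" offH]]) (use spec_coeff_neg_odd[OF e, of _ m] neg_odd in simp)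
  qed
qed

lemma continuous_lam: "continuous_on UNIV (\<lambda>x. lam \<epsilon> x)"
  unfolding lambda_fun_def R_eq symbol_sq_def using kap_pos by (intro continuous_intros) auto

lemma bounded_comp_lam:
  fixes \<phi> :: "real \<Rightarrow> real"
  assumes "continuous_on UNIV \<phi>"
  shows "\<exists>K. \<forall>\<epsilon>\<in>{1, -1}. \<forall>x\<in>{0<..<pi}. \<bar>\<phi> (lam \<epsilon> x)\<bar> \<le> K"
proof -
  have "\<exists>K. \<forall>x\<in>{0<..<pi}. \<bar>\<phi> (lam \<epsilon> x)\<bar> \<le> K" for \<epsilon>
  proof -
    have "continuous_on {0..pi} (\<lambda>x. \<phi> (lam \<epsilon> x))"
      by (rule continuous_on_compose2[OF assms continuous_on_subset[OF continuous_lam]]) auto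
    then have "bounded ((\<lambda>x. \<phi> (lam \<epsilon> x)) ` {0..pi})"
      by (intro compact_imp_bounded compact_continuous_image) auto
    then show ?thesis unfolding bounded_iff by force
  qed
  from this[of 1] this[of "-1"] obtain K1 K2 where
    "\<forall>x\<in>{0<..<pi}. \<bar>\<phi> (lam 1 x)\<bar> \<le> K1" "\<forall>x\<in>{0<..<pi}. \<bar>\<phi> (lam (-1) x)\<bar> \<le> K2" by blast
  then show ?thesis by (intro exI[of _ "max K1 K2"]) force
qed

lemma integrable_spectral:
  assumes "continuous_on UNIV \<phi>"
  shows "set_integrable lborel {0<..<pi} (\<lambda>x. \<Sum>\<epsilon>\<in>{1, -1}. \<phi> (lam \<epsilon> x) * spec_coeff \<epsilon> x n)"
proof -
  have "set_integrable lborel {0<..<pi} (\<lambda>x. \<phi> (lam \<epsilon> x) * spec_coeff \<epsilon> x n)" if e: "\<epsilon> \<in> {1, -1}" for \<epsilon>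
  proof -
    obtain h where h: "h \<in> borel_measurable borel" "\<And>x. 0 < x \<Longrightarrow> x < pi \<Longrightarrow> spec_coeff \<epsilon> x n = h x"
      using spec_coeff_measurable[OF e, of n] by auto
    obtain K where K: "\<And>x. 0 < x \<Longrightarrow> x < pi \<Longrightarrow> \<bar>\<phi> (lam \<epsilon> x)\<bar> \<le> K"
      using bounded_comp_lam[OF assms] e by (metis greaterThanLessThan_iff)
    have "continuous_on UNIV (\<lambda>x. \<phi> (lam \<epsilon> x))"
      by (rule continuous_on_compose2[OF assms continuous_lam]) auto
    then have m: "(\<lambda>x. \<phi> (lam \<epsilon> x)) \<in> borel_measurable borel" by (rule borel_measurable_continuous_onI)
    have "set_integrable lborel {0<..<pi} (\<lambda>x. \<phi> (lam \<epsilon> x) * h x)"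
    proof (rule set_integrable_bounded)
      show "(\<lambda>x. \<phi> (lam \<epsilon> x) * h x) \<in> borel_measurable borel" using m h(1) by measurable
      fix x :: real assume x: "0 < x" "x < pi"
      have "\<bar>h x\<bar> \<le> 1" using spec_coeff_bound[OF e x, of n] h(2)[OF x] by simp
      with K[OF x] show "\<bar>\<phi> (lam \<epsilon> x) * h x\<bar> \<le> K * 1"
        unfolding abs_mult by (intro mult_mono) auto
    qed
    then show ?thesis using h(2) by (subst set_integrable_cong[OF refl]) auto
  qed
  from this[of 1] this[of "-1"] show ?thesis by simp
qed

text \<open>The integral of \<open>\<phi>\<close> against the spectral measure of the Laplacian between the positions \<open>0\<close>
  and \<open>n\<close>.\<close>

definition spectral_pairing :: "(real \<Rightarrow> real) \<Rightarrow> int \<Rightarrow> real" where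
  "spectral_pairing \<phi> n =
     \<phi> (eigval1 M N \<omega>\<^sub>1 \<omega>\<^sub>2) * eigfun1 M N 0 * eigfun1 M N n
     + \<phi> (eigval2 M N \<omega>\<^sub>1 \<omega>\<^sub>2) * eigfun2 M N 0 * eigfun2 M N n
     + (LBINT x:{0<..<pi}. (\<Sum>\<epsilon>\<in>{1, -1}. \<phi> (lam \<epsilon> x) * spec_coeff \<epsilon> x n))"

text \<open>Completeness of the spectral data: the integrals of the total density cancel the products of
  the two eigenfunctions.\<close>

lemma spectral_pairing_one: "spectral_pairing (\<lambda>_. 1) n = (if n = 0 then 1 else 0)"
proof -
  have LB: "(LBINT x:{0<..<pi}. (\<Sum>\<epsilon>\<in>{1, -1}. 1 * spec_coeff \<epsilon> x n)) = I"
    if "(g has_integral I) {0..pi}" "\<And>x. 0 < x \<Longrightarrow> x < pi \<Longrightarrow> (\<Sum>\<epsilon>\<in>{1, -1}. spec_coeff \<epsilon> x n) = g x" for g I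
  proof -
    have int: "set_integrable lborel {0<..<pi} (\<lambda>x. \<Sum>\<epsilon>\<in>{1, -1}. 1 * spec_coeff \<epsilon> x n)"
      by (rule integrable_spectral) simp
    have "(g has_integral I) {0<..<pi}" using that(1) by (simp add: has_integral_Icc_iff_Ioo)
    then have "((\<lambda>x. \<Sum>\<epsilon>\<in>{1, -1}. 1 * spec_coeff \<epsilon> x n) has_integral I) {0<..<pi}"
      by (rule has_integral_eq[rotated]) (use that(2) in auto)
    then show ?thesis
      using set_borel_integral_eq_integral(2)[OF int] by (simp add: integral_unique)
  qed
  note f0 = eigfun1_values(1)[of 0] eigfun2_values(1)[of 0]
  show ?thesis
  proof (cases n rule: int_parity_cases)
    case zero
    then have z: "n = 2 * int 0" by simp
    note L = LB[OF plancherel_even[of 0] spec_coeff_sum_even(1)[of _ 0, folded z]]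
    show ?thesis using L f0 by (simp add: spectral_pairing_def zero)
  next
    case (pos_even m)
    note L = LB[OF plancherel_even[of "Suc m"] spec_coeff_sum_even(1)[of _ "Suc m", folded pos_even]]
    have "n \<noteq> 0" using pos_even by simp
    then show ?thesis
      using L f0 eigfun1_values(1)[of "Suc m", folded pos_even] eigfun2_values(1)[of "Suc m", folded pos_even]
      by (simp add: spectral_pairing_def)
  next
    case (neg_even m)
    note L = LB[OF plancherel_even[of "Suc m"] spec_coeff_sum_even(2)[of _ "Suc m", folded neg_even]]
    have "n \<noteq> 0" using neg_even by simp
    then show ?thesis
      using L f0 eigfun1_values(2)[of "Suc m", folded neg_even] eigfun2_values(2)[of "Suc m", folded neg_even]
      by (simp add: spectral_pairing_def)
  next
    case (pos_odd m)
    note L = LB[OF plancherel_odd[of m] spec_coeff_sum_odd(1)[of _ m, folded pos_odd]]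
    have "n \<noteq> 0" using pos_odd by simp
    then show ?thesis
      using L f0 eigfun1_values(3)[of m, folded pos_odd] eigfun2_values(3)[of m, folded pos_odd]
      by (simp add: spectral_pairing_def add_divide_distrib)
  next
    case (neg_odd m)
    note L = LB[OF plancherel_neg_odd[of m] spec_coeff_sum_odd(2)[of _ m, folded neg_odd]]
    have "n \<noteq> 0" using neg_odd by simp
    then show ?thesis
      using L f0 eigfun1_values(4)[of m, folded neg_odd] eigfun2_values(4)[of m, folded neg_odd]
      by (simp add: spectral_pairing_def)
  qed
qed

lemma jacobi_coefficients:
  obtains p q r where "\<And>v. jacobi v n = p * v (n - 1) + q * v n + r * v (n + 1)"
  unfolding jacobi_def by metis

text \<open>The eigenvalue equations of all components, integrated.\<close>

lemma spectral_pairing_mult: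
  assumes \<phi>: "continuous_on UNIV \<phi>"
  shows "spectral_pairing (\<lambda>l. l * \<phi> l) n = spectral_pairing \<phi> n - jacobi (spectral_pairing \<phi>) n / kap"
proof -
  obtain p q r where j: "\<And>v. jacobi v n = p * v (n - 1) + q * v n + r * v (n + 1)"
    using jacobi_coefficients by blast
  let ?l1 = "eigval1 M N \<omega>\<^sub>1 \<omega>\<^sub>2" and ?l2 = "eigval2 M N \<omega>\<^sub>1 \<omega>\<^sub>2"
  let ?I = "\<lambda>n x. \<Sum>\<epsilon>\<in>{1, -1}. \<phi> (lam \<epsilon> x) * spec_coeff \<epsilon> x n"
  let ?L = "\<lambda>n. LBINT x:{0<..<pi}. ?I n x"
  note int = integrable_spectral[OF \<phi>]
  have e1: "?l1 * eigfun1 M N n = eigfun1 M N n - jacobi (eigfun1 M N) n / kap"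
    unfolding eigfun1_jacobi using kap_pos
    by (simp add: eigval1_def field_simps) (simp add: kappa_def algebra_simps)
  have e2: "?l2 * eigfun2 M N n = eigfun2 M N n - jacobi (eigfun2 M N) n / kap"
    unfolding eigfun2_jacobi using kap_pos
    by (simp add: eigval2_def field_simps)
  have "(LBINT x:{0<..<pi}. (\<Sum>\<epsilon>\<in>{1, -1}. lam \<epsilon> x * \<phi> (lam \<epsilon> x) * spec_coeff \<epsilon> x n))
      = (LBINT x:{0<..<pi}. ?I n x - (p * ?I (n - 1) x + q * ?I n x + r * ?I (n + 1) x) / kap)"
  proof (intro set_lebesgue_integral_cong ballI allI impI)
    fix x :: real assume "x \<in> {0<..<pi}"
    then have x: "0 < x" "x < pi" by auto
    have "lam \<epsilon> x * spec_coeff \<epsilon> x n = spec_coeff \<epsilon> x n - jacobi (spec_coeff \<epsilon> x) n / kap" if "\<epsilon> \<in> {1, -1}" for \<epsilon>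
      unfolding spec_coeff_jacobi[OF that x] using kap_pos by (simp add: rho_fun_def left_diff_distrib)
    from this[of 1] this[of "-1"]
    have a: "lam \<epsilon> x * spec_coeff \<epsilon> x n = spec_coeff \<epsilon> x n
        - (p * spec_coeff \<epsilon> x (n - 1) + q * spec_coeff \<epsilon> x n + r * spec_coeff \<epsilon> x (n + 1)) / kap"
      if "\<epsilon> = 1 \<or> \<epsilon> = -1" for \<epsilon>
      using that unfolding j by auto
    have b: "lam \<epsilon> x * \<phi> (lam \<epsilon> x) * spec_coeff \<epsilon> x n = \<phi> (lam \<epsilon> x) * spec_coeff \<epsilon> x n
        - (p * (\<phi> (lam \<epsilon> x) * spec_coeff \<epsilon> x (n - 1)) + q * (\<phi> (lam \<epsilon> x) * spec_coeff \<epsilon> x n)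
          + r * (\<phi> (lam \<epsilon> x) * spec_coeff \<epsilon> x (n + 1))) / kap"
      if "\<epsilon> = 1 \<or> \<epsilon> = -1" for \<epsilon>
    proof -
      have "lam \<epsilon> x * \<phi> (lam \<epsilon> x) * spec_coeff \<epsilon> x n = \<phi> (lam \<epsilon> x) * (lam \<epsilon> x * spec_coeff \<epsilon> x n)" by simp
      also have "\<dots> = \<phi> (lam \<epsilon> x) * (spec_coeff \<epsilon> x n
        - (p * spec_coeff \<epsilon> x (n - 1) + q * spec_coeff \<epsilon> x n + r * spec_coeff \<epsilon> x (n + 1)) / kap)"
        unfolding a[OF that] ..
      finally show ?thesis by (simp add: right_diff_distrib distrib_left mult.left_commute)
    qed
    show "(\<Sum>\<epsilon>\<in>{1, -1}. lam \<epsilon> x * \<phi> (lam \<epsilon> x) * spec_coeff \<epsilon> x n)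
        = ?I n x - (p * ?I (n - 1) x + q * ?I n x + r * ?I (n + 1) x) / kap"
      using b[of 1] b[of "-1"] by (simp add: distrib_left add_divide_distrib)
  qed simp
  also have "\<dots> = ?L n - (p * ?L (n - 1) + q * ?L n + r * ?L (n + 1)) / kap"
    using int by (simp add: set_integral_diff set_integral_add set_integrable_mult_right set_integral_mult_right
      set_integral_divide_zero)
  finally have L: "(LBINT x:{0<..<pi}. (\<Sum>\<epsilon>\<in>{1, -1}. lam \<epsilon> x * \<phi> (lam \<epsilon> x) * spec_coeff \<epsilon> x n))
      = ?L n - (p * ?L (n - 1) + q * ?L n + r * ?L (n + 1)) / kap" .
  have "spectral_pairing (\<lambda>l. l * \<phi> l) n =
      \<phi> ?l1 * eigfun1 M N 0 * (?l1 * eigfun1 M N n) + \<phi> ?l2 * eigfun2 M N 0 * (?l2 * eigfun2 M N n)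
      + (?L n - (p * ?L (n - 1) + q * ?L n + r * ?L (n + 1)) / kap)"
    unfolding spectral_pairing_def L by simp
  also have "\<dots> = spectral_pairing \<phi> n - jacobi (spectral_pairing \<phi>) n / kap"
    unfolding e1 e2 j spectral_pairing_def by (simp add: algebra_simps add_divide_distrib)
  finally show ?thesis .
qed

lemma spectral_pairing_tendsto:
  fixes \<phi> :: "real \<Rightarrow> real" and \<psi> :: "nat \<Rightarrow> real \<Rightarrow> real"
  assumes cont: "\<And>k. continuous_on UNIV (\<psi> k)" "continuous_on UNIV \<phi>"
    and lim: "\<And>l. (\<lambda>k. \<psi> k l) \<longlonglongrightarrow> \<phi> l"
    and bound: "\<And>k \<epsilon> x. \<epsilon> \<in> {1, -1} \<Longrightarrow> x \<in> {0<..<pi} \<Longrightarrow> \<bar>\<psi> k (lam \<epsilon> x)\<bar> \<le> C"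
  shows "(\<lambda>k. spectral_pairing (\<psi> k) n) \<longlonglongrightarrow> spectral_pairing \<phi> n"
proof -
  let ?f = "\<lambda>\<phi> x. \<Sum>\<epsilon>\<in>{1, -1}. \<phi> (lam \<epsilon> x) * spec_coeff \<epsilon> x n"
  have "(\<lambda>k. LINT x|lborel. indicator {0<..<pi} x *\<^sub>R ?f (\<psi> k) x)
      \<longlonglongrightarrow> (LINT x|lborel. indicator {0<..<pi} x *\<^sub>R ?f \<phi> x)"
  proof (rule integral_dominated_convergence[where w = "\<lambda>x. indicator {0<..<pi} x *\<^sub>R (2 * C)"])
    show "(\<lambda>x. indicator {0<..<pi} x *\<^sub>R ?f \<phi> x) \<in> borel_measurable lborel"
      using integrable_spectral[OF cont(2), of n] unfolding set_integrable_def
      by (rule borel_measurable_integrable)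
    show "(\<lambda>x. indicator {0<..<pi} x *\<^sub>R ?f (\<psi> k) x) \<in> borel_measurable lborel" for k
      using integrable_spectral[OF cont(1), of k n] unfolding set_integrable_def
      by (rule borel_measurable_integrable)
    show "integrable lborel (\<lambda>x. indicator {0<..<pi} x *\<^sub>R (2 * C))" by simp
    show "AE x in lborel. (\<lambda>k. indicator {0<..<pi} x *\<^sub>R ?f (\<psi> k) x)
        \<longlonglongrightarrow> indicator {0<..<pi} x *\<^sub>R ?f \<phi> x"
      by (intro AE_I2 tendsto_intros lim)
    show "AE x in lborel. norm (indicator {0<..<pi} x *\<^sub>R ?f (\<psi> k) x) \<le> indicator {0<..<pi} x *\<^sub>R (2 * C)" for k
    proof (rule AE_I2)
      fix x :: real
      show "norm (indicator {0<..<pi} x *\<^sub>R ?f (\<psi> k) x) \<le> indicator {0<..<pi} x *\<^sub>R (2 * C)"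
      proof (cases "x \<in> {0<..<pi}")
        case True
        have "\<bar>\<psi> k (lam \<epsilon> x) * spec_coeff \<epsilon> x n\<bar> \<le> C * 1" if "\<epsilon> \<in> {1, -1}" for \<epsilon>
          unfolding abs_mult using bound[OF that True, of k] spec_coeff_bound[OF that, of x n] True
          by (intro mult_mono) auto
        from this[of 1] this[of "-1"]
        have "\<bar>?f (\<psi> k) x\<bar> \<le> 2 * C" by simp
        then show ?thesis using True by simp
      qed simp
    qed
  qed
  then show ?thesis
    unfolding spectral_pairing_def set_lebesgue_integral_def by (intro tendsto_intros lim)
qed

lemma spectral_pairing_poly:
  "spectral_pairing (\<lambda>l. \<Sum>j<k. c j * l ^ j) n = (\<Sum>j<k. c j * spectral_pairing (\<lambda>l. l ^ j) n)"
proof (induction k)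
  case 0
  then show ?case by (simp add: spectral_pairing_def set_lebesgue_integral_def)
next
  case (Suc k)
  let ?f = "\<lambda>\<phi> x. \<Sum>\<epsilon>\<in>{1, -1}. \<phi> (lam \<epsilon> x) * spec_coeff \<epsilon> x n"
  let ?p = "\<lambda>l. \<Sum>j<k. c j * l ^ j"
  have int: "set_integrable lborel {0<..<pi} (?f ?p)" "set_integrable lborel {0<..<pi} (?f (\<lambda>l. l ^ k))"
    by (rule integrable_spectral; intro continuous_intros)+
  have "(LBINT x:{0<..<pi}. ?f (\<lambda>l. \<Sum>j<Suc k. c j * l ^ j) x)
      = (LBINT x:{0<..<pi}. ?f ?p x + c k * ?f (\<lambda>l. l ^ k) x)"
    by (rule set_lebesgue_integral_cong) (simp_all add: distrib_right distrib_left)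
  also have "\<dots> = (LBINT x:{0<..<pi}. ?f ?p x) + (LBINT x:{0<..<pi}. c k * ?f (\<lambda>l. l ^ k) x)"
    by (rule set_integral_add(2)[OF int(1) set_integrable_mult_right[OF int(2)]])
  also have "(LBINT x:{0<..<pi}. c k * ?f (\<lambda>l. l ^ k) x) = c k * (LBINT x:{0<..<pi}. ?f (\<lambda>l. l ^ k) x)"
    by (rule set_integral_mult_right)
  finally have "spectral_pairing (\<lambda>l. \<Sum>j<Suc k. c j * l ^ j) n = spectral_pairing ?p n + c k * spectral_pairing (\<lambda>l. l ^ k) n"
    unfolding spectral_pairing_def by (simp add: algebra_simps)
  then show ?case using Suc by simp
qed

text \<open>On the spectrum, which is bounded, the partial sums of the exponential series are dominated by
  a constant.\<close>

lemma spectral_pairing_exp: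
  "(\<lambda>j. (- t) ^ j / fact j * spectral_pairing (\<lambda>l. l ^ j) n) sums spectral_pairing (\<lambda>l. exp (- t * l)) n"
proof -
  let ?p = "\<lambda>k l. \<Sum>j<k. (- t) ^ j / fact j * l ^ j"
  obtain L where L: "\<And>\<epsilon> x. \<epsilon> \<in> {1, -1} \<Longrightarrow> x \<in> {0<..<pi} \<Longrightarrow> \<bar>lam \<epsilon> x\<bar> \<le> L"
    using bounded_comp_lam[of "\<lambda>l. l"] by (metis continuous_on_id)
  have sums: "(\<lambda>j. s ^ j / fact j) sums exp s" for s :: real
    using exp_converges[of s] by (simp add: inverse_eq_divide)
  have "(\<lambda>k. spectral_pairing (?p k) n) \<longlonglongrightarrow> spectral_pairing (\<lambda>l. exp (- t * l)) n"
  proof (rule spectral_pairing_tendsto[where C = "exp (\<bar>t\<bar> * L)"])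
    show "(\<lambda>k. ?p k l) \<longlonglongrightarrow> exp (- t * l)" for l
      using sums[of "- t * l"] by (simp add: sums_def power_mult_distrib flip: power_mult_distrib)
    fix k and \<epsilon> x :: real assume e: "\<epsilon> \<in> {1, -1}" and x: "x \<in> {0<..<pi}"
    have "\<bar>?p k (lam \<epsilon> x)\<bar> \<le> (\<Sum>j<k. (\<bar>t\<bar> * L) ^ j / fact j)"
    proof (rule order_trans[OF sum_abs sum_mono])
      fix j
      have "\<bar>t * lam \<epsilon> x\<bar> ^ j \<le> (\<bar>t\<bar> * L) ^ j"
        unfolding abs_mult using L[OF e x] by (intro power_mono mult_left_mono) auto
      then show "\<bar>(- t) ^ j / fact j * lam \<epsilon> x ^ j\<bar> \<le> (\<bar>t\<bar> * L) ^ j / fact j"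
        by (simp add: abs_mult power_abs power_mult_distrib divide_right_mono)
    qed
    also have "\<dots> \<le> exp (\<bar>t\<bar> * L)"
    proof -
      have "0 \<le> \<bar>t\<bar> * L" using L[OF e x] by simp
      then show ?thesis
        unfolding sums_unique[OF sums[of "\<bar>t\<bar> * L"]] using sums[of "\<bar>t\<bar> * L"]
        by (intro sum_le_suminf) (auto simp: sums_iff)
    qed
    finally show "\<bar>?p k (lam \<epsilon> x)\<bar> \<le> exp (\<bar>t\<bar> * L)" .
  qed (intro continuous_intros)+
  then show ?thesis unfolding sums_def spectral_pairing_poly .
qed

lemma spectral_integrand_eq:
  "spectral_integrand M N \<omega>\<^sub>1 \<omega>\<^sub>2 t n = (\<lambda>x. \<Sum>\<epsilon>\<in>{1, -1}. exp (- t * lam \<epsilon> x) * spec_coeff \<epsilon> x n)"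
  by (simp add: fun_eq_iff spectral_integrand_def spec_coeff_def)

text \<open>Here \<open>s\<close> stands for the sphere sizes. Their growth by the factors \<open>M\<close> and \<open>N\<close> turns the
  transition numbers \<open>1\<close> and \<open>M\<close> of an edge into their common geometric mean \<open>sqrt M\<close>, and
  likewise for \<open>N\<close>.\<close>

lemma radial_adjacency_symmetrised:
  assumes pos: "\<And>n. s n > 0"
    and step: "\<And>n e. n = 0 \<and> \<bar>e\<bar> = 1 \<or> n \<noteq> 0 \<and> e = sgn n \<Longrightarrow>
      s (n + e) = s n * (if (e > 0) = odd n then real M else real N)"
  shows "radial_adjacency M N \<omega>\<^sub>1 \<omega>\<^sub>2 (\<lambda>n. v n / sqrt (s n)) n = jacobi v n / sqrt (s n)"
proof -
  have out: "v m / sqrt (s (n + e)) = v m / sqrt (s n) / (if (e > 0) = odd n then sM else sN)"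
    if "n = 0 \<and> \<bar>e\<bar> = 1 \<or> n \<noteq> 0 \<and> e = sgn n" for m e
    unfolding step[OF that] by (simp add: real_sqrt_mult)
  show ?thesis
  proof (cases "n = 0")
    case True
    have at: "v 1 / sqrt (s 1) = v 1 / sqrt (s 0) / sN" "v (-1) / sqrt (s (-1)) = v (-1) / sqrt (s 0) / sM"
      using out[of 1 1] out[of "-1" "-1"] True by simp_all
    have "radial_adjacency M N \<omega>\<^sub>1 \<omega>\<^sub>2 (\<lambda>n. v n / sqrt (s n)) n
        = real M * \<omega>\<^sub>1 * (v (-1) / sqrt (s (-1))) + real N * \<omega>\<^sub>2 * (v 1 / sqrt (s 1))"
      using True by (simp add: radial_adjacency_def)
    also have "\<dots> = real M * \<omega>\<^sub>1 * (v (-1) / sqrt (s 0) / sM) + real N * \<omega>\<^sub>2 * (v 1 / sqrt (s 0) / sN)"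
      unfolding at ..
    also have "\<dots> = (offG * v (-1) + offH * v 1) / sqrt (s 0)"
      using MN_pos pos[of 0] by (simp add: offG_def offH_def field_simps sq_sqrt)
    finally show ?thesis using True by (simp add: jacobi_def)
  next
    case False
    define e where "e = sgn n"
    have e: "e = 1 \<or> e = -1" "(n > 0) = (e > 0)" "odd e" using False by (auto simp: e_def sgn_if)
    have fwd: "v (n + e) / sqrt (s (n + e)) = v (n + e) / sqrt (s n) / (if (n > 0) = odd n then sM else sN)"
      unfolding e(2) by (rule out) (use False in \<open>simp add: e_def\<close>)
    have "n - e = 0 \<and> \<bar>e\<bar> = 1 \<or> n - e \<noteq> 0 \<and> e = sgn (n - e)"
      using False by (auto simp: e_def sgn_if)
    note step = step[OF this]
    have "n - e + e = n" "odd (n - e) = even n" using e(3) by simp_all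
    then have "s n = s (n - e) * (if (n > 0) = even n then real M else real N)"
      using step unfolding e(2) by (simp only:)
    then have bwd: "v (n - e) / sqrt (s (n - e)) = v (n - e) / sqrt (s n) * (if (n > 0) = even n then sM else sN)"
      using MN_pos by (simp add: real_sqrt_mult)
    show ?thesis
    proof (cases "(n > 0) = even n")
      case True
      have "radial_adjacency M N \<omega>\<^sub>1 \<omega>\<^sub>2 (\<lambda>n. v n / sqrt (s n)) n
          = \<omega>\<^sub>1 * (v (n - e) / sqrt (s (n - e)) + (real M - 1) * (v n / sqrt (s n))) + real N * \<omega>\<^sub>2 * (v (n + e) / sqrt (s (n + e)))"
        using False True by (auto simp: radial_adjacency_def e_def)
      also have "\<dots> = \<omega>\<^sub>1 * (v (n - e) / sqrt (s n) * sM + (real M - 1) * (v n / sqrt (s n)))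
          + real N * \<omega>\<^sub>2 * (v (n + e) / sqrt (s n) / sN)"
        unfolding fwd bwd using True by auto
      also have "\<dots> = (offG * v (n - e) + diagG * v n + offH * v (n + e)) / sqrt (s n)"
        using MN_pos pos[of n] by (simp add: offG_def offH_def diagG_def field_simps sq_sqrt)
      also have "offG * v (n - e) + diagG * v n + offH * v (n + e) = jacobi v n"
        using True False e by (auto simp: jacobi_def)
      finally show ?thesis .
    next
      case no: False
      have "radial_adjacency M N \<omega>\<^sub>1 \<omega>\<^sub>2 (\<lambda>n. v n / sqrt (s n)) n
          = \<omega>\<^sub>2 * (v (n - e) / sqrt (s (n - e)) + (real N - 1) * (v n / sqrt (s n))) + real M * \<omega>\<^sub>1 * (v (n + e) / sqrt (s (n + e)))"
        using False no by (auto simp: radial_adjacency_def e_def)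
      also have "\<dots> = \<omega>\<^sub>2 * (v (n - e) / sqrt (s n) * sN + (real N - 1) * (v n / sqrt (s n)))
          + real M * \<omega>\<^sub>1 * (v (n + e) / sqrt (s n) / sM)"
        unfolding fwd bwd using no by auto
      also have "\<dots> = (offH * v (n - e) + diagH * v n + offG * v (n + e)) / sqrt (s n)"
        using MN_pos pos[of n] by (simp add: offG_def offH_def diagH_def field_simps sq_sqrt)
      also have "offH * v (n - e) + diagH * v n + offG * v (n + e) = jacobi v n"
        using no False e by (auto simp: jacobi_def)
      finally show ?thesis .
    qed
  qed
qed

end

section \<open>The heat kernel\<close>

theorem theorem1p2:
  fixes G :: "('a, 'c) monoid_scheme" and H :: "('b, 'd) monoid_scheme"
    and M N :: nat and \<omega>\<^sub>1 \<omega>\<^sub>2 t :: real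
  assumes "group G" and "group H"
    and "finite (carrier G)" and "finite (carrier H)"
    and "card (carrier G) = M + 1" and "card (carrier H) = N + 1"
    and "2 \<le> card (carrier G)" and "card (carrier G) < card (carrier H)"
    and "\<omega>\<^sub>1 > 0" and "\<omega>\<^sub>2 > 0" and "t \<ge> 0"
  shows "(\<forall>n. set_integrable lborel {0<..<pi} (spectral_integrand M N \<omega>\<^sub>1 \<omega>\<^sub>2 t n)) \<and>
    (\<forall>k. is_heat_kernel G H \<omega>\<^sub>1 \<omega>\<^sub>2 t k \<longleftrightarrow>
      (\<forall>x\<in>carrier (free_product G H). k x = heat_profile G H M N \<omega>\<^sub>1 \<omega>\<^sub>2 t (pi_e x)))"
proof -
  interpret B: free_product_graph G H M N \<omega>\<^sub>1 \<omega>\<^sub>2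
    by (rule free_product_graph.intro) (use assms in auto)
  interpret S: spectral_data M N \<omega>\<^sub>1 \<omega>\<^sub>2
    by unfold_locales (use assms in auto)
  have MN: "0 < M" "0 < N" using S.MN_pos by auto
  \<comment> \<open>The radial profile of the \<open>j\<close>-th power of the Laplacian applied to the point mass at the identity.\<close>
  define g where "g j n = S.spectral_pairing (\<lambda>l. l ^ j) n / sqrt (real (card (B.sphere n)))" for j n
  have g_step: "g (Suc j) n = g j n - radial_adjacency M N \<omega>\<^sub>1 \<omega>\<^sub>2 (g j) n / kappa M N \<omega>\<^sub>1 \<omega>\<^sub>2" for j n
  proof -
    have "radial_adjacency M N \<omega>\<^sub>1 \<omega>\<^sub>2 (g j) n
        = S.jacobi (S.spectral_pairing (\<lambda>l. l ^ j)) n / sqrt (real (card (B.sphere n)))"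
      unfolding g_def
      by (rule S.radial_adjacency_symmetrised)
        (use B.card_sphere_pos[OF MN] B.card_sphere_step in \<open>auto simp: of_nat_mult\<close>)
    moreover have "S.spectral_pairing (\<lambda>l. l ^ Suc j) n = S.spectral_pairing (\<lambda>l. l ^ j) n
        - S.jacobi (S.spectral_pairing (\<lambda>l. l ^ j)) n / kappa M N \<omega>\<^sub>1 \<omega>\<^sub>2"
      using S.spectral_pairing_mult[of "\<lambda>l. l ^ j" n] by (simp add: continuous_intros)
    ultimately show ?thesis unfolding g_def[of "Suc j" n] g_def[of j n] by (simp add: diff_divide_distrib mult.commute)
  qed
  have g_0: "g 0 n = (if n = 0 then 1 else 0)" for n
    using S.spectral_pairing_one[of n] by (simp add: g_def B.sphere_0)
  have profile: "heat_profile G H M N \<omega>\<^sub>1 \<omega>\<^sub>2 t n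
      = S.spectral_pairing (\<lambda>l. exp (- t * l)) n / sqrt (real (card (B.sphere n)))" for n
    by (simp add: heat_profile_def B.sphere_def S.spectral_pairing_def S.spectral_integrand_eq)
  have "(\<Sum>j. (B.heat_gen t ^^ j) (point_mass []) x / fact j) = of_real (heat_profile G H M N \<omega>\<^sub>1 \<omega>\<^sub>2 t (pi_e x))"
    if x: "x \<in> carrier (free_product G H)" for x
  proof -
    have "(\<lambda>j. (- t) ^ j / fact j * S.spectral_pairing (\<lambda>l. l ^ j) (pi_e x) / sqrt (real (card (B.sphere (pi_e x)))))
        sums heat_profile G H M N \<omega>\<^sub>1 \<omega>\<^sub>2 t (pi_e x)"
      unfolding profile by (intro sums_divide S.spectral_pairing_exp)
    then have "(\<lambda>j. (- t) ^ j * g j (pi_e x) / fact j) sums heat_profile G H M N \<omega>\<^sub>1 \<omega>\<^sub>2 t (pi_e x)"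
      by (simp add: g_def mult.commute)
    from sums_of_real[OF this, where 'a = complex]
    show ?thesis
      using B.heat_gen_pow_radial[where g = g and t = t, OF g_0 g_step x] by (simp add: sums_iff)
  qed
  then have "is_heat_kernel G H \<omega>\<^sub>1 \<omega>\<^sub>2 t k \<longleftrightarrow>
      (\<forall>x\<in>carrier (free_product G H). k x = heat_profile G H M N \<omega>\<^sub>1 \<omega>\<^sub>2 t (pi_e x))" for k
    unfolding B.is_heat_kernel_iff by simp
  moreover have "set_integrable lborel {0<..<pi} (spectral_integrand M N \<omega>\<^sub>1 \<omega>\<^sub>2 t n)" for n
    unfolding S.spectral_integrand_eq by (rule S.integrable_spectral) (intro continuous_intros)
  ultimately show ?thesis by blast
qed

end
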